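(* Let $G$ be a $6$-dimensional Lie group with a left-invariant non-parallelizable complex structure $J$ admitting a left-invariant $(1,0)$-coframe $\{\zeta^1,\zeta^2,\zeta^3\}$ such that $$d\zeta^1=d\zeta^2=0,\qquad d\zeta^3=\rho\,\zeta^{12}+\zeta^{1\bar1}+(x+iy)\,\zeta^{2\bar2},$$ with $x,y\in\mathbb R$ and $\rho\in\{0,1\}$. Let $E=T^{1,0}G$ and $\Psi=\zeta^1\wedge\zeta^2\wedge\zeta^3$, and consider left-invariant solutions $(\omega_t,H_t)$ of the flow $$\partial_t(\Vert\Psi\Vert_{\omega_t}\omega_t^2)= i\partial\overline\partial\omega_t-\frac{\alpha'}{4}\big(\mathrm{Tr}(Rm^\tau_t\wedge Rm^\tau_t)-\mathrm{Tr}(A^\kappa_t\wedge A^\kappa_t)\big),\qquad H_t^{-1}\partial_t H_t=\frac{\omega_t^2\wedge A_t^\kappa}{\omega_t^3}.$$ If the initial left-invariant Hermitian metrics $\omega_0$ and $H_0$ are both diagonal, then $\omega_t$ and $H_t$ remain diagonal along the flow.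
   Context: Notation: $\zeta^{i\bar j}=\zeta^i\wedge\overline{\zeta^j}$. "Non-parallelizable" means $(G,J)$ is not a complex Lie group. A left-invariant Hermitian metric is diagonal if its fundamental form is $\frac i2(r^2\zeta^{1\bar1}+s^2\zeta^{2\bar2}+k^2\zeta^{3\bar3})$ with $r,s,k\in\mathbb R\setminus\{0\}$ (for $H_t$ with coefficients $\tilde r,\tilde s,\tilde k$); Hermitian metrics on $E=T^{1,0}G$ are identified with $J$-Hermitian metrics on $G$. For $\omega=\frac i2\sum h_{j\bar l}\,\zeta^{j\bar l}$ with $(h_{j\bar l})$ positive definite Hermitian, $\Vert\Psi\Vert_\omega^2=8/\det(h_{j\bar l})$. For a Hermitian metric, the Gauduchon connections are $\nabla^\tau=\frac{1+\tau}2\nabla^1+\frac{1-\tau}2\nabla^{-1}$, $\nabla^1$ being the Chern connection and $\nabla^{-1}$ the Strominger–Bismut connection (the Hermitian connection with totally skew torsion). $Rm^\tau_t$ is the curvature of the Gauduchon connection $\nabla^\tau$ of $\omega_t$ and $A^\kappa_t$ the curvature of the Gauduchon connection $\nabla^\kappa$ of $H_t$. $\mathrm{Tr}(\Omega\wedge\Omega)=\sum_{i<j}\Omega^i_j\wedge\Omega^i_j$ in a real frame orthonormal for the metric defining the connection. $\alpha',\tau,\kappa\in\mathbb R$ are constants. In the second equation the curvature is normalized, as is customary, so that the right-hand side is an $H_t$-self-adjoint endomorphism of $E$ (factor $i$ absorbed). *)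

theory Defs
  imports "HOL-Analysis.Analysis"
begin

text \<open>The predicate below is meant for open \<open>S\<close>.\<close>

primrec Ck_on :: "nat \<Rightarrow> 'x::euclidean_space set \<Rightarrow> ('x \<Rightarrow> 'y::real_normed_vector) \<Rightarrow> bool" where
  "Ck_on 0 S f \<longleftrightarrow> continuous_on S f"
| "Ck_on (Suc k) S f \<longleftrightarrow>
     f differentiable_on S \<and> (\<forall>v. Ck_on k S (\<lambda>x. frechet_derivative f (at x) v))"

definition smooth_on :: "'x::euclidean_space set \<Rightarrow> ('x \<Rightarrow> 'y::real_normed_vector) \<Rightarrow> bool" where
  "smooth_on S f \<longleftrightarrow> (\<forall>k. Ck_on k S f)"

text \<open>A chart is a pair \<open>(U, \<phi>)\<close>; only the values of \<open>\<phi>\<close> on \<open>U\<close> matter, and its inverse is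
  \<open>inv_into U \<phi>\<close>.\<close>

definition chart :: "'a::topological_space set \<times> ('a \<Rightarrow> 'e::euclidean_space) \<Rightarrow> bool" where
  "chart c \<longleftrightarrow> (case c of (U, \<phi>) \<Rightarrow>
     open U \<and> open (\<phi> ` U) \<and> inj_on \<phi> U \<and> continuous_on U \<phi> \<and> continuous_on (\<phi> ` U) (inv_into U \<phi>))"

definition smooth_atlas :: "('a::topological_space set \<times> ('a \<Rightarrow> 'e::euclidean_space)) set \<Rightarrow> bool" where
  "smooth_atlas \<A> \<longleftrightarrow>
     (\<forall>c\<in>\<A>. chart c) \<and> (\<Union>c\<in>\<A>. fst c) = UNIV \<and>
     (\<forall>(U, \<phi>)\<in>\<A>. \<forall>(V, \<theta>)\<in>\<A>. smooth_on (\<phi> ` (U \<inter> V)) (\<theta> \<circ> inv_into U \<phi>))"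

locale lie_group =
  group mul e inverse
  for mul :: "'a::{t2_space, second_countable_topology} \<Rightarrow> 'a \<Rightarrow> 'a" and e and inverse +
  fixes \<A> :: "('a set \<times> ('a \<Rightarrow> 'e::euclidean_space)) set"
  assumes atlas: "smooth_atlas \<A>"
    and continuous_mult: "continuous_on UNIV (\<lambda>(x, y). mul x y)"
    and continuous_inverse: "continuous_on UNIV inverse"
    and smooth_mult: "\<lbrakk>(U, \<phi>) \<in> \<A>; (V, \<theta>) \<in> \<A>; (W, \<xi>) \<in> \<A>\<rbrakk> \<Longrightarrow>
      smooth_on ((\<lambda>(x, y). (\<phi> x, \<theta> y)) ` {(x, y). x \<in> U \<and> y \<in> V \<and> mul x y \<in> W})
        (\<lambda>(p, q). \<xi> (mul (inv_into U \<phi> p) (inv_into V \<theta> q)))"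
    and smooth_inverse: "\<lbrakk>(U, \<phi>) \<in> \<A>; (W, \<xi>) \<in> \<A>\<rbrakk> \<Longrightarrow>
      smooth_on (\<phi> ` {x \<in> U. inverse x \<in> W}) (\<lambda>p. \<xi> (inverse (inv_into U \<phi> p)))"

definition smooth_functions ::
    "('a::topological_space set \<times> ('a \<Rightarrow> 'e::euclidean_space)) set \<Rightarrow> ('a \<Rightarrow> real) set" where
  "smooth_functions \<A> = {f. \<forall>(U, \<phi>)\<in>\<A>. smooth_on (\<phi> ` U) (f \<circ> inv_into U \<phi>)}"

text \<open>Vector fields are treated as derivations of the algebra of smooth functions.\<close>

definition left_invariant_field ::
    "('a::topological_space set \<times> ('a \<Rightarrow> 'e::euclidean_space)) set \<Rightarrow> ('a \<Rightarrow> 'a \<Rightarrow> 'a)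
      \<Rightarrow> (('a \<Rightarrow> real) \<Rightarrow> 'a \<Rightarrow> real) \<Rightarrow> bool" where
  "left_invariant_field \<A> mul X \<longleftrightarrow> (let C = smooth_functions \<A> in
     (\<forall>f\<in>C. X f \<in> C) \<and>
     (\<forall>f\<in>C. \<forall>g\<in>C. \<forall>a b. X (\<lambda>x. a * f x + b * g x) = (\<lambda>x. a * X f x + b * X g x)) \<and>
     (\<forall>f\<in>C. \<forall>g\<in>C. X (\<lambda>x. f x * g x) = (\<lambda>x. X f x * g x + f x * X g x)) \<and>
     (\<forall>f\<in>C. \<forall>a. X (\<lambda>x. f (mul a x)) = (\<lambda>x. X f (mul a x))))"

text \<open>The vector space \<open>'g\<close> with the bracket \<open>br\<close> is the Lie algebra of the group: \<open>L\<close> is a linear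
  bijection onto the left-invariant vector fields, taking \<open>br\<close> to the commutator. From here on,
  left-invariant tensors are multilinear maps on \<open>'g\<close>.\<close>

definition lie_algebra_of ::
    "('a::topological_space set \<times> ('a \<Rightarrow> 'e::euclidean_space)) set \<Rightarrow> ('a \<Rightarrow> 'a \<Rightarrow> 'a)
      \<Rightarrow> ('g::real_vector \<Rightarrow> ('a \<Rightarrow> real) \<Rightarrow> 'a \<Rightarrow> real) \<Rightarrow> ('g \<Rightarrow> 'g \<Rightarrow> 'g) \<Rightarrow> bool" where
  "lie_algebra_of \<A> mul L br \<longleftrightarrow> (let C = smooth_functions \<A> in
     (\<forall>u. left_invariant_field \<A> mul (L u)) \<and>
     (\<forall>X. left_invariant_field \<A> mul X \<longrightarrow> (\<exists>!u. \<forall>f\<in>C. X f = L u f)) \<and>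
     (\<forall>u v a b. \<forall>f\<in>C. L (a *\<^sub>R u + b *\<^sub>R v) f = (\<lambda>x. a * L u f x + b * L v f x)) \<and>
     (\<forall>u v. \<forall>f\<in>C. L (br u v) f = (\<lambda>x. L u (L v f) x - L v (L u f) x)))"

definition complex_structure :: "('g::real_vector \<Rightarrow> 'g \<Rightarrow> 'g) \<Rightarrow> ('g \<Rightarrow> 'g) \<Rightarrow> bool" where
  "complex_structure br J \<longleftrightarrow> linear J \<and> (\<forall>u. J (J u) = - u) \<and>
     (\<forall>u v. br (J u) (J v) - br u v - J (br (J u) v) - J (br u (J v)) = 0)"

text \<open>A left-invariant complex structure makes the group a complex Lie group iff it is preserved by
  all right translations. The premise below says that the push-forward of \<open>L u\<close> under right
  translation by \<open>a\<close> is \<open>L w\<close>.\<close>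

definition complex_lie_group ::
    "('a::topological_space set \<times> ('a \<Rightarrow> 'e::euclidean_space)) set \<Rightarrow> ('a \<Rightarrow> 'a \<Rightarrow> 'a)
      \<Rightarrow> ('g::real_vector \<Rightarrow> ('a \<Rightarrow> real) \<Rightarrow> 'a \<Rightarrow> real) \<Rightarrow> ('g \<Rightarrow> 'g) \<Rightarrow> bool" where
  "complex_lie_group \<A> mul L J \<longleftrightarrow> (let C = smooth_functions \<A> in
     \<forall>a u w.
       (\<forall>f\<in>C. \<forall>x. L w f (mul x a) = L u (\<lambda>y. f (mul y a)) x) \<longrightarrow>
       (\<forall>f\<in>C. \<forall>x. L (J w) f (mul x a) = L (J u) (\<lambda>y. f (mul y a)) x))"

text \<open>A complex-valued \<open>k\<close>-form is a function of a sequence of vectors that depends only on the first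
  \<open>k\<close> of them. The wedge product is normalised by \<open>(\<alpha> \<and> \<beta>)(u, v) = \<alpha> u \<beta> v - \<alpha> v \<beta> u\<close> for
  1-forms, and the differential by \<open>d\<alpha>(u, v) = - \<alpha>[u, v]\<close>.\<close>

type_synonym 'g form = "(nat \<Rightarrow> 'g) \<Rightarrow> complex"

definition form1 :: "('g \<Rightarrow> complex) \<Rightarrow> 'g form" where
  "form1 \<alpha> = (\<lambda>v. \<alpha> (v 0))"

definition wedge :: "nat \<Rightarrow> nat \<Rightarrow> 'g form \<Rightarrow> 'g form \<Rightarrow> 'g form" where
  "wedge p q \<alpha> \<beta> = (\<lambda>v.
     (\<Sum>\<sigma> | \<sigma> permutes {..<p + q}.
        of_int (sign \<sigma>) * \<alpha> (\<lambda>i. v (\<sigma> i)) * \<beta> (\<lambda>i. v (\<sigma> (p + i)))) / (fact p * fact q))"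

text \<open>For \<open>i < j\<close>: the sequence \<open>[v i, v j], v 0, v 1, \<dots>\<close> with \<open>v i\<close> and \<open>v j\<close> left out of the tail.\<close>

definition bracket_args :: "('g \<Rightarrow> 'g \<Rightarrow> 'g) \<Rightarrow> nat \<Rightarrow> nat \<Rightarrow> (nat \<Rightarrow> 'g) \<Rightarrow> nat \<Rightarrow> 'g" where
  "bracket_args br i j v = (\<lambda>m. case m of
       0 \<Rightarrow> br (v i) (v j)
     | Suc n \<Rightarrow> v (if n < i then n else if Suc n < j then Suc n else Suc (Suc n)))"

definition ext_deriv :: "('g \<Rightarrow> 'g \<Rightarrow> 'g) \<Rightarrow> nat \<Rightarrow> 'g form \<Rightarrow> 'g form" where
  "ext_deriv br k \<alpha> = (\<lambda>v. \<Sum>j<Suc k. \<Sum>i<j. (-1) ^ (i + j) * \<alpha> (bracket_args br i j v))"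

text \<open>The \<open>(p, q)\<close>-part of a \<open>(p + q)\<close>-form \<open>\<alpha>\<close>: extend \<open>\<alpha>\<close> complex-multilinearly, insert
  \<open>(v - i J v) / 2\<close> in \<open>p\<close> of the slots (those in \<open>S\<close>) and \<open>(v + i J v) / 2\<close> in the others, and sum
  over all choices of \<open>S\<close>.\<close>

definition type_part :: "('g \<Rightarrow> 'g) \<Rightarrow> nat \<Rightarrow> nat \<Rightarrow> 'g form \<Rightarrow> 'g form" where
  "type_part J p q \<alpha> = (\<lambda>v.
     (\<Sum>S | S \<subseteq> {..<p + q} \<and> card S = p. \<Sum>T\<in>Pow {..<p + q}.
        (\<Prod>i\<in>T. if i \<in> S then - \<i> else \<i>) * \<alpha> (\<lambda>m. if m \<in> T then J (v m) else v m)) / 2 ^ (p + q))"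

text \<open>\<open>\<partial>\<close> and its conjugate on forms of type \<open>(p, q)\<close>.\<close>

definition del :: "('g \<Rightarrow> 'g \<Rightarrow> 'g) \<Rightarrow> ('g \<Rightarrow> 'g) \<Rightarrow> nat \<Rightarrow> nat \<Rightarrow> 'g form \<Rightarrow> 'g form" where
  "del br J p q \<alpha> = type_part J (Suc p) q (ext_deriv br (p + q) \<alpha>)"

definition delbar :: "('g \<Rightarrow> 'g \<Rightarrow> 'g) \<Rightarrow> ('g \<Rightarrow> 'g) \<Rightarrow> nat \<Rightarrow> nat \<Rightarrow> 'g form \<Rightarrow> 'g form" where
  "delbar br J p q \<alpha> = type_part J p (Suc q) (ext_deriv br (p + q) \<alpha>)"

definition form_10 :: "('g::real_vector \<Rightarrow> 'g) \<Rightarrow> ('g \<Rightarrow> complex) \<Rightarrow> bool" where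
  "form_10 J \<alpha> \<longleftrightarrow> linear \<alpha> \<and> (\<forall>u. \<alpha> (J u) = \<i> * \<alpha> u)"

definition coframe_10 :: "('g::real_vector \<Rightarrow> 'g) \<Rightarrow> (3 \<Rightarrow> 'g \<Rightarrow> complex) \<Rightarrow> bool" where
  "coframe_10 J \<zeta> \<longleftrightarrow> (\<forall>j. form_10 J (\<zeta> j)) \<and>
     (\<forall>\<alpha>. form_10 J \<alpha> \<longrightarrow> (\<exists>!c :: complex ^ 3. \<forall>u. \<alpha> u = (\<Sum>j\<in>UNIV. c $ j * \<zeta> j u)))"

definition zeta20 :: "(3 \<Rightarrow> 'g \<Rightarrow> complex) \<Rightarrow> 3 \<Rightarrow> 3 \<Rightarrow> 'g form" where
  "zeta20 \<zeta> j l = wedge 1 1 (form1 (\<zeta> j)) (form1 (\<zeta> l))"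

definition zeta11 :: "(3 \<Rightarrow> 'g \<Rightarrow> complex) \<Rightarrow> 3 \<Rightarrow> 3 \<Rightarrow> 'g form" where
  "zeta11 \<zeta> j l = wedge 1 1 (form1 (\<zeta> j)) (form1 (\<lambda>u. cnj (\<zeta> l u)))"

definition hermitian_metric :: "('g::real_vector \<Rightarrow> 'g) \<Rightarrow> ('g \<Rightarrow> 'g \<Rightarrow> real) \<Rightarrow> bool" where
  "hermitian_metric J g \<longleftrightarrow> bilinear g \<and> (\<forall>u v. g u v = g v u) \<and> (\<forall>u. u \<noteq> 0 \<longrightarrow> 0 < g u u) \<and>
     (\<forall>u v. g (J u) (J v) = g u v)"

text \<open>With \<open>\<omega>(u, v) = g(J u, v)\<close>, the metric with orthonormal coframe \<open>Re \<zeta>, Im \<zeta>\<close> has fundamental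
  form \<open>(i / 2) \<zeta> \<and> cnj \<zeta>\<close>.\<close>

definition fund_form :: "('g \<Rightarrow> 'g) \<Rightarrow> ('g \<Rightarrow> 'g \<Rightarrow> real) \<Rightarrow> 'g form" where
  "fund_form J g = (\<lambda>v. of_real (g (J (v 0)) (v 1)))"

definition diagonal_metric ::
    "('g \<Rightarrow> 'g) \<Rightarrow> (3 \<Rightarrow> 'g \<Rightarrow> complex) \<Rightarrow> ('g \<Rightarrow> 'g \<Rightarrow> real) \<Rightarrow> bool" where
  "diagonal_metric J \<zeta> g \<longleftrightarrow> (\<exists>r s k :: real. r \<noteq> 0 \<and> s \<noteq> 0 \<and> k \<noteq> 0 \<and>
     fund_form J g = (\<lambda>v. \<i> / 2 * (of_real (r\<^sup>2) * zeta11 \<zeta> 1 1 v + of_real (s\<^sup>2) * zeta11 \<zeta> 2 2 v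
       + of_real (k\<^sup>2) * zeta11 \<zeta> 3 3 v)))"

definition form_coeffs :: "(3 \<Rightarrow> 'g \<Rightarrow> complex) \<Rightarrow> 'g form \<Rightarrow> complex ^ 3 ^ 3" where
  "form_coeffs \<zeta> \<omega> = (THE h. \<omega> = (\<lambda>v. \<i> / 2 * (\<Sum>j\<in>UNIV. \<Sum>l\<in>UNIV. h $ j $ l * zeta11 \<zeta> j l v)))"

text \<open>The norm of \<open>\<Psi> = \<zeta>\<^sup>1 \<and> \<zeta>\<^sup>2 \<and> \<zeta>\<^sup>3\<close>; the determinant is real because the coefficient matrix is
  Hermitian.\<close>

definition norm_Psi :: "(3 \<Rightarrow> 'g \<Rightarrow> complex) \<Rightarrow> 'g form \<Rightarrow> real" where
  "norm_Psi \<zeta> \<omega> = sqrt (8 / Re (det (form_coeffs \<zeta> \<omega>)))"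

text \<open>A left-invariant connection on the tangent bundle is a bilinear map \<open>D\<close>, where \<open>D u v\<close> is the
  covariant derivative of \<open>v\<close> in the direction \<open>u\<close>.\<close>

definition torsion :: "('g::real_vector \<Rightarrow> 'g \<Rightarrow> 'g) \<Rightarrow> ('g \<Rightarrow> 'g \<Rightarrow> 'g) \<Rightarrow> 'g \<Rightarrow> 'g \<Rightarrow> 'g" where
  "torsion br D u v = D u v - D v u - br u v"

definition curvature ::
    "('g::real_vector \<Rightarrow> 'g \<Rightarrow> 'g) \<Rightarrow> ('g \<Rightarrow> 'g \<Rightarrow> 'g) \<Rightarrow> 'g \<Rightarrow> 'g \<Rightarrow> 'g \<Rightarrow> 'g" where
  "curvature br D u v w = D u (D v w) - D v (D u w) - D (br u v) w"

definition hermitian_connection ::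
    "('g::real_vector \<Rightarrow> 'g) \<Rightarrow> ('g \<Rightarrow> 'g \<Rightarrow> real) \<Rightarrow> ('g \<Rightarrow> 'g \<Rightarrow> 'g) \<Rightarrow> bool" where
  "hermitian_connection J g D \<longleftrightarrow> bilinear D \<and> (\<forall>u v w. g (D u v) w + g v (D u w) = 0) \<and>
     (\<forall>u v. D u (J v) = J (D u v))"

text \<open>The Chern connection is the Hermitian connection whose torsion has no \<open>(1,1)\<close>-part.\<close>

definition chern_connection ::
    "('g::real_vector \<Rightarrow> 'g \<Rightarrow> 'g) \<Rightarrow> ('g \<Rightarrow> 'g) \<Rightarrow> ('g \<Rightarrow> 'g \<Rightarrow> real) \<Rightarrow> 'g \<Rightarrow> 'g \<Rightarrow> 'g" where
  "chern_connection br J g = (THE D. hermitian_connection J g D \<and>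
     (\<forall>u v. torsion br D (J u) v = torsion br D u (J v)))"

definition bismut_connection ::
    "('g::real_vector \<Rightarrow> 'g \<Rightarrow> 'g) \<Rightarrow> ('g \<Rightarrow> 'g) \<Rightarrow> ('g \<Rightarrow> 'g \<Rightarrow> real) \<Rightarrow> 'g \<Rightarrow> 'g \<Rightarrow> 'g" where
  "bismut_connection br J g = (THE D. hermitian_connection J g D \<and>
     (\<forall>u v w. g (torsion br D u v) w = - g (torsion br D u w) v))"

definition gauduchon_connection ::
    "('g::real_vector \<Rightarrow> 'g \<Rightarrow> 'g) \<Rightarrow> ('g \<Rightarrow> 'g) \<Rightarrow> real \<Rightarrow> ('g \<Rightarrow> 'g \<Rightarrow> real) \<Rightarrow> 'g \<Rightarrow> 'g \<Rightarrow> 'g" where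
  "gauduchon_connection br J \<tau> g = (\<lambda>u v.
     ((1 + \<tau>) / 2) *\<^sub>R chern_connection br J g u v + ((1 - \<tau>) / 2) *\<^sub>R bismut_connection br J g u v)"

definition gauduchon_curvature ::
    "('g::real_vector \<Rightarrow> 'g \<Rightarrow> 'g) \<Rightarrow> ('g \<Rightarrow> 'g) \<Rightarrow> real \<Rightarrow> ('g \<Rightarrow> 'g \<Rightarrow> real) \<Rightarrow> 'g \<Rightarrow> 'g \<Rightarrow> 'g \<Rightarrow> 'g" where
  "gauduchon_curvature br J \<tau> g = curvature br (gauduchon_connection br J \<tau> g)"

text \<open>The number of frame vectors is the real dimension 6; the frame used in \<open>trace_square\<close> is
  arbitrary, the result being the same for all of them.\<close>

definition orthonormal_frame :: "('g \<Rightarrow> 'g \<Rightarrow> real) \<Rightarrow> (nat \<Rightarrow> 'g) \<Rightarrow> bool" where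
  "orthonormal_frame g E \<longleftrightarrow> (\<forall>i<6. \<forall>j<6. g (E i) (E j) = (if i = j then 1 else 0))"

definition curvature_form ::
    "('g \<Rightarrow> 'g \<Rightarrow> real) \<Rightarrow> (nat \<Rightarrow> 'g) \<Rightarrow> ('g \<Rightarrow> 'g \<Rightarrow> 'g \<Rightarrow> 'g) \<Rightarrow> nat \<Rightarrow> nat \<Rightarrow> 'g form" where
  "curvature_form g E R i j = (\<lambda>v. of_real (g (R (v 0) (v 1) (E j)) (E i)))"

definition trace_square :: "('g \<Rightarrow> 'g \<Rightarrow> real) \<Rightarrow> ('g \<Rightarrow> 'g \<Rightarrow> 'g \<Rightarrow> 'g) \<Rightarrow> 'g form" where
  "trace_square g R = (let E = (SOME E. orthonormal_frame g E) in
     (\<lambda>v. \<Sum>j<6. \<Sum>i<j. wedge 2 2 (curvature_form g E R i j) (curvature_form g E R i j) v))"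

text \<open>The bundle \<open>T\<^sup>1\<^sup>,\<^sup>0G\<close> is identified with \<open>(TG, J)\<close>, so its endomorphisms are endomorphisms of \<open>'g\<close>
  commuting with \<open>J\<close>, and multiplication by \<open>i\<close> is \<open>J\<close>.

  For a bilinear form \<open>B\<close>, the next definition is the endomorphism \<open>H\<^sup>-\<^sup>1B\<close>.\<close>

definition endo_of :: "('g \<Rightarrow> 'g \<Rightarrow> real) \<Rightarrow> ('g \<Rightarrow> 'g \<Rightarrow> real) \<Rightarrow> 'g \<Rightarrow> 'g" where
  "endo_of H B = (THE K. \<forall>u v. H (K u) v = B u v)"

definition power2_form :: "'g form \<Rightarrow> 'g form" where
  "power2_form \<omega> = wedge 2 2 \<omega> \<omega>"

definition power3_form :: "'g form \<Rightarrow> 'g form" where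
  "power3_form \<omega> = wedge 4 2 (power2_form \<omega>) \<omega>"

text \<open>The endomorphism \<open>K = (\<omega>\<^sup>2 \<and> A) / \<omega>\<^sup>3\<close>: the equality \<open>\<omega>\<^sup>2 \<and> A = K \<otimes> \<omega>\<^sup>3\<close> of
  endomorphism-valued 6-forms is tested on vectors \<open>u\<close> and real linear functionals \<open>l\<close>.\<close>

definition contracted_curvature :: "'g::real_vector form \<Rightarrow> ('g \<Rightarrow> 'g \<Rightarrow> 'g \<Rightarrow> 'g) \<Rightarrow> 'g \<Rightarrow> 'g" where
  "contracted_curvature \<omega> A = (THE K. \<forall>l :: 'g \<Rightarrow> real. linear l \<longrightarrow> (\<forall>u v.
     wedge 4 2 (power2_form \<omega>) (\<lambda>w. of_real (l (A (w 0) (w 1) u))) v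
       = of_real (l (K u)) * power3_form \<omega> v))"

text \<open>A left-invariant solution on the time interval \<open>I\<close>, with \<open>\<omega>\<^sub>t\<close> given through its metric \<open>g t\<close>.
  The contracted curvature is skew-adjoint, and \<open>\<epsilon> = 1\<close> or \<open>\<epsilon> = -1\<close> is the sign of the factor \<open>\<epsilon> i\<close>
  that makes it self-adjoint.\<close>

definition anomaly_flow ::
    "('g::real_vector \<Rightarrow> 'g \<Rightarrow> 'g) \<Rightarrow> ('g \<Rightarrow> 'g) \<Rightarrow> (3 \<Rightarrow> 'g \<Rightarrow> complex)
      \<Rightarrow> real \<Rightarrow> real \<Rightarrow> real \<Rightarrow> real \<Rightarrow> real set
      \<Rightarrow> (real \<Rightarrow> 'g \<Rightarrow> 'g \<Rightarrow> real) \<Rightarrow> (real \<Rightarrow> 'g \<Rightarrow> 'g \<Rightarrow> real) \<Rightarrow> bool" where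
  "anomaly_flow br J \<zeta> \<alpha>' \<tau> \<kappa> \<epsilon> I g H \<longleftrightarrow> (let \<omega> = (\<lambda>t. fund_form J (g t)) in
     (\<forall>t\<in>I. hermitian_metric J (g t) \<and> hermitian_metric J (H t)) \<and>
     (\<forall>t\<in>I. \<forall>v.
       ((\<lambda>s. of_real (norm_Psi \<zeta> (\<omega> s)) * power2_form (\<omega> s) v) has_vector_derivative
         \<i> * del br J 1 2 (delbar br J 1 1 (\<omega> t)) v
           - of_real (\<alpha>' / 4) * (trace_square (g t) (gauduchon_curvature br J \<tau> (g t)) v
               - trace_square (H t) (gauduchon_curvature br J \<kappa> (H t)) v)) (at t within I)) \<and>
     (\<forall>t\<in>I. \<exists>H'.
       (\<forall>u v. ((\<lambda>s. H s u v) has_real_derivative H' u v) (at t within I)) \<and>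
       endo_of (H t) H'
         = (\<lambda>u. \<epsilon> *\<^sub>R J (contracted_curvature (\<omega> t) (gauduchon_curvature br J \<kappa> (H t)) u))))"

end

(*
  The rotation F with zeta^1 o F = i zeta^1, zeta^2 o F = -i zeta^2, zeta^3 o F = zeta^3 commutes
  with J and, by the structure equations, preserves the bracket; a Hermitian metric is diagonal
  iff it is F-invariant. Pulling a solution of the flow back by F gives another solution, with the
  same initial values when these are diagonal, so the claim is a uniqueness statement. It is proved
  by Gronwall's inequality: let d(t) be the sum of the absolute values of finitely many components
  of Q - F^*Q and H - F^*H, where Q = |Psi| omega^2. The metric g is a polynomial in Q (take minors
  of minors), the Chern and Bismut connections are explicit in g and the bracket, and both metrics
  are uniformly positive on compact intervals; hence every quantity in the flow equations differs
  from its pull-back by at most a constant times d(t). Thus the derivatives of the components are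
  bounded by a multiple of d, and d = 0.
*)

theory Submission
  imports Defs
begin

section \<open>Orthonormal frames\<close>

text \<open>The metrics enter the right-hand sides through definite descriptions, an arbitrarily
  chosen orthonormal frame and a division by \<omega>^3, so there is no vector field at hand to
  which a uniqueness theorem for differential equations would apply. Each ingredient is instead
  compared with its own pull-back along the one given solution. The relation \<open>close\<close>
  records a bound on both curves together with a bound on their difference; it is stable under sums,
  products and inverses away from zero, so it passes through any explicit formula. Since the second
  curve is always evaluated on vectors moved by the rotation, one and the same lemma gives
  equivariance and Lipschitz dependence. The first equation differentiates only the rescaled square
  of \<omega>, so even continuity of \<omega> in time has to be recovered. For a 3x3 matrix the
  adjugate of the adjugate is the determinant times the matrix, and the normalisation of the norm of
  \<Psi> turns that determinant into the constant 8.\<close>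

lemma independent_image_if_separated:
  fixes E :: "nat \<Rightarrow> 'g::real_vector"
  assumes "\<And>i. i < n \<Longrightarrow> \<exists>f::'g \<Rightarrow> real. linear f \<and> f (E i) \<noteq> 0 \<and> (\<forall>j<i. f (E j) = 0)"
  shows "independent (E ` {..<n}) \<and> card (E ` {..<n}) = n"
  using assms
proof (induction n)
  case 0
  then show ?case by (simp add: independent_empty)
next
  case (Suc n)
  then have IH: "independent (E ` {..<n})" "card (E ` {..<n}) = n" by auto
  from Suc.prems[of n] obtain f where f: "linear (f::'g \<Rightarrow> real)" "f (E n) \<noteq> 0" "\<forall>j<n. f (E j) = 0" by auto
  \<comment> \<open>\<open>f\<close> annihilates the span of the earlier vectors but not
    \<open>E n\<close>. This gives independence and also excludes a repetition, which the
    cardinality needs.\<close>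
  have "f x = 0" if "x \<in> span (E ` {..<n})" for x
    using that
  proof (induction rule: span_induct)
    case base
    show ?case using f(1) by (auto simp: subspace_def linear_0 linear_add linear_scale)
  next
    case (step x)
    then show ?case using f(3) by auto
  qed
  then have notin: "E n \<notin> span (E ` {..<n})" using f(2) by auto
  then have "E n \<notin> E ` {..<n}" using span_base[of "E n" "E ` {..<n}"] by argo
  then show ?case using IH notin by (simp add: lessThan_Suc independent_insert)
qed

text \<open>The Lie algebra is a bare real vector space, so dimension six and all coordinates come
  from an explicit basis. As a locale this can serve both a basis and its image under a
  symmetry.\<close>

locale dual_basis =
  fixes b :: "nat \<Rightarrow> 'g::real_vector" and \<phi> :: "nat \<Rightarrow> 'g \<Rightarrow> real"
  assumes linear_phi: "linear (\<phi> k)"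
    and expand: "(\<Sum>k<6. \<phi> k u *\<^sub>R b k) = u"
    and dual: "i < 6 \<Longrightarrow> k < 6 \<Longrightarrow> \<phi> i (b k) = (if i = k then 1 else 0)"
begin

lemma linear_expand:
  fixes f :: "'g \<Rightarrow> 'v::real_vector"
  assumes "linear f"
  shows "f u = (\<Sum>k<6. \<phi> k u *\<^sub>R f (b k))"
proof -
  have "f u = f (\<Sum>k<6. \<phi> k u *\<^sub>R b k)" by (simp add: expand)
  then show ?thesis using assms by (simp add: linear_sum linear_scale)
qed

lemma card_independent_le:
  assumes "independent (A::'g set)"
  shows "finite A \<and> card A \<le> 6"
proof -
  have "A \<subseteq> span (b ` {..<6})"
  proof
    fix u
    have "(\<Sum>k<6. \<phi> k u *\<^sub>R b k) \<in> span (b ` {..<6})"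
      by (intro span_sum span_scale span_base) auto
    then show "u \<in> span (b ` {..<6})" by (simp add: expand)
  qed
  then have "finite A \<and> card A \<le> card (b ` {..<6})"
    using independent_span_bound[of "b ` {..<6}" A] assms by auto
  then show ?thesis using card_image_le[of "{..<6}" b] by auto
qed

lemma exists_not_in_span:
  assumes "finite A" "card A < 6"
  shows "\<exists>u::'g. u \<notin> span A"
proof (rule ccontr)
  assume "\<not> ?thesis"
  moreover have "independent (b ` {..<6}) \<and> card (b ` {..<6}) = 6"
  proof (rule independent_image_if_separated)
    fix i :: nat
    assume "i < 6"
    then show "\<exists>f::'g \<Rightarrow> real. linear f \<and> f (b i) \<noteq> 0 \<and> (\<forall>j<i. f (b j) = 0)"
      by (intro exI[of _ "\<phi> i"]) (auto simp: linear_phi dual)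
  qed
  ultimately show False
    using independent_span_bound[of A "b ` {..<6}"] assms by auto
qed

end

definition inner_form :: "('g::real_vector \<Rightarrow> 'g \<Rightarrow> real) \<Rightarrow> bool" where
  "inner_form g \<longleftrightarrow> bilinear g \<and> (\<forall>u v. g u v = g v u) \<and> (\<forall>u. u \<noteq> 0 \<longrightarrow> 0 < g u u)"

lemma inner_form_linear_left: "inner_form g \<Longrightarrow> linear (\<lambda>u. g u v)"
  and inner_form_linear_right: "inner_form g \<Longrightarrow> linear (g u)"
  by (auto simp: inner_form_def bilinear_def)

lemma inner_form_sym: "inner_form g \<Longrightarrow> g u v = g v u"
  and inner_form_pos: "inner_form g \<Longrightarrow> u \<noteq> 0 \<Longrightarrow> 0 < g u u"
  by (auto simp: inner_form_def)

lemma inner_form_eqI: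
  assumes "inner_form g" "\<And>w. g u w = g v w"
  shows "u = v"
proof -
  have "g (u - v) (u - v) = 0"
    using assms by (simp add: linear_diff[OF inner_form_linear_left[OF assms(1)]])
  then show ?thesis using inner_form_pos[OF assms(1), of "u - v"] by auto
qed

context dual_basis
begin

text \<open>Gram-Schmidt: fewer than six vectors do not span, so some vector leaves a nonzero
  residual, which is normalised and appended.\<close>

lemma exists_partial_frame:
  assumes g: "inner_form (g::'g \<Rightarrow> 'g \<Rightarrow> real)" and "n \<le> (6::nat)"
  shows "\<exists>E. \<forall>i<n. \<forall>j<n. g (E i) (E j) = (if i = j then 1 else 0)"
  using \<open>n \<le> 6\<close>
proof (induction n)
  case 0
  then show ?case by simp
next
  case (Suc n)
  note ll = inner_form_linear_left[OF g] and lr = inner_form_linear_right[OF g]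
  from Suc obtain E where E: "\<And>i j. i < n \<Longrightarrow> j < n \<Longrightarrow> g (E i) (E j) = (if i = j then 1 else 0)" by force
  have "card (E ` {..<n}) < 6" using Suc.prems card_image_le[of "{..<n}" E] by simp
  then obtain u where u: "u \<notin> span (E ` {..<n})" using exists_not_in_span by blast
  define r where "r = u - (\<Sum>i<n. g u (E i) *\<^sub>R E i)"
  have "(\<Sum>i<n. g u (E i) *\<^sub>R E i) \<in> span (E ` {..<n})"
    by (intro span_sum span_scale span_base) auto
  then have "r \<noteq> 0" using u by (auto simp: r_def)
  then have rr: "g r r > 0" using inner_form_pos[OF g] by auto
  have rE: "g r (E j) = 0" if "j < n" for j
  proof -
    have "g r (E j) = g u (E j) - (\<Sum>i<n. g u (E i) * g (E i) (E j))"
      unfolding r_def by (simp add: linear_diff[OF ll] linear_sum[OF ll] linear_scale[OF ll])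
    also have "(\<Sum>i<n. g u (E i) * g (E i) (E j)) = (\<Sum>i<n. if i = j then g u (E i) else 0)"
      by (rule sum.cong) (auto simp: E that)
    finally show ?thesis using that by simp
  qed
  define N where "N = r /\<^sub>R sqrt (g r r)"
  have NE: "g N (E j) = 0" "g (E j) N = 0" if "j < n" for j
    using rE[OF that] inner_form_sym[OF g] by (auto simp: N_def linear_scale[OF ll] linear_scale[OF lr])
  have "sqrt (g r r) * sqrt (g r r) = g r r" using rr by simp
  then have NN: "g N N = 1"
    using rr by (simp add: N_def linear_scale[OF ll] linear_scale[OF lr] field_simps)
  show ?case
    by (rule exI[of _ "E(n := N)"]) (auto simp: less_Suc_eq E NE NN)
qed

lemma exists_orthonormal_frame:
  assumes "inner_form (g::'g \<Rightarrow> 'g \<Rightarrow> real)"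
  shows "\<exists>E. orthonormal_frame g E"
  using exists_partial_frame[OF assms, of 6] by (simp add: orthonormal_frame_def)

text \<open>A nonzero residual would be orthogonal to the whole frame, hence a seventh independent
  vector.\<close>

lemma orthonormal_expansion:
  assumes g: "inner_form (g::'g \<Rightarrow> 'g \<Rightarrow> real)" and E: "orthonormal_frame g E"
  shows "(\<Sum>j<6. g u (E j) *\<^sub>R E j) = u"
proof (rule ccontr)
  assume "\<not> ?thesis"
  note ll = inner_form_linear_left[OF g] and lr = inner_form_linear_right[OF g]
  define r where "r = u - (\<Sum>i<6. g u (E i) *\<^sub>R E i)"
  have "r \<noteq> 0" using \<open>\<not> _\<close> by (auto simp: r_def)
  have EE: "g (E i) (E j) = (if i = j then 1 else 0)" if "i < 6" "j < 6" for i j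
    using E that by (auto simp: orthonormal_frame_def)
  have rE: "g r (E j) = 0" if "j < 6" for j
  proof -
    have "g r (E j) = g u (E j) - (\<Sum>i<6. g u (E i) * g (E i) (E j))"
      unfolding r_def by (simp add: linear_diff[OF ll] linear_sum[OF ll] linear_scale[OF ll])
    also have "(\<Sum>i<6. g u (E i) * g (E i) (E j)) = (\<Sum>i<6. if i = j then g u (E i) else 0)"
      by (rule sum.cong) (auto simp: EE that)
    finally show ?thesis using that by simp
  qed
  define E' where "E' = E(6 := r)"
  have "independent (E' ` {..<7}) \<and> card (E' ` {..<7}) = 7"
  proof (rule independent_image_if_separated)
    fix i :: nat
    assume "i < 7"
    then have "i < 6 \<or> i = 6" by auto
    then show "\<exists>f::'g \<Rightarrow> real. linear f \<and> f (E' i) \<noteq> 0 \<and> (\<forall>j<i. f (E' j) = 0)"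
      using inner_form_pos[OF g \<open>r \<noteq> 0\<close>]
      by (intro exI[of _ "g (E' i)"]) (auto simp: E'_def lr EE rE)
  qed
  then show False using card_independent_le[of "E' ` {..<7}"] by auto
qed

text \<open>Riesz representation. It turns the lowered formulas for the connections back into
  vectors, and the time derivative of \<open>H\<close> into an endomorphism.\<close>

lemma exists_representer:
  assumes g: "inner_form (g::'g \<Rightarrow> 'g \<Rightarrow> real)" and f: "linear f"
  shows "\<exists>X. \<forall>w. g X w = f w"
proof -
  note ll = inner_form_linear_left[OF g]
  obtain E where E: "orthonormal_frame g E" using exists_orthonormal_frame[OF g] by blast
  have "g (\<Sum>j<6. f (E j) *\<^sub>R E j) w = f w" for w
  proof -
    have "f w = f (\<Sum>j<6. g w (E j) *\<^sub>R E j)" by (simp add: orthonormal_expansion[OF g E])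
    also have "\<dots> = (\<Sum>j<6. g w (E j) * f (E j))" by (simp add: linear_sum[OF f] linear_scale[OF f])
    finally show ?thesis
      by (simp add: linear_sum[OF ll] linear_scale[OF ll] inner_form_sym[OF g, of w] mult.commute)
  qed
  then show ?thesis by blast
qed

text \<open>A trace does not depend on the basis. The right-hand side contains neither metric nor
  frame, which makes traces at different times comparable.\<close>

lemma trace_eq:
  assumes g: "inner_form (g::'g \<Rightarrow> 'g \<Rightarrow> real)" and E: "orthonormal_frame g E" and K: "linear K"
  shows "(\<Sum>j<6. g (K (E j)) (E j)) = (\<Sum>k<6. \<phi> k (K (b k)))"
proof -
  have "g (K (E j)) (E j) = (\<Sum>k<6. \<phi> k (K (E j)) * g (b k) (E j))" for j
    using linear_expand[OF inner_form_linear_left[OF g, of "E j"], of "K (E j)"] by simp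
  then have "(\<Sum>j<6. g (K (E j)) (E j)) = (\<Sum>k<6. \<Sum>j<6. \<phi> k (K (E j)) * g (b k) (E j))"
    by (simp only:) (rule sum.swap)
  also have "\<dots> = (\<Sum>k<6. \<phi> k (K (b k)))"
  proof (rule sum.cong[OF refl])
    fix k
    have l: "linear (\<lambda>u. \<phi> k (K u))" using linear_compose[OF K linear_phi[of k]] by (simp add: o_def)
    have "\<phi> k (K (b k)) = \<phi> k (K (\<Sum>j<6. g (b k) (E j) *\<^sub>R E j))" by (simp add: orthonormal_expansion[OF g E])
    then show "(\<Sum>j<6. \<phi> k (K (E j)) * g (b k) (E j)) = \<phi> k (K (b k))"
      by (simp add: linear_sum[OF l] linear_scale[OF l] mult.commute)
  qed
  finally show ?thesis .
qed

end

section \<open>Exterior algebra\<close>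

text \<open>A form is a function of an infinite sequence; the second clause makes it blind to the
  arguments from index \<open>k\<close> on.\<close>

definition multilinear_form :: "nat \<Rightarrow> 'g::real_vector form \<Rightarrow> bool" where
  "multilinear_form k f \<longleftrightarrow> (\<forall>v i. i < k \<longrightarrow> linear (\<lambda>x. f (v(i := x)))) \<and>
     (\<forall>v w. (\<forall>i<k. v i = w i) \<longrightarrow> f v = f w)"

definition alternating :: "nat \<Rightarrow> 'g form \<Rightarrow> bool" where
  "alternating k f \<longleftrightarrow> (\<forall>\<sigma> v. \<sigma> permutes {..<k} \<longrightarrow> f (\<lambda>i. v (\<sigma> i)) = of_int (sign \<sigma>) * f v)"

lemma multilinear_form_wedge:
  assumes \<alpha>: "multilinear_form p \<alpha>" and \<beta>: "multilinear_form q \<beta>"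
  shows "multilinear_form (p + q) (wedge p q \<alpha> \<beta>)"
  unfolding multilinear_form_def
proof (intro conjI allI impI)
  fix v :: "nat \<Rightarrow> 'a" and k
  assume "k < p + q"
  have lin: "linear (\<lambda>x. of_int (sign \<sigma>) * \<alpha> (\<lambda>i. (v(k := x)) (\<sigma> i)) * \<beta> (\<lambda>i. (v(k := x)) (\<sigma> (p + i))))"
    if \<sigma>: "\<sigma> permutes {..<p + q}" for \<sigma>
  proof -
    \<comment> \<open>In the term of \<open>\<sigma>\<close> the vector with index \<open>k\<close>
      occupies exactly the slot \<open>m\<close>, which belongs to \<open>\<alpha>\<close> if
      \<open>m < p\<close> and to \<open>\<beta>\<close> otherwise; the other factor is constant in
      it.\<close>
    define m where "m = inv \<sigma> k"
    have m: "m < p + q" using permutes_in_image[OF permutes_inv[OF \<sigma>]] \<open>k < p + q\<close> by (auto simp: m_def)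
    have eq: "\<sigma> i = k \<longleftrightarrow> i = m" for i using permutes_inverses[OF \<sigma>] by (auto simp: m_def)
    show ?thesis
    proof (cases "m < p")
      case True
      have "(\<lambda>i. (v(k := x)) (\<sigma> i)) = (\<lambda>i. v (\<sigma> i))(m := x)" for x by (auto simp: eq)
      moreover have "(\<lambda>i. (v(k := x)) (\<sigma> (p + i))) = (\<lambda>i. v (\<sigma> (p + i)))" for x using True by (auto simp: eq)
      moreover have "linear (\<lambda>x. \<alpha> ((\<lambda>i. v (\<sigma> i))(m := x)))" using \<alpha> True by (simp add: multilinear_form_def)
      ultimately show ?thesis
        by (auto simp: linear_iff algebra_simps)
    next
      case False
      then have m': "m - p < q" using m by auto
      have "(\<lambda>i. (v(k := x)) (\<sigma> (p + i))) = (\<lambda>i. v (\<sigma> (p + i)))(m - p := x)" for x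
        using False by (auto simp: eq fun_eq_iff)
      moreover have "\<alpha> (\<lambda>i. (v(k := x)) (\<sigma> i)) = \<alpha> (\<lambda>i. v (\<sigma> i))" for x
        using \<alpha> False by (auto simp: eq multilinear_form_def)
      moreover have "linear (\<lambda>x. \<beta> ((\<lambda>i. v (\<sigma> (p + i)))(m - p := x)))" using \<beta> m' by (simp add: multilinear_form_def)
      ultimately show ?thesis
        by (auto simp: linear_iff algebra_simps)
    qed
  qed
  have "linear (\<lambda>x. \<Sum>\<sigma> | \<sigma> permutes {..<p + q}. of_int (sign \<sigma>) * \<alpha> (\<lambda>i. (v(k := x)) (\<sigma> i)) * \<beta> (\<lambda>i. (v(k := x)) (\<sigma> (p + i))))"
    by (rule linear_compose_sum) (use lin in blast)
  then show "linear (\<lambda>x. wedge p q \<alpha> \<beta> (v(k := x)))"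
    unfolding wedge_def linear_iff by (simp only: add_divide_distrib scaleR_conv_of_real) (simp add: mult.assoc)
next
  fix v w :: "nat \<Rightarrow> 'a"
  assume vw: "\<forall>i<p + q. v i = w i"
  have 1: "\<alpha> (\<lambda>i. v (\<sigma> i)) = \<alpha> (\<lambda>i. w (\<sigma> i))" "\<beta> (\<lambda>i. v (\<sigma> (p + i))) = \<beta> (\<lambda>i. w (\<sigma> (p + i)))"
    if \<sigma>: "\<sigma> permutes {..<p + q}" for \<sigma>
  proof -
    have "\<sigma> i < p + q" if "i < p + q" for i using permutes_in_image[OF \<sigma>, of i] that by auto
    then have "\<forall>i<p + q. v (\<sigma> i) = w (\<sigma> i)" using vw by auto
    then show "\<alpha> (\<lambda>i. v (\<sigma> i)) = \<alpha> (\<lambda>i. w (\<sigma> i))" "\<beta> (\<lambda>i. v (\<sigma> (p + i))) = \<beta> (\<lambda>i. w (\<sigma> (p + i)))"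
      using \<alpha> \<beta> by (auto simp: multilinear_form_def)
  qed
  show "wedge p q \<alpha> \<beta> v = wedge p q \<alpha> \<beta> w"
    unfolding wedge_def by (intro arg_cong2[where f = "(/)"] sum.cong refl) (simp add: 1)
qed

text \<open>The permutation sum antisymmetrises: composing on the left with \<open>\<tau>\<close>
  only reindexes it and pulls out the sign.\<close>

lemma alternating_wedge: "alternating (p + q) (wedge p q \<alpha> \<beta>)"
  unfolding alternating_def
proof (intro allI impI)
  fix \<tau> and v :: "nat \<Rightarrow> 'a"
  assume \<tau>: "\<tau> permutes {..<p + q}"
  let ?f = "\<lambda>\<sigma>. of_int (sign \<sigma>) * \<alpha> (\<lambda>i. v (\<sigma> i)) * \<beta> (\<lambda>i. v (\<sigma> (p + i)))"
  have "(\<Sum>\<sigma> | \<sigma> permutes {..<p + q}. ?f \<sigma>) = (\<Sum>\<sigma> | \<sigma> permutes {..<p + q}. ?f (\<tau> \<circ> \<sigma>))"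
    by (rule setum_permutations_compose_left[OF \<tau>])
  also have "\<dots> = (\<Sum>\<sigma> | \<sigma> permutes {..<p + q}. of_int (sign \<tau>) *
      (of_int (sign \<sigma>) * \<alpha> (\<lambda>i. v (\<tau> (\<sigma> i))) * \<beta> (\<lambda>i. v (\<tau> (\<sigma> (p + i))))))"
  proof (rule sum.cong[OF refl])
    fix \<sigma> assume "\<sigma> \<in> {\<sigma>. \<sigma> permutes {..<p + q}}"
    then have "permutation \<sigma>" "permutation \<tau>" using \<tau> permutation_permutes by blast+
    then show "?f (\<tau> \<circ> \<sigma>) = of_int (sign \<tau>) *
      (of_int (sign \<sigma>) * \<alpha> (\<lambda>i. v (\<tau> (\<sigma> i))) * \<beta> (\<lambda>i. v (\<tau> (\<sigma> (p + i)))))"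
      by (simp add: sign_compose)
  qed
  finally have *: "wedge p q \<alpha> \<beta> v = of_int (sign \<tau>) * wedge p q \<alpha> \<beta> (\<lambda>i. v (\<tau> i))"
    by (simp add: wedge_def sum_distrib_left)
  have "of_int (sign \<tau>) * (of_int (sign \<tau>) :: complex) = 1"
    by (cases \<tau> rule: sign_cases) auto
  then show "wedge p q \<alpha> \<beta> (\<lambda>i. v (\<tau> i)) = of_int (sign \<tau>) * wedge p q \<alpha> \<beta> v"
    by (simp add: * mult.assoc[symmetric])
qed

text \<open>A permutation of \<open>n + 1\<close> points is determined by the image \<open>b\<close>
  of the last point and a permutation of the others. Used twice, this exposes the two arguments of
  the second factor in \<open>wedge_two\<close>.\<close>

lemma sum_permutations_Suc:
  "sum f {\<sigma>. \<sigma> permutes {..<Suc n}} = (\<Sum>b<Suc n. \<Sum>q | q permutes {..<n}. f (Transposition.transpose n b \<circ> q))"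
  using sum_over_permutations_insert[of "{..<n}" n f] by (simp only: lessThan_Suc) simp

text \<open>Split off the last two values of the permutation; the remaining sum over the
  permutations of the arguments of \<open>\<alpha>\<close> is trivial because \<open>\<alpha>\<close> is alternating.\<close>

lemma wedge_two:
  assumes \<alpha>: "alternating p \<alpha>"
  shows "wedge p 2 \<alpha> \<beta> v = (\<Sum>b<Suc (Suc p). \<Sum>c<Suc p.
     (if b = Suc p then 1 else -1) * (if c = p then 1 else -1)
       * \<alpha> (\<lambda>i. v (Transposition.transpose (Suc p) b (Transposition.transpose p c i)))
       * \<beta> (\<lambda>i. v (Transposition.transpose (Suc p) b (Transposition.transpose p c (p + i))))) / 2"
proof -
  let ?f = "\<lambda>\<sigma>. of_int (sign \<sigma>) * \<alpha> (\<lambda>i. v (\<sigma> i)) * \<beta> (\<lambda>i. v (\<sigma> (p + i)))"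
  let ?g = "\<lambda>b c. (if b = Suc p then 1 else -1) * (if c = p then 1 else -1)
       * \<alpha> (\<lambda>i. v (Transposition.transpose (Suc p) b (Transposition.transpose p c i)))
       * \<beta> (\<lambda>i. v (Transposition.transpose (Suc p) b (Transposition.transpose p c (p + i))))"
  have "?f (Transposition.transpose (Suc p) b \<circ> (Transposition.transpose p c \<circ> q)) = ?g b c" if q: "q permutes {..<p}" for b c q
  proof -
    have pq: "permutation q" using q permutation_permutes by blast
    have s: "(of_int (sign (Transposition.transpose (Suc p) b \<circ> (Transposition.transpose p c \<circ> q))) :: complex)
        = (if b = Suc p then 1 else -1) * (if c = p then 1 else -1) * of_int (sign q)"
      using pq by (simp add: sign_compose permutation_compose permutation_swap_id sign_swap_id)
    have qi: "q (p + i) = p + i" for i using q by (simp add: permutes_def)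
    have "\<alpha> (\<lambda>i. v (Transposition.transpose (Suc p) b (Transposition.transpose p c (q i))))
        = of_int (sign q) * \<alpha> (\<lambda>i. v (Transposition.transpose (Suc p) b (Transposition.transpose p c i)))"
      using \<alpha>[unfolded alternating_def, rule_format, OF q,
          of "\<lambda>i. v (Transposition.transpose (Suc p) b (Transposition.transpose p c i))"] by simp
    moreover have "of_int (sign q) * (of_int (sign q) :: complex) = 1"
      by (cases q rule: sign_cases) auto
    ultimately show ?thesis
      unfolding s by (simp add: qi)
  qed
  then have "(\<Sum>\<sigma> | \<sigma> permutes {..<Suc (Suc p)}. ?f \<sigma>)
      = (\<Sum>b<Suc (Suc p). \<Sum>c<Suc p. \<Sum>q | q permutes {..<p}. ?g b c)"
    unfolding sum_permutations_Suc by (intro sum.cong refl) auto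
  also have "\<dots> = fact p * (\<Sum>b<Suc (Suc p). \<Sum>c<Suc p. ?g b c)"
    by (simp only: sum_distrib_left sum_constant) (simp add: card_permutations)
  finally show ?thesis
    by (simp add: wedge_def)
qed

section \<open>Square and cube of a real two-form\<close>

lemma alternating_of_real_skew:
  assumes "\<And>u v. w u v = - w v u"
  shows "alternating 2 (\<lambda>v. of_real (w (v 0) (v 1)))"
  unfolding alternating_def
proof (intro allI impI)
  fix \<sigma> and v :: "nat \<Rightarrow> 'a"
  assume \<sigma>: "\<sigma> permutes {..<2::nat}"
  have "{..<2::nat} = {0, 1}" by auto
  then have "\<sigma> = id \<or> \<sigma> = Transposition.transpose 0 1" using \<sigma> permutes_doubleton_iff[of \<sigma> 0 1] by simp
  then show "(of_real (w (v (\<sigma> 0)) (v (\<sigma> 1))) :: complex) = of_int (sign \<sigma>) * of_real (w (v 0) (v 1))"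
    using assms[of "v 1" "v 0"] by (auto simp: sign_swap_id)
qed

text \<open>The six shuffles of four arguments pair up into the three perfect matchings, each
  counted twice; the bracket is a 4x4 Pfaffian.\<close>

lemma power2_form_eq:
  assumes "\<And>u v. w u v = - w v u"
  shows "power2_form (\<lambda>v. of_real (w (v 0) (v 1))) v = of_real (2 *
    (w (v 0) (v 1) * w (v 2) (v 3) - w (v 0) (v 2) * w (v 1) (v 3) + w (v 0) (v 3) * w (v 1) (v 2)))"
proof -
  have sets: "{..<Suc (Suc 2)} = {0, 1, 2, 3::nat}" "{..<Suc 2} = {0, 1, 2::nat}" by auto
  have swap: "w (v 1) (v 0) = - w (v 0) (v 1)" "w (v 2) (v 0) = - w (v 0) (v 2)"
    "w (v 2) (v 1) = - w (v 1) (v 2)" "w (v 3) (v 0) = - w (v 0) (v 3)"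
    "w (v 3) (v 1) = - w (v 1) (v 3)" "w (v 3) (v 2) = - w (v 2) (v 3)"
    using assms by blast+
  have arith: "Suc 2 = 3" "2 + 0 = (2::nat)" "2 + 1 = (3::nat)" by simp_all
  show ?thesis
    unfolding power2_form_def wedge_two[OF alternating_of_real_skew[of w, OF assms]] sets
    unfolding arith Transposition.transpose_def
    by (simp add: swap del: One_nat_def)
qed

definition pfaffian :: "(nat \<Rightarrow> nat \<Rightarrow> real) \<Rightarrow> real" where
  "pfaffian a =
     a 0 1 * (a 2 3 * a 4 5 - a 2 4 * a 3 5 + a 2 5 * a 3 4)
   - a 0 2 * (a 1 3 * a 4 5 - a 1 4 * a 3 5 + a 1 5 * a 3 4)
   + a 0 3 * (a 1 2 * a 4 5 - a 1 4 * a 2 5 + a 1 5 * a 2 4)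
   - a 0 4 * (a 1 2 * a 3 5 - a 1 3 * a 2 5 + a 1 5 * a 2 3)
   + a 0 5 * (a 1 2 * a 3 4 - a 1 3 * a 2 4 + a 1 4 * a 2 3)"

text \<open>The factor 6 is the number of orders in which the three pairs of a perfect matching of
  six arguments can be distributed over the three factors.\<close>

lemma power3_form_eq:
  assumes "\<And>u v. w u v = - w v u"
  shows "power3_form (\<lambda>v. of_real (w (v 0) (v 1))) v = of_real (6 * pfaffian (\<lambda>i j. w (v i) (v j)))"
proof -
  have sets: "{..<Suc (Suc 4)} = {0, 1, 2, 3, 4, 5::nat}" "{..<Suc 4} = {0, 1, 2, 3, 4::nat}" by auto
  have swap: "w (v 1) (v 0) = - w (v 0) (v 1)" "w (v 2) (v 0) = - w (v 0) (v 2)"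
    "w (v 2) (v 1) = - w (v 1) (v 2)" "w (v 3) (v 0) = - w (v 0) (v 3)"
    "w (v 3) (v 1) = - w (v 1) (v 3)" "w (v 3) (v 2) = - w (v 2) (v 3)"
    "w (v 4) (v 0) = - w (v 0) (v 4)" "w (v 4) (v 1) = - w (v 1) (v 4)"
    "w (v 4) (v 2) = - w (v 2) (v 4)" "w (v 4) (v 3) = - w (v 3) (v 4)"
    "w (v 5) (v 0) = - w (v 0) (v 5)" "w (v 5) (v 1) = - w (v 1) (v 5)"
    "w (v 5) (v 2) = - w (v 2) (v 5)" "w (v 5) (v 3) = - w (v 3) (v 5)"
    "w (v 5) (v 4) = - w (v 4) (v 5)"
    using assms by blast+
  have arith: "Suc 4 = 5" "4 + 0 = (4::nat)" "4 + 1 = (5::nat)" by simp_all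
  have alt: "alternating 4 (power2_form (\<lambda>v. of_real (w (v 0) (v 1))))"
    using alternating_wedge[of 2 2] by (simp add: power2_form_def)
  show ?thesis
    unfolding power3_form_def wedge_two[OF alt] sets
    unfolding power2_form_eq[of w, OF assms] arith Transposition.transpose_def pfaffian_def
    by (simp add: swap del: One_nat_def) (simp add: algebra_simps)
qed

section \<open>Alternating forms of top degree\<close>

lemma alternating_multilinear_eq_0:
  assumes ml: "multilinear_form n f" and alt: "alternating n f"
    and span: "\<And>u. (\<Sum>k<n. \<phi> k u *\<^sub>R b k) = (u::'g::real_vector)"
    and zero: "f b = 0"
  shows "f v = 0"
proof -
  \<comment> \<open>On basis vectors an injective choice of indices is a permutation and gives plus
    or minus \<open>f b\<close>; with a repeated index the value equals its own negative.\<close>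
  have basis: "f (\<lambda>i. b (c i)) = 0" if c: "\<forall>i<n. c i < n" for c
  proof (cases "inj_on c {..<n}")
    case True
    \<comment> \<open>\<open>permutes\<close> demands the identity from \<open>n\<close> on;
      \<open>f\<close> does not see this change.\<close>
    define \<sigma> where "\<sigma> = (\<lambda>i. if i < n then c i else i)"
    have "bij_betw \<sigma> {..<n} {..<n}"
    proof -
      have "inj_on \<sigma> {..<n}" using True by (auto simp: inj_on_def \<sigma>_def)
      moreover have "\<sigma> ` {..<n} \<subseteq> {..<n}" using c by (auto simp: \<sigma>_def)
      ultimately show ?thesis by (simp add: bij_betw_def endo_inj_surj)
    qed
    then have "\<sigma> permutes {..<n}" by (rule bij_imp_permutes) (auto simp: \<sigma>_def)
    then have "f (\<lambda>i. b (\<sigma> i)) = 0" using alt zero by (simp add: alternating_def)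
    moreover have "f (\<lambda>i. b (\<sigma> i)) = f (\<lambda>i. b (c i))"
      using ml by (auto simp: multilinear_form_def \<sigma>_def)
    ultimately show ?thesis by simp
  next
    case False
    then obtain i j where ij: "i < n" "j < n" "i \<noteq> j" "c i = c j" by (auto simp: inj_on_def)
    have "Transposition.transpose i j permutes {..<n}" using ij by (intro permutes_swap_id) auto
    then have "f (\<lambda>k. b (c (Transposition.transpose i j k))) = of_int (sign (Transposition.transpose i j)) * f (\<lambda>k. b (c k))"
      using alt[unfolded alternating_def, rule_format, of _ "\<lambda>k. b (c k)"] by blast
    moreover have "(\<lambda>k. b (c (Transposition.transpose i j k))) = (\<lambda>k. b (c k))"
      using ij by (auto simp: Transposition.transpose_def)
    ultimately show ?thesis using ij by (simp add: sign_swap_id)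
  qed
  \<comment> \<open>Multilinear expansion slot by slot: the first \<open>m\<close> arguments are
    arbitrary and the remaining ones are basis vectors, so \<open>m = n\<close> is the
    claim.\<close>
  have "\<forall>v. (\<forall>i. m \<le> i \<and> i < n \<longrightarrow> v i \<in> b ` {..<n}) \<longrightarrow> f v = 0" if "m \<le> n" for m
    using that
  proof (induction m)
    case 0
    show ?case
    proof (intro allI impI)
      fix v
      assume v: "\<forall>i. 0 \<le> i \<and> i < n \<longrightarrow> v i \<in> b ` {..<n}"
      then have "\<forall>i. \<exists>j. i < n \<longrightarrow> j < n \<and> v i = b j" by auto
      then obtain c where c: "\<forall>i. i < n \<longrightarrow> c i < n \<and> v i = b (c i)" by metis
      then have "f v = f (\<lambda>i. b (c i))" using ml by (auto simp: multilinear_form_def)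
      then show "f v = 0" using basis c by auto
    qed
  next
    case (Suc m)
    show ?case
    proof (intro allI impI)
      fix v
      assume v: "\<forall>i. Suc m \<le> i \<and> i < n \<longrightarrow> v i \<in> b ` {..<n}"
      have lin: "linear (\<lambda>x. f (v(m := x)))" using ml Suc.prems by (simp add: multilinear_form_def)
      have "f (v(m := b k)) = 0" if "k < n" for k
      proof -
        have "\<forall>i. m \<le> i \<and> i < n \<longrightarrow> (v(m := b k)) i \<in> b ` {..<n}" using v that by auto
        then show ?thesis using Suc by simp
      qed
      then have "f (v(m := (\<Sum>k<n. \<phi> k (v m) *\<^sub>R b k))) = 0"
        by (simp add: linear_sum[OF lin] linear_scale[OF lin])
      then show "f v = 0" by (simp add: span)
    qed
  qed
  from this[of n] show ?thesis by auto
qed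

text \<open>Forms of top degree span a line: the combination of \<open>f\<close> and
  \<open>h\<close> that vanishes on \<open>b\<close> vanishes everywhere. The cross-multiplied shape
  avoids a case distinction on \<open>h b = 0\<close>.\<close>

lemma top_form_proportional:
  assumes f: "multilinear_form n f" "alternating n f" and h: "multilinear_form n h" "alternating n h"
    and span: "\<And>u. (\<Sum>k<n. \<phi> k u *\<^sub>R b k) = (u::'g::real_vector)"
  shows "f v * h b = f b * h v"
proof -
  have "f v * h b - f b * h v = 0"
  proof (rule alternating_multilinear_eq_0[where n = n and \<phi> = \<phi> and b = b and f = "\<lambda>v. f v * h b - f b * h v"])
    show "multilinear_form n (\<lambda>v. f v * h b - f b * h v)"
      using f(1) h(1) unfolding multilinear_form_def
      by (auto simp: linear_iff algebra_simps) metis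
    show "alternating n (\<lambda>v. f v * h b - f b * h v)"
      using f(2) h(2) by (simp add: alternating_def algebra_simps)
  qed (use span in auto)
  then show ?thesis by simp
qed

section \<open>Traces and contractions of curvature\<close>

lemma sum_lower_triangle:
  fixes a :: "nat \<Rightarrow> nat \<Rightarrow> real"
  assumes "\<And>i j. a i j = a j i" and "\<And>i. a i i = 0"
  shows "(\<Sum>j<n. \<Sum>i<j. a i j) = (\<Sum>j<n. \<Sum>i<n. a i j) / 2"
proof (induction n)
  case (Suc n)
  have "(\<Sum>i<n. a n i) = (\<Sum>i<n. a i n)" by (rule sum.cong) (auto simp: assms(1)[of n])
  with Suc show ?case by (simp add: sum.distrib assms(2))
qed simp

context dual_basis
begin

lemma orthonormal_parseval:
  assumes g: "inner_form (g::'g \<Rightarrow> 'g \<Rightarrow> real)" and E: "orthonormal_frame g E"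
  shows "(\<Sum>i<6. g u (E i) * g v (E i)) = g u v"
proof -
  note lr = inner_form_linear_right[OF g]
  have "g u v = g u (\<Sum>i<6. g v (E i) *\<^sub>R E i)" by (simp add: orthonormal_expansion[OF g E])
  then show ?thesis by (simp add: linear_sum[OF lr] linear_scale[OF lr] mult.commute)
qed

text \<open>Since the curvature is skew, the trace of \<open>Rm \<and> Rm\<close> is up to sign half the trace of a
  composition of endomorphisms, and so does not depend on the frame.\<close>

lemma trace_square_eq:
  assumes g: "inner_form (g::'g \<Rightarrow> 'g \<Rightarrow> real)" and lin: "\<And>u v. linear (R u v)"
    and skew: "\<And>u v w z. g (R u v w) z = - g w (R u v z)"
  shows "trace_square g R v = - (1 / 8) * (\<Sum>\<sigma> | \<sigma> permutes {..<2 + 2::nat}. of_int (sign \<sigma>) *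
     of_real (\<Sum>k<6. \<phi> k (R (v (\<sigma> 2)) (v (\<sigma> 3)) (R (v (\<sigma> 0)) (v (\<sigma> 1)) (b k)))))"
proof -
  define E where "E = (SOME E. orthonormal_frame g E)"
  have E: "orthonormal_frame g E"
    using someI_ex[OF exists_orthonormal_frame[OF g]] by (simp add: E_def)
  \<comment> \<open>The factor 1/2 comes from replacing the pairs \<open>i < j\<close> by all pairs,
    and the sign from moving one curvature operator across the metric. The two factorials in the
    wedge product contribute the remaining 1/4.\<close>
  have key: "(\<Sum>j<6. \<Sum>i<j. g (R p q (E j)) (E i) * g (R r s (E j)) (E i))
      = - (1 / 2) * (\<Sum>k<6. \<phi> k (R r s (R p q (b k))))" for p q r s
  proof -
    have skewE: "g (R u v (E j)) (E i) = - g (R u v (E i)) (E j)" for u v i j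
      using skew inner_form_sym[OF g] by metis
    have "(\<Sum>j<6. \<Sum>i<j. g (R p q (E j)) (E i) * g (R r s (E j)) (E i))
      = (\<Sum>j<6. \<Sum>i<6. g (R p q (E j)) (E i) * g (R r s (E j)) (E i)) / 2"
    proof (rule sum_lower_triangle)
      fix i j
      show "g (R p q (E j)) (E i) * g (R r s (E j)) (E i) = g (R p q (E i)) (E j) * g (R r s (E i)) (E j)"
        by (subst (1 2) skewE) simp
      show "g (R p q (E i)) (E i) * g (R r s (E i)) (E i) = 0"
        using skewE[of p q i i] by simp
    qed
    also have "\<dots> = (\<Sum>j<6. g (R p q (E j)) (R r s (E j))) / 2"
      by (simp add: orthonormal_parseval[OF g E])
    also have "\<dots> = (\<Sum>j<6. - g (R r s (R p q (E j))) (E j)) / 2"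
      by (simp add: skew[of r s "R p q (E _)"])
    also have "\<dots> = - (1 / 2) * (\<Sum>j<6. g (R r s (R p q (E j))) (E j))"
      by (simp add: sum_negf)
    also have "(\<Sum>j<6. g (R r s (R p q (E j))) (E j)) = (\<Sum>k<6. \<phi> k (R r s (R p q (b k))))"
      using trace_eq[OF g E linear_compose[OF lin[of p q] lin[of r s]]] by simp
    finally show ?thesis .
  qed
  have nums: "(2::nat) + 0 = 2" "(2::nat) + 1 = 3" by simp_all
  let ?P = "{\<sigma>. \<sigma> permutes {..<2 + 2::nat}}"
  have "trace_square g R v = (\<Sum>j<6. \<Sum>i<j. (\<Sum>\<sigma>\<in>?P. of_int (sign \<sigma>) *
      of_real (g (R (v (\<sigma> 0)) (v (\<sigma> 1)) (E j)) (E i)) * of_real (g (R (v (\<sigma> 2)) (v (\<sigma> 3)) (E j)) (E i))) / 4)"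
    by (simp only: trace_square_def Let_def wedge_def curvature_form_def nums fact_2 flip: E_def) simp
  also have "\<dots> = (\<Sum>\<sigma>\<in>?P. of_int (sign \<sigma>) * of_real (\<Sum>j<6. \<Sum>i<j.
      g (R (v (\<sigma> 0)) (v (\<sigma> 1)) (E j)) (E i) * g (R (v (\<sigma> 2)) (v (\<sigma> 3)) (E j)) (E i))) / 4"
    unfolding sum_divide_distrib[symmetric]
    by (simp only: sum.swap[where B = ?P] of_real_sum of_real_mult sum_distrib_left mult.assoc)
  also have "\<dots> = (\<Sum>\<sigma>\<in>?P. - (1 / 2) * (of_int (sign \<sigma>) *
     of_real (\<Sum>k<6. \<phi> k (R (v (\<sigma> 2)) (v (\<sigma> 3)) (R (v (\<sigma> 0)) (v (\<sigma> 1)) (b k)))))) / 4"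
    unfolding key by (simp only: of_real_mult) simp
  also have "\<dots> = - (1 / 8) * (\<Sum>\<sigma>\<in>?P. of_int (sign \<sigma>) *
     of_real (\<Sum>k<6. \<phi> k (R (v (\<sigma> 2)) (v (\<sigma> 3)) (R (v (\<sigma> 0)) (v (\<sigma> 1)) (b k)))))"
    by (simp only: sum_distrib_left[symmetric]) simp
  finally show ?thesis .
qed

end

section \<open>Contraction of curvature with the square of the fundamental form\<close>

lemma wedge_real:
  assumes "\<And>v. \<alpha> v \<in> \<real>" "\<And>v. \<beta> v \<in> \<real>"
  shows "wedge p q \<alpha> \<beta> v \<in> \<real>"
  unfolding wedge_def using assms
  by (intro Reals_divide sum_in_Reals Reals_mult) (auto simp: fact_in_Reals)

lemma wedge_sum_right:
  "wedge p q \<alpha> (\<lambda>w. \<Sum>i\<in>I. c i * \<beta> i w) v = (\<Sum>i\<in>I. c i * wedge p q \<alpha> (\<beta> i) v)"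
proof -
  have "(\<Sum>\<sigma> | \<sigma> permutes {..<p + q}. of_int (sign \<sigma>) * \<alpha> (\<lambda>i. v (\<sigma> i)) * (\<Sum>i\<in>I. c i * \<beta> i (\<lambda>i. v (\<sigma> (p + i)))))
      = (\<Sum>i\<in>I. c i * (\<Sum>\<sigma> | \<sigma> permutes {..<p + q}. of_int (sign \<sigma>) * \<alpha> (\<lambda>i. v (\<sigma> i)) * \<beta> i (\<lambda>i. v (\<sigma> (p + i)))))"
    by (subst sum_distrib_left, subst sum.swap) (simp add: sum_distrib_left algebra_simps)
  then show ?thesis unfolding wedge_def by (simp only: sum_divide_distrib[symmetric] times_divide_eq_right)
qed

lemma multilinear_form_of_real:
  assumes "\<And>v. linear (\<lambda>u. f u v)" "\<And>u. linear (f u)"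
  shows "multilinear_form 2 (\<lambda>v. of_real (f (v 0) (v 1)))"
  unfolding multilinear_form_def
proof (intro conjI allI impI)
  fix v :: "nat \<Rightarrow> 'a" and i :: nat
  assume "i < 2"
  then consider "i = 0" | "i = 1" by linarith
  then show "linear (\<lambda>x. complex_of_real (f ((v(i := x)) 0) ((v(i := x)) 1)))"
    using assms by cases (auto simp: linear_iff scaleR_conv_of_real)
qed auto

context dual_basis
begin

text \<open>Testing the defining identity on \<open>b\<close> against the six coordinate functionals
  forces the components of the endomorphism. Conversely these components work for every functional
  by linear expansion, and for every argument by proportionality of top-degree forms. A nonzero
  volume of \<open>b\<close> makes the definite description unambiguous.\<close>

lemma contracted_curvature_component:
  assumes w: "\<And>v. linear (\<lambda>u. w u v)" "\<And>u. linear (w u)"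
    and A: "\<And>v z. linear (\<lambda>u. A u v z)" "\<And>u z. linear (\<lambda>v. A u v z)"
    and \<omega>: "\<omega> = (\<lambda>v. of_real (w (v 0) (v 1)))"
    and nz: "power3_form \<omega> b \<noteq> 0" and "i < 6"
  shows "of_real (\<phi> i (contracted_curvature \<omega> A u))
    = wedge 4 2 (power2_form \<omega>) (\<lambda>v. of_real (\<phi> i (A (v 0) (v 1) u))) b / power3_form \<omega> b"
proof -
  define W where "W = (\<lambda>l u. wedge 4 2 (power2_form \<omega>) (\<lambda>v. of_real (l (A (v 0) (v 1) u))))"
  define K where "K = (\<lambda>u. \<Sum>i<6. Re (W (\<phi> i) u b / power3_form \<omega> b) *\<^sub>R b i)"
  have m2: "multilinear_form 2 \<omega>" unfolding \<omega> by (rule multilinear_form_of_real[OF w])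
  have m4: "multilinear_form 4 (power2_form \<omega>)"
    using multilinear_form_wedge[OF m2 m2] by (simp add: power2_form_def)
  have real2: "\<omega> v \<in> \<real>" for v by (simp add: \<omega>)
  have real4: "power2_form \<omega> v \<in> \<real>" for v by (simp add: power2_form_def wedge_real real2)
  have real6: "power3_form \<omega> v \<in> \<real>" "W l u v \<in> \<real>" for v l u
    by (auto simp: power3_form_def W_def intro!: wedge_real real4 real2)
  have top: "multilinear_form 6 (W l u)" "alternating 6 (W l u)" if "linear l" for l u
  proof -
    have "multilinear_form 2 (\<lambda>v. of_real (l (A (v 0) (v 1) u)))"
      using linear_compose[OF A(1) that] linear_compose[OF A(2) that]
      by (intro multilinear_form_of_real) (auto simp: o_def)
    from multilinear_form_wedge[OF m4 this] show "multilinear_form 6 (W l u)" by (simp add: W_def)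
    show "alternating 6 (W l u)" using alternating_wedge[of 4 2] by (simp add: W_def)
  qed
  have top3: "multilinear_form 6 (power3_form \<omega>)" "alternating 6 (power3_form \<omega>)"
    using multilinear_form_wedge[OF m4 m2] alternating_wedge[of 4 2] by (simp_all add: power3_form_def)
  \<comment> \<open>Both forms take real values, so the real part in the definition of
    \<open>K\<close> loses nothing.\<close>
  have Re: "of_real (Re (W l u b / power3_form \<omega> b)) = W l u b / power3_form \<omega> b" for l u
    using real6 by (intro of_real_Re Reals_divide) auto
  have W_expand: "W l u v = (\<Sum>i<6. of_real (l (b i)) * W (\<phi> i) u v)" if l: "linear l" for l u v
  proof -
    have "complex_of_real (l a) = (\<Sum>i<6. of_real (l (b i)) * of_real (\<phi> i a))" for a
      using linear_expand[OF l, of a] by (simp add: mult.commute)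
    then have "(\<lambda>v. complex_of_real (l (A (v 0) (v 1) u)))
        = (\<lambda>v. \<Sum>i<6. of_real (l (b i)) * of_real (\<phi> i (A (v 0) (v 1) u)))"
      by (intro ext)

    from arg_cong[OF this, of "\<lambda>\<beta>. wedge 4 2 (power2_form \<omega>) \<beta> v"] show ?thesis
      unfolding W_def wedge_sum_right .
  qed
  have K: "W l u v = of_real (l (K u)) * power3_form \<omega> v" if l: "linear l" for l u v
  proof -
    have "of_real (l (K u)) = (\<Sum>i<6. of_real (Re (W (\<phi> i) u b / power3_form \<omega> b)) * (of_real (l (b i)) :: complex))"
      by (simp add: K_def linear_sum[OF l] linear_scale[OF l])
    also have "\<dots> = (\<Sum>i<6. of_real (l (b i)) * W (\<phi> i) u b) / power3_form \<omega> b"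
      by (simp only: Re sum_divide_distrib) (simp add: mult.commute)
    also have "\<dots> = W l u b / power3_form \<omega> b" by (simp only: W_expand[OF l, of u b])
    finally have "W l u b = of_real (l (K u)) * power3_form \<omega> b" using nz by (simp add: field_simps)
    moreover have "W l u v * power3_form \<omega> b = W l u b * power3_form \<omega> v"
      by (rule top_form_proportional[OF top[OF l] top3 expand])
    ultimately have "W l u v * power3_form \<omega> b = of_real (l (K u)) * power3_form \<omega> v * power3_form \<omega> b"
      by (simp add: mult_ac)
    then show ?thesis using nz by simp
  qed
  have "contracted_curvature \<omega> A = K"
    unfolding contracted_curvature_def
  proof (rule the_equality)
    show "\<forall>l::'g \<Rightarrow> real. linear l \<longrightarrow> (\<forall>u v. wedge 4 2 (power2_form \<omega>) (\<lambda>w. of_real (l (A (w 0) (w 1) u))) v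
      = of_real (l (K u)) * power3_form \<omega> v)"
      using K by (simp add: W_def)
    fix K'
    assume K': "\<forall>l::'g \<Rightarrow> real. linear l \<longrightarrow> (\<forall>u v. wedge 4 2 (power2_form \<omega>) (\<lambda>w. of_real (l (A (w 0) (w 1) u))) v
      = of_real (l (K' u)) * power3_form \<omega> v)"
    have "\<phi> i (K' u) = \<phi> i (K u)" for i u
      using K'[rule_format, OF linear_phi[of i], of u b] K[OF linear_phi[of i], of u b] nz
      by (simp add: W_def)
    then show "K' = K" using expand by (metis (no_types, lifting) ext sum.cong)
  qed
  then show ?thesis
    using K[OF linear_phi[of i], of u b] nz by (simp add: W_def)
qed

end

section \<open>Chern, Bismut and Gauduchon connections\<close>

lemma hermitian_metric_inner_form: "hermitian_metric J g \<Longrightarrow> inner_form g"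
  by (auto simp: hermitian_metric_def inner_form_def)

locale complex_bracket = dual_basis b \<phi>
  for b :: "nat \<Rightarrow> 'g::real_vector" and \<phi> +
  fixes br :: "'g \<Rightarrow> 'g \<Rightarrow> 'g" and J :: "'g \<Rightarrow> 'g"
  assumes complex_structure: "complex_structure br J"
    and bilinear_br: "bilinear br" and br_skew: "br u v = - br v u"
begin

lemma linear_J: "linear J" and J_J [simp]: "J (J u) = - u"
  using complex_structure by (auto simp: complex_structure_def)

lemma br_J_J: "br (J u) (J v) = br u v + J (br (J u) v) + J (br u (J v))"
proof -
  have "br (J u) (J v) - br u v - J (br (J u) v) - J (br u (J v)) = 0"
    using complex_structure by (auto simp: complex_structure_def)
  then show ?thesis by (simp add: algebra_simps)
qed

definition lowered :: "('g \<Rightarrow> 'g \<Rightarrow> real) \<Rightarrow> 'g \<Rightarrow> 'g \<Rightarrow> 'g \<Rightarrow> real" where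
  "lowered g u v w = g (br u v) w"

text \<open>With \<open>\<nabla>\<close> the Levi-Civita connection, the Chern and the Bismut connection are
  \<open>g (\<nabla> u v) w - d\<omega> (J u) v w / 2\<close> and \<open>g (\<nabla> u v) w + d\<omega> (J u) (J v) (J w) / 2\<close>; inserting the
  Koszul formula and \<open>d\<omega> u v w = - \<omega> [u, v] w + \<omega> [u, w] v - \<omega> [v, w] u\<close> gives the expressions below.\<close>

definition chern_lowered :: "('g \<Rightarrow> 'g \<Rightarrow> real) \<Rightarrow> 'g \<Rightarrow> 'g \<Rightarrow> 'g \<Rightarrow> real" where
  "chern_lowered g u v w = (lowered g u v w + lowered g w u v
     - lowered g (J u) v (J w) + lowered g (J u) w (J v)) / 2"

definition bismut_lowered :: "('g \<Rightarrow> 'g \<Rightarrow> real) \<Rightarrow> 'g \<Rightarrow> 'g \<Rightarrow> 'g \<Rightarrow> real" where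
  "bismut_lowered g u v w = (lowered g u v w - lowered g v w u + lowered g w u v
     - lowered g (J u) (J v) w + lowered g (J u) (J w) v - lowered g (J v) (J w) u) / 2"

end

locale complex_bracket_metric = complex_bracket b \<phi> br J
  for b :: "nat \<Rightarrow> 'g::real_vector" and \<phi> br J +
  fixes g :: "'g \<Rightarrow> 'g \<Rightarrow> real"
  assumes hermitian: "hermitian_metric J g"
begin

lemma inner: "inner_form g" by (rule hermitian_metric_inner_form[OF hermitian])

lemmas g_left = inner_form_linear_left[OF inner]
lemmas g_right = inner_form_linear_right[OF inner]
lemmas g_eqI = inner_form_eqI[OF inner]

lemma g_sym: "g u v = g v u" by (rule inner_form_sym[OF inner])

lemma g_J_J [simp]: "g (J u) (J v) = g u v" using hermitian by (auto simp: hermitian_metric_def)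

lemma g_J_left: "g (J u) v = - g u (J v)"
  using g_J_J[of u "J v"] linear_neg[OF g_right] by simp

lemma lowered_linear:
  "linear (\<lambda>u. lowered g u v w)" "linear (\<lambda>v. lowered g u v w)" "linear (\<lambda>w. lowered g u v w)"
  using linear_compose[OF _ g_left[of w], of "\<lambda>u. br u v"] linear_compose[OF _ g_left[of w], of "br u"] bilinear_br
  by (auto simp: lowered_def[abs_def] bilinear_def o_def g_right)

lemma lowered_neg: "lowered g (- u) v w = - lowered g u v w" "lowered g u (- v) w = - lowered g u v w"
  "lowered g u v (- w) = - lowered g u v w"
  by (simp_all add: linear_neg[OF lowered_linear(1)] linear_neg[OF lowered_linear(2)] linear_neg[OF lowered_linear(3)])

lemma lowered_skew: "lowered g u v w = - lowered g v u w"
  unfolding lowered_def by (subst br_skew) (simp add: linear_neg[OF g_left])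

text \<open>The vanishing Nijenhuis tensor, paired with the metric. Integrability of
  \<open>J\<close> enters the connection formulas only in this shape.\<close>

lemma lowered_J_J: "lowered g (J u) (J v) w = lowered g u v w - lowered g (J u) v (J w) - lowered g u (J v) (J w)"
  by (simp add: lowered_def br_J_J linear_add[OF g_left] g_J_left)

text \<open>Riesz representation raises the last index; \<open>skew\<close> and \<open>cJ\<close>
  are the lowered versions of metric compatibility and of parallelism of \<open>J\<close>.\<close>

lemma connection_of_lowered:
  assumes "\<And>v w. linear (\<lambda>u. c u v w)" "\<And>u w. linear (\<lambda>v. c u v w)" "\<And>u v. linear (\<lambda>w. c u v w)"
    and skew: "\<And>u v w. c u v w + c u w v = 0" and cJ: "\<And>u v w. c u (J v) w = - c u v (J w)"
  shows "\<exists>D. hermitian_connection J g D \<and> (\<forall>u v w. g (D u v) w = c u v w)"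
proof -
  have "\<exists>X. \<forall>w. g X w = c u v w" for u v
    using exists_representer[OF inner assms(3)] .
  then obtain D where D: "\<And>u v w. g (D u v) w = c u v w" by metis
  have "bilinear D"
    unfolding bilinear_def linear_iff
    by (intro conjI allI g_eqI)
      (simp_all add: D linear_add[OF g_left] linear_scale[OF g_left] linear_add[OF assms(1)]
        linear_add[OF assms(2)] linear_scale[OF assms(1)] linear_scale[OF assms(2)])
  moreover have "g (D u v) w + g v (D u w) = 0" for u v w
    using skew[of u v w] by (simp add: D g_sym[of v])
  moreover have "D u (J v) = J (D u v)" for u v
    by (rule g_eqI) (simp add: D cJ g_J_left)
  ultimately show ?thesis using D by (auto simp: hermitian_connection_def)
qed

lemma lowered_simps:
  "lowered g (u + u') v w = lowered g u v w + lowered g u' v w"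
  "lowered g u (v + v') w = lowered g u v w + lowered g u v' w"
  "lowered g u v (w + w') = lowered g u v w + lowered g u v w'"
  "lowered g (r *\<^sub>R u) v w = r * lowered g u v w"
  "lowered g u (r *\<^sub>R v) w = r * lowered g u v w"
  "lowered g u v (r *\<^sub>R w) = r * lowered g u v w"
  using lowered_linear by (simp_all add: linear_iff)

section \<open>Existence and uniqueness of the Chern and Bismut connections\<close>

lemma chern_exists:
  "\<exists>D. hermitian_connection J g D \<and> (\<forall>u v w. g (D u v) w = chern_lowered g u v w)"
proof (rule connection_of_lowered)
  fix u v w
  show "chern_lowered g u v w + chern_lowered g u w v = 0"
    using lowered_skew[of w u v] lowered_skew[of u v w] by (simp add: chern_lowered_def field_simps)
  show "chern_lowered g u (J v) w = - chern_lowered g u v (J w)"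
    using lowered_J_J[of u v "J w"] lowered_J_J[of u w "J v"] lowered_skew[of w u "J v"] lowered_skew[of "J w" u v]
    by (simp add: chern_lowered_def lowered_neg field_simps)
qed (auto simp: linear_iff chern_lowered_def lowered_simps linear_add[OF linear_J] linear_scale[OF linear_J] field_simps)

lemma bismut_exists:
  "\<exists>D. hermitian_connection J g D \<and> (\<forall>u v w. g (D u v) w = bismut_lowered g u v w)"
proof (rule connection_of_lowered)
  fix u v w
  show "bismut_lowered g u v w + bismut_lowered g u w v = 0"
    using lowered_skew[of w u v] lowered_skew[of u v w] lowered_skew[of v w u] lowered_skew[of "J v" "J w" u]
    by (simp add: bismut_lowered_def field_simps)
  show "bismut_lowered g u (J v) w = - bismut_lowered g u v (J w)"
    using lowered_J_J[of u v "J w"] lowered_J_J[of u w "J v"] lowered_J_J[of v w "J u"]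
      lowered_skew[of w u "J v"] lowered_skew[of "J w" u v]
      lowered_J_J[of u v "w"] lowered_J_J[of u w "v"] lowered_J_J[of v w "u"]
    by (simp add: bismut_lowered_def lowered_neg field_simps)
qed (auto simp: linear_iff bismut_lowered_def lowered_simps linear_add[OF linear_J] linear_scale[OF linear_J] field_simps)

text \<open>The torsion condition makes the difference \<open>A\<close> of two such connections
  complex linear in the direction as well as in the differentiated vector. Replacing
  \<open>u\<close> and \<open>w\<close> by \<open>J u\<close> and \<open>J w\<close> in its skewness
  then reverses one sign, so \<open>A\<close> vanishes.\<close>

lemma chern_unique:
  assumes D: "hermitian_connection J g D" "\<And>u v. torsion br D (J u) v = torsion br D u (J v)"
    and D': "hermitian_connection J g D'" "\<And>u v. torsion br D' (J u) v = torsion br D' u (J v)"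
  shows "D' = D"
proof -
  define A where "A = (\<lambda>u v. D u v - D' u v)"
  have A_J: "A u (J v) = J (A u v)" for u v
    using D(1) D'(1) by (simp add: A_def hermitian_connection_def linear_diff[OF linear_J])
  have A_skew: "g (A u v) w = - g v (A u w)" for u v w
  proof -
    have "g (D u v) w + g v (D u w) = 0" "g (D' u v) w + g v (D' u w) = 0"
      using D(1) D'(1) by (auto simp: hermitian_connection_def)
    then show ?thesis by (simp add: A_def linear_diff[OF g_left] linear_diff[OF g_right])
  qed
  have A_neg: "A (- u) v = - A u v" for u v
  proof -
    have "linear (\<lambda>u. D u v)" "linear (\<lambda>u. D' u v)"
      using D(1) D'(1) by (auto simp: hermitian_connection_def bilinear_def)
    from linear_neg[OF this(1)] linear_neg[OF this(2)] show ?thesis by (simp add: A_def)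
  qed
  have tor: "A (J u) v - A v (J u) = A u (J v) - A (J v) u" for u v
  proof -
    have "A x y - A y x = torsion br D x y - torsion br D' x y" for x y
      by (simp add: A_def torsion_def)
    then show ?thesis using D(2)[of u v] D'(2)[of u v] by simp
  qed
  text \<open>\<open>P\<close> is antisymmetric, \<open>J\<close>-linear in its second and \<open>J\<close>-antilinear in its first argument.\<close>
  define P where "P = (\<lambda>u v. A (J u) v - J (A u v))"
  have P_anti: "P u v = - P v u" for u v
    using tor[of u v] unfolding P_def A_J by (simp add: algebra_simps)
  have P1: "P (J u) v = - J (P u v)" for u v
    by (simp add: P_def A_neg linear_diff[OF linear_J])
  have P2: "P u (J v) = J (P u v)" for u v
    by (simp add: P_def A_J linear_diff[OF linear_J])
  have "J (P u v) = 0" for u v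
  proof -
    have "J (P u v) = - P (J v) u" by (simp only: P2[symmetric] P_anti[of u "J v"])
    also have "\<dots> = J (P v u)" by (simp add: P1)
    also have "\<dots> = - J (P u v)" by (subst P_anti) (simp add: linear_neg[OF linear_J])
    finally have "J (P u v) + J (P u v) = 0" by (simp only: eq_neg_iff_add_eq_0)
    then have "2 *\<^sub>R J (P u v) = 0" by (simp only: scaleR_2)
    then show ?thesis by simp
  qed
  then have "P u v = 0" for u v
    using J_J[of "P u v"] linear_0[OF linear_J] by simp
  then have AJ1: "A (J u) v = J (A u v)" for u v by (simp add: P_def)
  have "A u v = 0" for u v
  proof (rule g_eqI)
    fix w
    have "g (A (J u) v) (J w) = - g v (A (J u) (J w))" by (rule A_skew)
    then have "g (A u v) w = g v (A u w)" by (simp add: AJ1 A_J linear_neg[OF g_right])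
    then show "g (A u v) w = g 0 w" using A_skew[of u v w] by (simp add: linear_0[OF g_left])
  qed
  then show ?thesis by (intro ext) (simp add: A_def)
qed

text \<open>Subtracting the torsion conditions makes the difference totally skew. Carrying
  \<open>J\<close> from the first argument to the third directly, or by way of the second, then
  yields opposite signs.\<close>

lemma bismut_unique:
  assumes D: "hermitian_connection J g D" "\<And>u v w. g (torsion br D u v) w = - g (torsion br D u w) v"
    and D': "hermitian_connection J g D'" "\<And>u v w. g (torsion br D' u v) w = - g (torsion br D' u w) v"
  shows "D' = D"
proof -
  define a where "a = (\<lambda>u v w. g (D u v) w - g (D' u v) w)"
  have a_J: "a u (J v) w = - a u v (J w)" for u v w
    using D(1) D'(1) by (simp add: a_def hermitian_connection_def g_J_left)
  have a_skew: "a u v w = - a u w v" for u v w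
  proof -
    have "g (D u v) w + g v (D u w) = 0" "g (D' u v) w + g v (D' u w) = 0"
      using D(1) D'(1) by (auto simp: hermitian_connection_def)
    then show ?thesis by (simp add: a_def g_sym[of v])
  qed
  have tor: "a u v w - a v u w = - (a u w v - a w u v)" for u v w
    using D(2)[of u v w] D'(2)[of u v w] unfolding a_def torsion_def
    by (simp add: linear_diff[OF g_left])
  have cyc: "a v u w = a w v u" for u v w
    using tor[of u v w] a_skew[of u v w] a_skew[of w u v] by linarith
  text \<open>\<open>a\<close> is totally skew, so moving \<open>J\<close> from one argument to any other one changes the sign.\<close>
  have a_J1: "a (J u) v w = - a u (J v) w" for u v w
    using cyc[of "J u" v w] a_J[of w u v] cyc[of u "J v" w] by linarith
  have a_J0: "a u v (J w) = 0" for u v w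
    using a_J1[of u v w] a_J[of u v w] a_skew[of "J u" v w] a_J1[of u w v] a_skew[of u "J w" v] by linarith
  have "a u v w = 0" for u v w
    using a_J0[of u v "J w"] by (simp add: a_def linear_neg[OF g_right])
  then have "D' u v = D u v" for u v by (intro g_eqI) (simp add: a_def)
  then show ?thesis by blast
qed

text \<open>By uniqueness, the definite description is evaluated once the explicit connection is
  seen to satisfy the torsion condition.\<close>

lemma chern_connection:
  shows "hermitian_connection J g (chern_connection br J g)"
    and "g (chern_connection br J g u v) w = chern_lowered g u v w"
proof -
  obtain D where D: "hermitian_connection J g D" "\<And>u v w. g (D u v) w = chern_lowered g u v w"
    using chern_exists by blast
  have "torsion br D (J u) v = torsion br D u (J v)" for u v
  proof (rule g_eqI)
    fix w
    show "g (torsion br D (J u) v) w = g (torsion br D u (J v)) w"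
      unfolding torsion_def linear_diff[OF g_left] D(2)
      using lowered_skew[of u v "J w"] lowered_skew[of w u "J v"] lowered_skew[of w v "J u"]
        lowered_skew[of w "J u" v] lowered_skew[of w "J v" u] lowered_skew[of "J u" v w]
        lowered_skew[of u "J v" w] lowered_skew[of "J u" "J v" "J w"]
      by (simp add: chern_lowered_def lowered_neg lowered_def[symmetric] field_simps)
  qed
  then have "chern_connection br J g = D"
    unfolding chern_connection_def using D(1) chern_unique[OF D(1)] by (intro the_equality) blast+
  then show "hermitian_connection J g (chern_connection br J g)"
    "g (chern_connection br J g u v) w = chern_lowered g u v w" using D by auto
qed

lemma bismut_connection:
  shows "hermitian_connection J g (bismut_connection br J g)"
    and "g (bismut_connection br J g u v) w = bismut_lowered g u v w"
proof -
  obtain D where D: "hermitian_connection J g D" "\<And>u v w. g (D u v) w = bismut_lowered g u v w"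
    using bismut_exists by blast
  have "g (torsion br D u v) w = - g (torsion br D u w) v" for u v w
    unfolding torsion_def linear_diff[OF g_left] D(2)
    using lowered_skew[of u v w] lowered_skew[of v w u] lowered_skew[of w u v]
      lowered_skew[of "J u" "J v" w] lowered_skew[of "J v" "J w" u] lowered_skew[of "J w" "J u" v]
    by (simp add: bismut_lowered_def lowered_def[symmetric] field_simps)
  then have "bismut_connection br J g = D"
    unfolding bismut_connection_def using D(1) bismut_unique[OF D(1)] by (intro the_equality) blast+
  then show "hermitian_connection J g (bismut_connection br J g)"
    "g (bismut_connection br J g u v) w = bismut_lowered g u v w" using D by auto
qed

lemma gauduchon_lowered:
  "g (gauduchon_connection br J \<tau> g u v) w =
     (1 + \<tau>) / 2 * chern_lowered g u v w + (1 - \<tau>) / 2 * bismut_lowered g u v w"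
  by (simp add: gauduchon_connection_def linear_add[OF g_left] linear_scale[OF g_left]
      chern_connection bismut_connection)

lemma hermitian_connection_gauduchon: "hermitian_connection J g (gauduchon_connection br J \<tau> g)"
proof -
  note c = chern_connection(1) and d = bismut_connection(1)
  let ?C = "chern_connection br J g" and ?B = "bismut_connection br J g"
  have bil: "bilinear ?C" "bilinear ?B" using c d by (auto simp: hermitian_connection_def)
  have "bilinear (gauduchon_connection br J \<tau> g)"
    unfolding bilinear_def linear_iff gauduchon_connection_def
    by (simp add: bil[THEN bilinear_ladd] bil[THEN bilinear_radd] bil[THEN bilinear_lmul] bil[THEN bilinear_rmul]
        algebra_simps)
  moreover have "g (gauduchon_connection br J \<tau> g u v) w + g v (gauduchon_connection br J \<tau> g u w) = 0" for u v w
  proof -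
    have 1: "g (?C u v) w = - g v (?C u w)" "g (?B u v) w = - g v (?B u w)"
      using c d by (auto simp: hermitian_connection_def eq_neg_iff_add_eq_0)
    show ?thesis unfolding gauduchon_connection_def linear_add[OF g_left] linear_scale[OF g_left]
      linear_add[OF g_right] linear_scale[OF g_right] 1 by simp
  qed
  moreover have "gauduchon_connection br J \<tau> g u (J v) = J (gauduchon_connection br J \<tau> g u v)" for u v
    using c d by (simp add: gauduchon_connection_def hermitian_connection_def linear_add[OF linear_J] linear_scale[OF linear_J])
  ultimately show ?thesis by (simp add: hermitian_connection_def)
qed

lemma curvature_linear:
  assumes "bilinear D"
  shows "linear (curvature br D u v)" "linear (\<lambda>u. curvature br D u v w)" "linear (\<lambda>v. curvature br D u v w)"
  unfolding linear_iff curvature_def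
  by (simp_all add: bilinear_ladd[OF assms] bilinear_radd[OF assms] bilinear_lmul[OF assms] bilinear_rmul[OF assms]
      bilinear_ladd[OF bilinear_br] bilinear_radd[OF bilinear_br] bilinear_lmul[OF bilinear_br] bilinear_rmul[OF bilinear_br]
      algebra_simps)

lemma curvature_skew:
  assumes D: "hermitian_connection J g D"
  shows "g (curvature br D u v w) z = - g w (curvature br D u v z)"
proof -
  have m: "g (D u v) w = - g v (D u w)" for u v w
    using D by (auto simp: hermitian_connection_def eq_neg_iff_add_eq_0)
  show ?thesis
    unfolding curvature_def linear_diff[OF g_left] linear_diff[OF g_right] m by simp
qed

end

section \<open>Quantities that differ by at most a multiple of the defect\<close>

locale comparison =
  fixes S :: "real set" and d :: "real \<Rightarrow> real"
  assumes d_nonneg: "t \<in> S \<Longrightarrow> 0 \<le> d t"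
begin

text \<open>Lipschitz dependence on \<open>d\<close>, uniformly on \<open>S\<close>. Boundedness of
  both curves is included because the difference of two products involves the factors themselves,
  not only their differences.\<close>

definition close :: "(real \<Rightarrow> 'v::real_normed_vector) \<Rightarrow> (real \<Rightarrow> 'v) \<Rightarrow> bool" where
  "close a a' \<longleftrightarrow> (\<exists>B\<ge>0. \<forall>t\<in>S. norm (a t) \<le> B \<and> norm (a' t) \<le> B \<and> norm (a t - a' t) \<le> B * d t)"

lemma closeI:
  assumes "\<And>t. t \<in> S \<Longrightarrow> norm (a t) \<le> B" "\<And>t. t \<in> S \<Longrightarrow> norm (a' t) \<le> B'"
    and "\<And>t. t \<in> S \<Longrightarrow> norm (a t - a' t) \<le> C * d t"
  shows "close a a'"
  unfolding close_def
proof (intro exI[of _ "\<bar>B\<bar> + \<bar>B'\<bar> + \<bar>C\<bar>"] conjI ballI)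
  fix t assume t: "t \<in> S"
  have "C * d t \<le> (\<bar>B\<bar> + \<bar>B'\<bar> + \<bar>C\<bar>) * d t" by (rule mult_right_mono) (use d_nonneg[OF t] in auto)
  then show "norm (a t - a' t) \<le> (\<bar>B\<bar> + \<bar>B'\<bar> + \<bar>C\<bar>) * d t" using assms(3)[OF t] by linarith
  show "norm (a t) \<le> \<bar>B\<bar> + \<bar>B'\<bar> + \<bar>C\<bar>" "norm (a' t) \<le> \<bar>B\<bar> + \<bar>B'\<bar> + \<bar>C\<bar>"
    using assms(1,2)[OF t] by linarith+
qed simp

lemma close_cong:
  assumes "close a a'" "\<And>t. t \<in> S \<Longrightarrow> a t = c t" "\<And>t. t \<in> S \<Longrightarrow> a' t = c' t"
  shows "close c c'"
  using assms unfolding close_def by auto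

lemma close_const: "close (\<lambda>t. c) (\<lambda>t. c)"
  by (rule closeI[where C = 0]) auto

lemma close_add:
  assumes "close a a'" "close c c'"
  shows "close (\<lambda>t. a t + c t) (\<lambda>t. a' t + c' t)"
proof -
  obtain A where A: "\<And>t. t \<in> S \<Longrightarrow> norm (a t) \<le> A" "\<And>t. t \<in> S \<Longrightarrow> norm (a' t) \<le> A"
    "\<And>t. t \<in> S \<Longrightarrow> norm (a t - a' t) \<le> A * d t" using assms(1) unfolding close_def by blast
  obtain C where C: "\<And>t. t \<in> S \<Longrightarrow> norm (c t) \<le> C" "\<And>t. t \<in> S \<Longrightarrow> norm (c' t) \<le> C"
    "\<And>t. t \<in> S \<Longrightarrow> norm (c t - c' t) \<le> C * d t" using assms(2) unfolding close_def by blast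
  show ?thesis
  proof (rule closeI)
    fix t assume t: "t \<in> S"
    show "norm (a t + c t) \<le> A + C" using A(1)[OF t] C(1)[OF t] norm_triangle_ineq[of "a t" "c t"] by linarith
    show "norm (a' t + c' t) \<le> A + C" using A(2)[OF t] C(2)[OF t] norm_triangle_ineq[of "a' t" "c' t"] by linarith
    show "norm (a t + c t - (a' t + c' t)) \<le> (A + C) * d t"
      using A(3)[OF t] C(3)[OF t] norm_diff_triangle_ineq[of "a t" "c t" "a' t" "c' t"] by (simp add: algebra_simps)
  qed
qed

lemma close_mult:
  fixes a :: "real \<Rightarrow> 'v::real_normed_algebra"
  assumes "close a a'" "close c c'"
  shows "close (\<lambda>t. a t * c t) (\<lambda>t. a' t * c' t)"
proof -
  obtain A where A: "A \<ge> 0" "\<And>t. t \<in> S \<Longrightarrow> norm (a t) \<le> A" "\<And>t. t \<in> S \<Longrightarrow> norm (a' t) \<le> A"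
    "\<And>t. t \<in> S \<Longrightarrow> norm (a t - a' t) \<le> A * d t" using assms(1) unfolding close_def by blast
  obtain C where C: "C \<ge> 0" "\<And>t. t \<in> S \<Longrightarrow> norm (c t) \<le> C" "\<And>t. t \<in> S \<Longrightarrow> norm (c' t) \<le> C"
    "\<And>t. t \<in> S \<Longrightarrow> norm (c t - c' t) \<le> C * d t" using assms(2) unfolding close_def by blast
  show ?thesis
  proof (rule closeI)
    fix t assume t: "t \<in> S"
    show "norm (a t * c t) \<le> A * C"
      using norm_mult_ineq[of "a t" "c t"] mult_mono[OF A(2)[OF t] C(2)[OF t]] A(1) by simp
    show "norm (a' t * c' t) \<le> A * C"
      using norm_mult_ineq[of "a' t" "c' t"] mult_mono[OF A(3)[OF t] C(3)[OF t]] A(1) by simp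
    have "a t * c t - a' t * c' t = (a t - a' t) * c t + a' t * (c t - c' t)" by (simp add: algebra_simps)
    then have "norm (a t * c t - a' t * c' t) \<le> norm (a t - a' t) * norm (c t) + norm (a' t) * norm (c t - c' t)"
      using norm_triangle_ineq[of "(a t - a' t) * c t" "a' t * (c t - c' t)"]
        norm_mult_ineq[of "a t - a' t" "c t"] norm_mult_ineq[of "a' t" "c t - c' t"] by simp
    also have "\<dots> \<le> A * d t * C + A * (C * d t)"
      using A C d_nonneg[OF t] t by (intro add_mono mult_mono) auto
    finally show "norm (a t * c t - a' t * c' t) \<le> (2 * A * C) * d t" by (simp add: algebra_simps)
  qed
qed

lemma close_cmult:
  fixes a :: "real \<Rightarrow> 'v::real_normed_algebra"
  shows "close a a' \<Longrightarrow> close (\<lambda>t. k * a t) (\<lambda>t. k * a' t)"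
  by (rule close_mult[OF close_const])

lemma close_minus: "close a a' \<Longrightarrow> close (\<lambda>t. - a t) (\<lambda>t. - a' t)"
  unfolding close_def by (auto simp: minus_diff_commute norm_minus_commute)

lemma close_diff: "close a a' \<Longrightarrow> close c c' \<Longrightarrow> close (\<lambda>t. a t - c t) (\<lambda>t. a' t - c' t)"
  using close_add[of a a' "\<lambda>t. - c t" "\<lambda>t. - c' t"] close_minus[of c c'] by simp

lemma close_sum:
  assumes "\<And>i. i \<in> I \<Longrightarrow> close (a i) (a' i)"
  shows "close (\<lambda>t. \<Sum>i\<in>I. a i t) (\<lambda>t. \<Sum>i\<in>I. a' i t)"
proof (cases "finite I")
  case True
  then show ?thesis using assms
    by (induction I rule: finite_induct) (auto intro: close_const close_add)
qed (simp add: close_const)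

lemma close_of_real:
  "close (\<lambda>t. of_real (a t) :: 'v::real_normed_div_algebra) (\<lambda>t. of_real (a' t)) \<longleftrightarrow> close a a'"
proof -
  have "norm (of_real x - of_real y :: 'v) = norm (x - y)" for x y :: real
    by (metis norm_of_real of_real_diff real_norm_def)
  then show ?thesis by (simp add: close_def)
qed

text \<open>The difference of the inverses is the difference of the curves multiplied by both
  inverses, and the uniform lower bound \<open>c\<close> controls these.\<close>

lemma close_inverse:
  fixes a :: "real \<Rightarrow> 'v::real_normed_div_algebra"
  assumes "close a a'" and c: "c > 0" "\<And>t. t \<in> S \<Longrightarrow> c \<le> norm (a t)" "\<And>t. t \<in> S \<Longrightarrow> c \<le> norm (a' t)"
  shows "close (\<lambda>t. Fields.inverse (a t)) (\<lambda>t. Fields.inverse (a' t))"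
proof -
  obtain A where A: "A \<ge> 0" "\<And>t. t \<in> S \<Longrightarrow> norm (a t - a' t) \<le> A * d t" using assms(1) unfolding close_def by blast
  show ?thesis
  proof (rule closeI)
    fix t assume t: "t \<in> S"
    have nz: "a t \<noteq> 0" "a' t \<noteq> 0" using c t by fastforce+
    show n: "norm (Fields.inverse (a t)) \<le> 1 / c" "norm (Fields.inverse (a' t)) \<le> 1 / c"
      using c(1) c(2)[OF t] c(3)[OF t] by (simp_all only: norm_inverse inverse_eq_divide[symmetric] le_imp_inverse_le)
    have "norm (Fields.inverse (a t) - Fields.inverse (a' t))
        = norm (Fields.inverse (a t)) * norm (a t - a' t) * norm (Fields.inverse (a' t))"
      by (simp add: inverse_diff_inverse nz norm_mult)
    also have "\<dots> \<le> (1 / c) * (A * d t) * (1 / c)"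
      using n A d_nonneg[OF t] t c by (intro mult_mono) auto
    finally show "norm (Fields.inverse (a t) - Fields.inverse (a' t)) \<le> (A / c^2) * d t"
      by (simp add: power2_eq_square field_simps)
  qed
qed

lemma close_bounded_difference:
  assumes "close a a'"
  shows "\<exists>C\<ge>0. \<forall>t\<in>S. norm (a t - a' t) \<le> C * d t"
  using assms unfolding close_def by blast

end

section \<open>Curves compared with their images under a symmetry\<close>

locale symmetric_comparison = complex_bracket b \<phi> br J + comparison S d
  for b :: "nat \<Rightarrow> 'g::real_vector" and \<phi> br J S d +
  fixes F G :: "'g \<Rightarrow> 'g"
  assumes linear_F: "linear F" and F_G [simp]: "F (G u) = u" and G_F [simp]: "G (F u) = u"
    and F_J: "F (J u) = J (F u)" and F_br: "F (br u v) = br (F u) (F v)"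
begin

lemma linear_G: "linear G"
proof -
  have "G (u + v) = G (F (G u + G v))" "G (c *\<^sub>R u) = G (F (c *\<^sub>R G u))" for u v c
    by (simp_all only: linear_add[OF linear_F] linear_scale[OF linear_F] F_G)
  then show ?thesis by (simp add: linear_iff)
qed

text \<open>A basis formula evaluated in the moved basis has the coordinates
  \<open>\<phi> k (G u)\<close>, which are exactly those of the pulled-back vector. This is how the
  second curve of a comparison is computed.\<close>

lemma dual_basis_image: "dual_basis (\<lambda>k. F (b k)) (\<lambda>k u. \<phi> k (G u))"
proof (rule dual_basis.intro)
  show "linear (\<lambda>u. \<phi> k (G u))" for k
    using linear_compose[OF linear_G linear_phi] by (simp add: o_def)
  show "(\<Sum>k<6. \<phi> k (G u) *\<^sub>R F (b k)) = u" for u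
  proof -
    have "(\<Sum>k<6. \<phi> k (G u) *\<^sub>R F (b k)) = F (\<Sum>k<6. \<phi> k (G u) *\<^sub>R b k)"
      by (simp only: linear_sum[OF linear_F] linear_scale[OF linear_F])
    then show ?thesis by (simp add: expand)
  qed
qed (simp add: dual)

sublocale image: dual_basis "\<lambda>k. F (b k)" "\<lambda>k u. \<phi> k (G u)"
  by (rule dual_basis_image)

text \<open>The second curve is pulled back by \<open>F\<close> before the comparison.\<close>

definition vclose :: "(real \<Rightarrow> 'g) \<Rightarrow> (real \<Rightarrow> 'g) \<Rightarrow> bool" where
  "vclose X X' \<longleftrightarrow> (\<forall>k<6. close (\<lambda>t. \<phi> k (X t)) (\<lambda>t. \<phi> k (G (X' t))))"

lemma vclose_const: "vclose (\<lambda>t. u) (\<lambda>t. F u)"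
  by (simp add: vclose_def close_const)

lemma vclose_diff: "vclose X X' \<Longrightarrow> vclose Y Y' \<Longrightarrow> vclose (\<lambda>t. X t - Y t) (\<lambda>t. X' t - Y' t)"
  by (simp add: vclose_def linear_diff[OF linear_phi] linear_diff[OF linear_G] close_diff)

text \<open>Closeness on fixed vectors extends to moving ones: expand \<open>X t\<close> in the
  basis and \<open>X' t\<close> in the image basis, so that only finitely many products of close
  functions occur.\<close>

lemma close_linear:
  assumes B: "\<And>t. t \<in> S \<Longrightarrow> linear (B t)" "\<And>t. t \<in> S \<Longrightarrow> linear (B' t)"
    and c: "\<And>u. close (\<lambda>t. B t u) (\<lambda>t. B' t (F u) :: real)" and X: "vclose X X'"
  shows "close (\<lambda>t. B t (X t)) (\<lambda>t. B' t (X' t))"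
proof (rule close_cong)
  show "close (\<lambda>t. \<Sum>k<6. \<phi> k (X t) * B t (b k)) (\<lambda>t. \<Sum>k<6. \<phi> k (G (X' t)) * B' t (F (b k)))"
    using X c by (intro close_sum close_mult) (auto simp: vclose_def)
  fix t assume "t \<in> S"
  then show "(\<Sum>k<6. \<phi> k (X t) * B t (b k)) = B t (X t)"
      "(\<Sum>k<6. \<phi> k (G (X' t)) * B' t (F (b k))) = B' t (X' t)"
    using linear_expand[OF B(1), of t "X t"] image.linear_expand[OF B(2), of t "X' t"] by simp_all
qed

lemma close_bilinear:
  assumes B: "\<And>t. t \<in> S \<Longrightarrow> bilinear (B t)" "\<And>t. t \<in> S \<Longrightarrow> bilinear (B' t)"
    and c: "\<And>u v. close (\<lambda>t. B t u v) (\<lambda>t. B' t (F u) (F v) :: real)"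
    and X: "vclose X X'" and Y: "vclose Y Y'"
  shows "close (\<lambda>t. B t (X t) (Y t)) (\<lambda>t. B' t (X' t) (Y' t))"
proof (rule close_linear[where B = "\<lambda>t u. B t u (Y t)" and B' = "\<lambda>t u. B' t u (Y' t)", OF _ _ _ X])
  show "linear (\<lambda>u. B t u (Y t))" "linear (\<lambda>u. B' t u (Y' t))" if "t \<in> S" for t
    using B[OF that] by (auto simp: bilinear_def)
  show "close (\<lambda>t. B t u (Y t)) (\<lambda>t. B' t (F u) (Y' t))" for u
    using B by (intro close_linear[where B = "\<lambda>t. B t u" and B' = "\<lambda>t. B' t (F u)", OF _ _ c Y]) (auto simp: bilinear_def)
qed

lemma vclose_bilinear:
  assumes B: "\<And>t. t \<in> S \<Longrightarrow> bilinear (B t)"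
    and c: "\<And>u v. vclose (\<lambda>t. B t u v) (\<lambda>t. B t (F u) (F v))"
    and X: "vclose X X'" and Y: "vclose Y Y'"
  shows "vclose (\<lambda>t. B t (X t) (Y t)) (\<lambda>t. B t (X' t) (Y' t))"
  unfolding vclose_def
proof (intro allI impI)
  fix k :: nat assume k: "k < 6"
  show "close (\<lambda>t. \<phi> k (B t (X t) (Y t))) (\<lambda>t. \<phi> k (G (B t (X' t) (Y' t))))"
  proof (rule close_bilinear[OF _ _ _ X Y])
    fix t assume "t \<in> S"
    then have "linear (\<lambda>u. B t u v)" "linear (B t u)" for u v using B by (auto simp: bilinear_def)
    then show "bilinear (\<lambda>u v. \<phi> k (B t u v))" "bilinear (\<lambda>u v. \<phi> k (G (B t u v)))"
      using linear_compose[OF _ linear_phi[of k]] linear_compose[OF _ image.linear_phi[of k]]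
      by (auto simp: bilinear_def o_def)
  next
    show "close (\<lambda>t. \<phi> k (B t u v)) (\<lambda>t. \<phi> k (G (B t (F u) (F v))))" for u v
      using c k by (simp add: vclose_def)
  qed
qed

lemma vclose_br: "vclose X X' \<Longrightarrow> vclose Y Y' \<Longrightarrow> vclose (\<lambda>t. br (X t) (Y t)) (\<lambda>t. br (X' t) (Y' t))"
  by (rule vclose_bilinear[of "\<lambda>t. br"]) (simp_all only: bilinear_br F_br[symmetric] vclose_const)

lemma vclose_curvature:
  assumes D: "\<And>t. t \<in> S \<Longrightarrow> bilinear (D t)" "\<And>u v. vclose (\<lambda>t. D t u v) (\<lambda>t. D t (F u) (F v))"
    and X: "vclose X X'" and Y: "vclose Y Y'" and Z: "vclose Z Z'"
  shows "vclose (\<lambda>t. curvature br (D t) (X t) (Y t) (Z t)) (\<lambda>t. curvature br (D t) (X' t) (Y' t) (Z' t))"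
  unfolding curvature_def
  by (intro vclose_diff vclose_bilinear[OF D] vclose_br X Y Z)

text \<open>The uniform lower bound makes index raising compatible with closeness, see
  \<open>vclose_if_lowered_close\<close>.\<close>

definition metrics_close :: "(real \<Rightarrow> 'g \<Rightarrow> 'g \<Rightarrow> real) \<Rightarrow> bool" where
  "metrics_close g \<longleftrightarrow> (\<forall>t\<in>S. hermitian_metric J (g t)) \<and>
     (\<forall>u v. close (\<lambda>t. g t u v) (\<lambda>t. g t (F u) (F v))) \<and>
     (\<exists>c>0. \<forall>t\<in>S. \<forall>u. c * (\<Sum>k<6. (\<phi> k u)\<^sup>2) \<le> g t u u \<and> c * (\<Sum>k<6. (\<phi> k u)\<^sup>2) \<le> g t (F u) (F u))"

end

text \<open>If \<open>m\<close> is the largest of the \<bar>x k\<bar>, the hypotheses give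
  \<open>c * m * m \<le> n * m * A\<close>, and \<open>m\<close> cancels. In the application
  \<open>x\<close> holds the coordinates of a vector and \<open>a\<close> its pairings with the
  basis.\<close>

lemma coercive_bound:
  fixes x a :: "nat \<Rightarrow> real"
  assumes c: "c > 0" "c * (\<Sum>k<n. (x k)\<^sup>2) \<le> (\<Sum>k<n. x k * a k)" and a: "\<And>k. k < n \<Longrightarrow> \<bar>a k\<bar> \<le> A"
    and k: "k < n"
  shows "\<bar>x k\<bar> \<le> real n * A / c"
proof -
  define m where "m = Max ((\<lambda>k. \<bar>x k\<bar>) ` {..<n})"
  have m: "\<bar>x j\<bar> \<le> m" if "j < n" for j using that by (auto simp: m_def)
  have "m \<in> (\<lambda>k. \<bar>x k\<bar>) ` {..<n}" unfolding m_def using k by (intro Max_in) auto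
  then obtain i where i: "i < n" "m = \<bar>x i\<bar>" by auto
  have "c * m\<^sup>2 \<le> c * (\<Sum>k<n. (x k)\<^sup>2)"
    using i c by (intro mult_left_mono) (auto intro: member_le_sum[of i "{..<n}" "\<lambda>k. (x k)\<^sup>2"])
  also have "\<dots> \<le> (\<Sum>k<n. x k * a k)" by fact
  also have "\<dots> \<le> (\<Sum>k<n. m * A)"
  proof (rule sum_mono)
    fix j assume "j \<in> {..<n}"
    then have "\<bar>x j\<bar> * \<bar>a j\<bar> \<le> m * A" using m[of j] a[of j] by (intro mult_mono) auto
    then show "x j * a j \<le> m * A" using abs_ge_self[of "x j * a j"] by (simp only: abs_mult)
  qed
  finally have "m * (c * m) \<le> m * (real n * A)" by (simp add: power2_eq_square algebra_simps)
  moreover have "0 \<le> A" using a[OF k] by linarith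
  moreover have "m \<ge> 0" using i by simp
  ultimately have "c * m \<le> real n * A"
    using c by (cases "m = 0") (auto simp: mult_le_cancel_left)
  then have "m \<le> real n * A / c" using c by (simp add: field_simps)
  then show ?thesis using m[OF k] by linarith
qed

context symmetric_comparison
begin

text \<open>Raising an index is Lipschitz for uniformly positive metrics. Coercivity is used three
  times: for \<open>X\<close>, for the pulled-back \<open>X'\<close>, and for their
  difference.\<close>

lemma vclose_if_lowered_close:
  assumes g: "metrics_close g" and X: "\<And>w. close (\<lambda>t. g t (X t) w) (\<lambda>t. g t (X' t) (F w))"
  shows "vclose X X'"
proof -
  obtain c where c: "c > 0" "\<And>t u. t \<in> S \<Longrightarrow> c * (\<Sum>k<6. (\<phi> k u)\<^sup>2) \<le> g t u u"
    "\<And>t u. t \<in> S \<Longrightarrow> c * (\<Sum>k<6. (\<phi> k u)\<^sup>2) \<le> g t (F u) (F u)"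
    using g unfolding metrics_close_def by blast
  have inner: "inner_form (g t)" if "t \<in> S" for t
    using g that hermitian_metric_inner_form by (auto simp: metrics_close_def)
  note gl = inner_form_linear_left[OF inner] and gr = inner_form_linear_right[OF inner]
  have "\<exists>B\<ge>0. \<forall>t\<in>S. \<bar>g t (X t) (b k)\<bar> \<le> B \<and> \<bar>g t (X' t) (F (b k))\<bar> \<le> B
      \<and> \<bar>g t (X t) (b k) - g t (X' t) (F (b k))\<bar> \<le> B * d t" for k
    using X[of "b k"] by (simp add: close_def)
  then obtain B where B: "\<And>k. B k \<ge> 0" "\<And>k t. t \<in> S \<Longrightarrow> \<bar>g t (X t) (b k)\<bar> \<le> B k"
      "\<And>k t. t \<in> S \<Longrightarrow> \<bar>g t (X' t) (F (b k))\<bar> \<le> B k"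
      "\<And>k t. t \<in> S \<Longrightarrow> \<bar>g t (X t) (b k) - g t (X' t) (F (b k))\<bar> \<le> B k * d t"
    by metis
  define M where "M = (\<Sum>k<6. B k)"
  have BM: "B k \<le> M" if "k < 6" for k unfolding M_def by (rule member_le_sum) (use that B(1) in auto)
  have x1: "\<bar>\<phi> k (X t)\<bar> \<le> real 6 * M / c" if "k < 6" "t \<in> S" for k t
  proof (rule coercive_bound[where x = "\<lambda>k. \<phi> k (X t)" and a = "\<lambda>k. g t (X t) (b k)", OF c(1) _ _ that(1)])
    show "c * (\<Sum>k<6. (\<phi> k (X t))\<^sup>2) \<le> (\<Sum>k<6. \<phi> k (X t) * g t (X t) (b k))"
      using c(2)[OF that(2), of "X t"] linear_expand[OF gr[OF that(2), of "X t"], of "X t"] by simp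
    show "\<bar>g t (X t) (b j)\<bar> \<le> M" if "j < 6" for j
      using B(2)[OF \<open>t \<in> S\<close>, of j] BM[OF that] by linarith
  qed
  have x2: "\<bar>\<phi> k (G (X' t))\<bar> \<le> real 6 * M / c" if "k < 6" "t \<in> S" for k t
  proof (rule coercive_bound[where x = "\<lambda>k. \<phi> k (G (X' t))" and a = "\<lambda>k. g t (X' t) (F (b k))", OF c(1) _ _ that(1)])
    show "c * (\<Sum>k<6. (\<phi> k (G (X' t)))\<^sup>2) \<le> (\<Sum>k<6. \<phi> k (G (X' t)) * g t (X' t) (F (b k)))"
      using c(3)[OF that(2), of "G (X' t)"] image.linear_expand[OF gr[OF that(2), of "X' t"], of "X' t"] by simp
    show "\<bar>g t (X' t) (F (b j))\<bar> \<le> M" if "j < 6" for j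
      using B(3)[OF \<open>t \<in> S\<close>, of j] BM[OF that] by linarith
  qed
  define M' where "M' = real 6 * M / c"
  have "\<exists>B\<ge>0. \<forall>t\<in>S. \<bar>g t (b j) (b k) - g t (F (b j)) (F (b k))\<bar> \<le> B * d t" for j k
    using g close_bounded_difference by (fastforce simp: metrics_close_def)
  then obtain C where C: "\<And>j k. C j k \<ge> 0"
      "\<And>j k t. t \<in> S \<Longrightarrow> \<bar>g t (b j) (b k) - g t (F (b j)) (F (b k))\<bar> \<le> C j k * d t"
    by metis
  \<comment> \<open>\<open>M\<close> accounts for the difference of the lowered vectors, the double
    sum for the difference between the metric and its pull-back, weighted by the bound
    \<open>M'\<close> on the coordinates of the pulled-back \<open>X'\<close>.\<close>
  define N where "N = M + (\<Sum>k<6. \<Sum>j<6. M' * C j k)"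
  have M'0: "M' \<ge> 0" using c(1) B(1) by (simp add: M'_def M_def sum_nonneg)
  have diff: "\<bar>\<phi> k (X t) - \<phi> k (G (X' t))\<bar> \<le> real 6 * (N * d t) / c" if k: "k < 6" and t: "t \<in> S" for k t
  proof -
    define Y where "Y = G (X' t)"
    let ?W = "X t - Y"
    have "\<bar>\<phi> k ?W\<bar> \<le> real 6 * (N * d t) / c"
    proof (rule coercive_bound[where x = "\<lambda>k. \<phi> k ?W" and a = "\<lambda>k. g t ?W (b k)", OF c(1) _ _ k])
      show "c * (\<Sum>k<6. (\<phi> k ?W)\<^sup>2) \<le> (\<Sum>k<6. \<phi> k ?W * g t ?W (b k))"
        using c(2)[OF t, of ?W] linear_expand[OF gr[OF t, of ?W], of ?W] by simp
      fix i :: nat assume i: "i < 6"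
      have e1: "g t Y (b i) = (\<Sum>j<6. \<phi> j Y * g t (b j) (b i))"
        using linear_expand[OF gl[OF t], of Y] by simp
      have e2: "g t (X' t) (F (b i)) = (\<Sum>j<6. \<phi> j Y * g t (F (b j)) (F (b i)))"
        using image.linear_expand[OF gl[OF t], of "X' t"] by (simp add: Y_def)
      \<comment> \<open>Both vectors have to be lowered with the same metric; exchanging the
        pulled-back metric for \<open>g t\<close> costs the last sum.\<close>
      have "g t ?W (b i) = (g t (X t) (b i) - g t (X' t) (F (b i)))
          - (\<Sum>j<6. \<phi> j Y * (g t (b j) (b i) - g t (F (b j)) (F (b i))))"
        by (simp add: linear_diff[OF gl[OF t]] e1 e2 right_diff_distrib sum_subtractf)
      moreover have "\<bar>\<Sum>j<6. \<phi> j Y * (g t (b j) (b i) - g t (F (b j)) (F (b i)))\<bar> \<le> (\<Sum>j<6. M' * (C j i * d t))"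
      proof (rule order_trans[OF sum_abs], rule sum_mono)
        fix j :: nat assume "j \<in> {..<6}"
        then show "\<bar>\<phi> j Y * (g t (b j) (b i) - g t (F (b j)) (F (b i)))\<bar> \<le> M' * (C j i * d t)"
          using x2[OF _ t, of j] C(2)[OF t, of j i] M'0 unfolding abs_mult
          by (intro mult_mono) (auto simp: Y_def M'_def)
      qed
      moreover have "\<bar>g t (X t) (b i) - g t (X' t) (F (b i))\<bar> \<le> M * d t"
        using B(4)[OF t, of i] mult_right_mono[OF BM[OF i] d_nonneg[OF t]] by linarith
      moreover have "(\<Sum>j<6. M' * (C j i * d t)) \<le> (\<Sum>k<6. \<Sum>j<6. M' * C j k) * d t"
      proof -
        have "(\<Sum>j<6. M' * C j i) \<le> (\<Sum>k<6. \<Sum>j<6. M' * C j k)"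
          using i M'0 C(1) by (intro member_le_sum[of i "{..<6}" "\<lambda>k. \<Sum>j<6. M' * C j k"]) (auto intro!: sum_nonneg)
        from mult_right_mono[OF this d_nonneg[OF t]] show ?thesis
          by (simp add: sum_distrib_right mult.assoc)
      qed
      ultimately show "\<bar>g t ?W (b i)\<bar> \<le> N * d t"
        unfolding N_def by (simp only: distrib_right)
    qed
    then show ?thesis by (simp add: linear_diff[OF linear_phi] Y_def)
  qed
  show ?thesis
    unfolding vclose_def
    using x1 x2 diff by (intro allI impI closeI[where C = "real 6 * N / c"]) (auto simp: algebra_simps)
qed

end

section \<open>Closeness of the terms of the flow equations\<close>

context symmetric_comparison
begin

definition forms_close :: "(real \<Rightarrow> 'g form) \<Rightarrow> (real \<Rightarrow> 'g form) \<Rightarrow> bool" where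
  "forms_close \<alpha> \<alpha>' \<longleftrightarrow> (\<forall>v. close (\<lambda>t. \<alpha> t v) (\<lambda>t. \<alpha>' t (\<lambda>i. F (v i))))"

lemma forms_close_wedge:
  assumes "forms_close \<alpha> \<alpha>'" "forms_close \<beta> \<beta>'"
  shows "forms_close (\<lambda>t. wedge p q (\<alpha> t) (\<beta> t)) (\<lambda>t. wedge p q (\<alpha>' t) (\<beta>' t))"
  unfolding forms_close_def wedge_def divide_inverse
proof (intro allI close_mult close_sum close_const)
  fix v :: "nat \<Rightarrow> 'g" and \<sigma> :: "nat \<Rightarrow> nat"
  show "close (\<lambda>t. \<alpha> t (\<lambda>i. v (\<sigma> i))) (\<lambda>t. \<alpha>' t (\<lambda>i. F (v (\<sigma> i))))"
    using assms(1)[unfolded forms_close_def, rule_format, of "\<lambda>i. v (\<sigma> i)"] .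
  show "close (\<lambda>t. \<beta> t (\<lambda>i. v (\<sigma> (p + i)))) (\<lambda>t. \<beta>' t (\<lambda>i. F (v (\<sigma> (p + i)))))"
    using assms(2)[unfolded forms_close_def, rule_format, of "\<lambda>i. v (\<sigma> (p + i))"] .
qed

lemma forms_close_ext_deriv:
  assumes "forms_close \<alpha> \<alpha>'"
  shows "forms_close (\<lambda>t. ext_deriv br k (\<alpha> t)) (\<lambda>t. ext_deriv br k (\<alpha>' t))"
  unfolding forms_close_def ext_deriv_def
proof (intro allI close_cmult close_sum)
  fix v :: "nat \<Rightarrow> 'g" and i j
  have "bracket_args br i j (\<lambda>i. F (v i)) = (\<lambda>m. F (bracket_args br i j v m))"
    by (auto simp: bracket_args_def F_br split: nat.split)
  then show "close (\<lambda>t. \<alpha> t (bracket_args br i j v)) (\<lambda>t. \<alpha>' t (bracket_args br i j (\<lambda>i. F (v i))))"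
    using assms by (simp add: forms_close_def)
qed

lemma forms_close_type_part:
  assumes "forms_close \<alpha> \<alpha>'"
  shows "forms_close (\<lambda>t. type_part J p q (\<alpha> t)) (\<lambda>t. type_part J p q (\<alpha>' t))"
  unfolding forms_close_def type_part_def divide_inverse
proof (intro allI close_mult close_sum close_const)
  fix v :: "nat \<Rightarrow> 'g" and T :: "nat set"
  have "(\<lambda>m. if m \<in> T then J (F (v m)) else F (v m)) = (\<lambda>m. F (if m \<in> T then J (v m) else v m))"
    by (auto simp: F_J)
  then show "close (\<lambda>t. \<alpha> t (\<lambda>m. if m \<in> T then J (v m) else v m))
      (\<lambda>t. \<alpha>' t (\<lambda>m. if m \<in> T then J (F (v m)) else F (v m)))"
    using assms by (simp add: forms_close_def)
qed

lemma forms_close_del: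
  "forms_close \<alpha> \<alpha>' \<Longrightarrow> forms_close (\<lambda>t. del br J p q (\<alpha> t)) (\<lambda>t. del br J p q (\<alpha>' t))"
  and forms_close_delbar:
  "forms_close \<alpha> \<alpha>' \<Longrightarrow> forms_close (\<lambda>t. delbar br J p q (\<alpha> t)) (\<lambda>t. delbar br J p q (\<alpha>' t))"
  unfolding del_def delbar_def by (rule forms_close_type_part, erule forms_close_ext_deriv)+

lemma metrics_closeD:
  assumes "metrics_close g"
  shows "close (\<lambda>t. g t u v) (\<lambda>t. g t (F u) (F v))" "t \<in> S \<Longrightarrow> hermitian_metric J (g t)"
  using assms unfolding metrics_close_def by blast+

lemma complex_bracket_metricI:
  assumes "metrics_close g" "t \<in> S"
  shows "complex_bracket_metric b \<phi> br J (g t)"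
  by (intro complex_bracket_metric.intro complex_bracket_metric_axioms.intro complex_bracket_axioms
      metrics_closeD(2)[OF assms])

lemma forms_close_fund_form:
  assumes "metrics_close g"
  shows "forms_close (\<lambda>t. fund_form J (g t)) (\<lambda>t. fund_form J (g t))"
  unfolding forms_close_def fund_form_def close_of_real F_J[symmetric]
  using metrics_closeD(1)[OF assms] by blast

text \<open>Only the lowered connection is explicit in the metric and the bracket; the uniform
  positivity in \<open>metrics_close\<close> is what allows its index to be raised.\<close>

lemma vclose_gauduchon:
  assumes g: "metrics_close g"
  shows "vclose (\<lambda>t. gauduchon_connection br J \<tau> (g t) u v) (\<lambda>t. gauduchon_connection br J \<tau> (g t) (F u) (F v))"
proof (rule vclose_if_lowered_close[OF g])
  fix w
  have L: "close (\<lambda>t. lowered (g t) u v w) (\<lambda>t. lowered (g t) (F u) (F v) (F w))" for u v w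
    unfolding lowered_def F_br[symmetric] by (rule metrics_closeD(1)[OF g])
  let ?f = "\<lambda>u v w t. (1 + \<tau>) / 2 * chern_lowered (g t) u v w + (1 - \<tau>) / 2 * bismut_lowered (g t) u v w"
  have eq: "?f u v w t = g t (gauduchon_connection br J \<tau> (g t) u v) w" if "t \<in> S" for u v w t
  proof -
    interpret complex_bracket_metric b \<phi> br J "g t" by (rule complex_bracket_metricI[OF g that])
    show ?thesis by (rule gauduchon_lowered[symmetric])
  qed
  have "close (?f u v w) (?f (F u) (F v) (F w))"
    unfolding chern_lowered_def bismut_lowered_def divide_inverse F_J[symmetric]
    by (intro close_add close_mult close_const close_diff L)
  then show "close (\<lambda>t. g t (gauduchon_connection br J \<tau> (g t) u v) w)
      (\<lambda>t. g t (gauduchon_connection br J \<tau> (g t) (F u) (F v)) (F w))"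
    by (rule close_cong) (simp_all only: eq)
qed

lemma bilinear_gauduchon:
  assumes g: "metrics_close g" and t: "t \<in> S"
  shows "bilinear (gauduchon_connection br J \<tau> (g t))"
proof -
  interpret complex_bracket_metric b \<phi> br J "g t" by (rule complex_bracket_metricI[OF g t])
  show ?thesis using hermitian_connection_gauduchon by (auto simp: hermitian_connection_def)
qed

lemma vclose_gauduchon_curvature:
  assumes g: "metrics_close g" and "vclose X X'" "vclose Y Y'" "vclose Z Z'"
  shows "vclose (\<lambda>t. gauduchon_curvature br J \<tau> (g t) (X t) (Y t) (Z t))
    (\<lambda>t. gauduchon_curvature br J \<tau> (g t) (X' t) (Y' t) (Z' t))"
  unfolding gauduchon_curvature_def
  by (rule vclose_curvature[where D = "\<lambda>t. gauduchon_connection br J \<tau> (g t)",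
      OF bilinear_gauduchon[OF g] vclose_gauduchon[OF g] assms(2-4)])

text \<open>The frame selected in \<open>trace_square\<close> need not vary continuously with time.
  It is replaced by the frame-free trace formula, read in the basis \<open>b\<close> for the curve
  and in the moved basis for its pull-back.\<close>

lemma forms_close_trace_square:
  assumes g: "metrics_close g"
  shows "forms_close (\<lambda>t. trace_square (g t) (gauduchon_curvature br J \<tau> (g t)))
    (\<lambda>t. trace_square (g t) (gauduchon_curvature br J \<tau> (g t)))"
  unfolding forms_close_def
proof
  fix v :: "nat \<Rightarrow> 'g"
  let ?R = "\<lambda>t. gauduchon_curvature br J \<tau> (g t)"
  let ?a = "\<lambda>v t. - (1 / 8) * (\<Sum>\<sigma> | \<sigma> permutes {..<2 + 2::nat}. of_int (sign \<sigma>) *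
     of_real (\<Sum>k<6. \<phi> k (?R t (v (\<sigma> 2)) (v (\<sigma> 3)) (?R t (v (\<sigma> 0)) (v (\<sigma> 1)) (b k))))) :: complex"
  let ?a' = "\<lambda>v t. - (1 / 8) * (\<Sum>\<sigma> | \<sigma> permutes {..<2 + 2::nat}. of_int (sign \<sigma>) *
     of_real (\<Sum>k<6. \<phi> k (G (?R t (v (\<sigma> 2)) (v (\<sigma> 3)) (?R t (v (\<sigma> 0)) (v (\<sigma> 1)) (F (b k))))))) :: complex"
  have eq: "?a w t = trace_square (g t) (?R t) w" "?a' w t = trace_square (g t) (?R t) w" if "t \<in> S" for t w
  proof -
    interpret M: complex_bracket_metric b \<phi> br J "g t" by (rule complex_bracket_metricI[OF g that])
    have lin: "linear (?R t u v)" for u v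
      unfolding gauduchon_curvature_def using bilinear_gauduchon[OF g that] by (rule M.curvature_linear(1))
    have skew: "g t (?R t u v w) z = - g t w (?R t u v z)" for u v w z
      unfolding gauduchon_curvature_def by (rule M.curvature_skew[OF M.hermitian_connection_gauduchon])
    show "?a w t = trace_square (g t) (?R t) w" by (rule trace_square_eq[of "g t" "?R t", OF M.inner lin skew, symmetric])
    show "?a' w t = trace_square (g t) (?R t) w" by (rule image.trace_square_eq[of "g t" "?R t", OF M.inner lin skew, symmetric])
  qed
  have "close (?a v) (?a' (\<lambda>i. F (v i)))"
  proof (intro close_cmult close_sum)
    fix \<sigma> :: "nat \<Rightarrow> nat"
    have "vclose (\<lambda>t. ?R t (v (\<sigma> 2)) (v (\<sigma> 3)) (?R t (v (\<sigma> 0)) (v (\<sigma> 1)) (b k)))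
      (\<lambda>t. ?R t (F (v (\<sigma> 2))) (F (v (\<sigma> 3))) (?R t (F (v (\<sigma> 0))) (F (v (\<sigma> 1))) (F (b k))))" for k
      by (rule vclose_gauduchon_curvature[OF g vclose_const vclose_const
            vclose_gauduchon_curvature[OF g vclose_const vclose_const vclose_const]])
    then have "k < 6 \<Longrightarrow> close (\<lambda>t. \<phi> k (?R t (v (\<sigma> 2)) (v (\<sigma> 3)) (?R t (v (\<sigma> 0)) (v (\<sigma> 1)) (b k))))
      (\<lambda>t. \<phi> k (G (?R t (F (v (\<sigma> 2))) (F (v (\<sigma> 3))) (?R t (F (v (\<sigma> 0))) (F (v (\<sigma> 1))) (F (b k))))))" for k
      unfolding vclose_def by blast
    then show "close (\<lambda>t. of_real (\<Sum>k<6. \<phi> k (?R t (v (\<sigma> 2)) (v (\<sigma> 3)) (?R t (v (\<sigma> 0)) (v (\<sigma> 1)) (b k)))) :: complex)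
      (\<lambda>t. of_real (\<Sum>k<6. \<phi> k (G (?R t (F (v (\<sigma> 2))) (F (v (\<sigma> 3))) (?R t (F (v (\<sigma> 0))) (F (v (\<sigma> 1))) (F (b k)))))))"
      unfolding close_of_real by (intro close_sum) (simp only: lessThan_iff)
  qed
  then show "close (\<lambda>t. trace_square (g t) (?R t) v) (\<lambda>t. trace_square (g t) (?R t) (\<lambda>i. F (v i)))"
  proof (rule close_cong)
    fix t assume t: "t \<in> S"
    show "?a v t = trace_square (g t) (?R t) v" by (rule eq(1)[OF t])
    show "?a' (\<lambda>i. F (v i)) t = trace_square (g t) (?R t) (\<lambda>i. F (v i))" by (rule eq(2)[OF t])
  qed
qed

text \<open>The components are quotients of top-degree forms, read in \<open>b\<close> on one side
  and in the moved basis on the other, so both volumes have to stay away from zero.\<close>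

lemma vclose_contracted_curvature:
  assumes g: "metrics_close g" and H: "metrics_close H"
    and c: "c > 0" "\<And>t. t \<in> S \<Longrightarrow> c \<le> norm (power3_form (fund_form J (g t)) b)"
      "\<And>t. t \<in> S \<Longrightarrow> c \<le> norm (power3_form (fund_form J (g t)) (\<lambda>i. F (b i)))"
  shows "vclose (\<lambda>t. contracted_curvature (fund_form J (g t)) (gauduchon_curvature br J \<kappa> (H t)) u)
    (\<lambda>t. contracted_curvature (fund_form J (g t)) (gauduchon_curvature br J \<kappa> (H t)) (F u))"
  unfolding vclose_def
proof (intro allI impI)
  fix k :: nat
  assume k: "k < 6"
  let ?\<omega> = "\<lambda>t. fund_form J (g t)"
  let ?R = "\<lambda>t. gauduchon_curvature br J \<kappa> (H t)"
  let ?W = "\<lambda>l u t. wedge 4 2 (power2_form (?\<omega> t)) (\<lambda>v. of_real (l (?R t (v 0) (v 1) u)))"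
  have eq: "?W (\<phi> k) u t b * Fields.inverse (power3_form (?\<omega> t) b) = of_real (\<phi> k (contracted_curvature (?\<omega> t) (?R t) u))"
      "?W (\<lambda>v. \<phi> k (G v)) u t (\<lambda>i. F (b i)) * Fields.inverse (power3_form (?\<omega> t) (\<lambda>i. F (b i)))
        = of_real (\<phi> k (G (contracted_curvature (?\<omega> t) (?R t) u)))"
    if t: "t \<in> S" for t u
  proof -
    interpret M: complex_bracket_metric b \<phi> br J "H t" by (rule complex_bracket_metricI[OF H t])
    interpret N: complex_bracket_metric b \<phi> br J "g t" by (rule complex_bracket_metricI[OF g t])
    have lin: "linear (\<lambda>u. ?R t u v z)" "linear (\<lambda>v. ?R t u v z)" for u v z
      unfolding gauduchon_curvature_def using bilinear_gauduchon[OF H t]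
      by (rule M.curvature_linear(2), rule M.curvature_linear(3))
    have nz: "power3_form (?\<omega> t) b \<noteq> 0" "power3_form (?\<omega> t) (\<lambda>i. F (b i)) \<noteq> 0"
      using c(1) c(2)[OF t] c(3)[OF t] by auto
    have w: "linear (\<lambda>u. g t (J u) v)" "linear (\<lambda>v. g t (J u) v)" for u v
      using linear_compose[OF linear_J N.g_left[of v]] N.g_right[of "J u"] by (simp_all add: o_def)
    show "?W (\<phi> k) u t b * Fields.inverse (power3_form (?\<omega> t) b) = of_real (\<phi> k (contracted_curvature (?\<omega> t) (?R t) u))"
      by (simp only: contracted_curvature_component[of "\<lambda>u v. g t (J u) v", OF w lin fund_form_def nz(1) k] divide_inverse)
    show "?W (\<lambda>v. \<phi> k (G v)) u t (\<lambda>i. F (b i)) * Fields.inverse (power3_form (?\<omega> t) (\<lambda>i. F (b i)))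
        = of_real (\<phi> k (G (contracted_curvature (?\<omega> t) (?R t) u)))"
      by (simp only: image.contracted_curvature_component[of "\<lambda>u v. g t (J u) v", OF w lin fund_form_def nz(2) k] divide_inverse)
  qed
  have fc: "forms_close (\<lambda>t v. of_real (\<phi> k (?R t (v 0) (v 1) u))) (\<lambda>t v. of_real (\<phi> k (G (?R t (v 0) (v 1) (F u)))))"
    unfolding forms_close_def close_of_real
    using vclose_gauduchon_curvature[OF H vclose_const vclose_const vclose_const] k by (simp add: vclose_def)
  have p: "forms_close (\<lambda>t. power2_form (?\<omega> t)) (\<lambda>t. power2_form (?\<omega> t))"
    unfolding power2_form_def by (intro forms_close_wedge forms_close_fund_form g)
  have W: "close (\<lambda>t. ?W (\<phi> k) u t b) (\<lambda>t. ?W (\<lambda>v. \<phi> k (G v)) (F u) t (\<lambda>i. F (b i)))"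
    using forms_close_wedge[OF p fc] by (simp add: forms_close_def)
  have P: "close (\<lambda>t. power3_form (?\<omega> t) b) (\<lambda>t. power3_form (?\<omega> t) (\<lambda>i. F (b i)))"
    using forms_close_wedge[OF p forms_close_fund_form[OF g]] by (simp add: forms_close_def power3_form_def)
  have "close (\<lambda>t. of_real (\<phi> k (contracted_curvature (?\<omega> t) (?R t) u)) :: complex)
      (\<lambda>t. of_real (\<phi> k (G (contracted_curvature (?\<omega> t) (?R t) (F u)))))"
    using close_mult[OF W close_inverse[OF P c]] by (rule close_cong) (simp_all only: eq)
  then show "close (\<lambda>t. \<phi> k (contracted_curvature (?\<omega> t) (?R t) u))
      (\<lambda>t. \<phi> k (G (contracted_curvature (?\<omega> t) (?R t) (F u))))"
    by (simp only: close_of_real)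
qed

end

section \<open>Hermitian matrices of metrics in a coframe\<close>

lemma coframe_10_unique:
  assumes "coframe_10 J \<zeta>" "\<And>u. (\<Sum>j\<in>UNIV. c $ j * \<zeta> j u) = 0"
  shows "c = 0"
proof -
  have "form_10 J (\<lambda>u. 0)" by (auto simp: form_10_def linear_iff)
  then have "\<exists>!c. \<forall>u. 0 = (\<Sum>j\<in>UNIV. c $ j * \<zeta> j u)"
    using assms(1) unfolding coframe_10_def by blast
  moreover have "\<forall>u. 0 = (\<Sum>j\<in>UNIV. c $ j * \<zeta> j u)" "\<forall>u. 0 = (\<Sum>j\<in>UNIV. (0::complex^3) $ j * \<zeta> j u)"
    using assms(2) by simp_all
  ultimately show ?thesis by blast
qed

text \<open>Every real functional \<open>l\<close> is the real part of a (1,0)-form, namely of l - i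
  (l o J). A vector killed by the coframe is therefore killed by all functionals.\<close>

lemma coframe_10_injective:
  assumes J: "linear J" "\<And>u. J (J u) = - u" and co: "coframe_10 J \<zeta>" and z: "\<And>j. \<zeta> j u = 0"
  shows "u = 0"
proof (rule ccontr)
  assume u: "u \<noteq> 0"
  then have "independent {u}" by simp
  from linear_independent_extend[OF this, of "\<lambda>_. 1::real"]
  obtain l :: "'a \<Rightarrow> real" where l: "linear l" "l u = 1" by auto
  define \<alpha> where "\<alpha> = (\<lambda>v. Complex (l v) (- l (J v)))"
  have "form_10 J \<alpha>"
    using J linear_neg[OF l(1)] l(1) by (auto simp: form_10_def \<alpha>_def linear_iff complex_eq_iff)
  then obtain c :: "complex^3" where "\<forall>u. \<alpha> u = (\<Sum>j\<in>UNIV. c $ j * \<zeta> j u)"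
    using co unfolding coframe_10_def by blast
  then have "\<alpha> u = 0" using z by simp
  then show False using l(2) by (simp add: \<alpha>_def complex_eq_iff)
qed

text \<open>If the joint values of the coframe missed something, a vector orthogonal to them would
  give a vanishing real part of a linear combination. Passing from \<open>u\<close> to
  \<open>J u\<close> kills the imaginary part too, which contradicts uniqueness of
  coefficients.\<close>

lemma coframe_10_surjective:
  assumes J: "linear J" "\<And>u. J (J u) = - u" and co: "coframe_10 J \<zeta>"
  shows "\<exists>u. \<forall>j. \<zeta> j u = z $ j"
proof -
  let ?Z = "\<lambda>u. (\<chi> j. \<zeta> j u)"
  have lin: "linear (\<zeta> j)" "\<zeta> j (J u) = \<i> * \<zeta> j u" for j u
    using co by (auto simp: coframe_10_def form_10_def)
  have Z: "linear ?Z"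
    using lin(1) by (auto simp: linear_iff vec_eq_iff)
  have "range ?Z = UNIV"
  proof (rule ccontr)
    assume "range ?Z \<noteq> UNIV"
    moreover have sub: "subspace (range ?Z)" using linear_subspace_image[OF Z subspace_UNIV] .
    ultimately have "dim (range ?Z) \<noteq> DIM(complex^3)"
      using dim_eq_full[of "range ?Z"] span_eq_iff by blast
    then have "dim (range ?Z) < DIM(complex^3)" using dim_subset_UNIV[of "range ?Z"] by linarith
    from orthogonal_to_subspace_exists[OF this] obtain a where a: "a \<noteq> 0" "\<And>y. y \<in> span (range ?Z) \<Longrightarrow> orthogonal a y"
      by blast
    \<comment> \<open>The real inner product of \<open>a\<close> with a vector is the real part of
      its pairing with the conjugate entries of \<open>a\<close>.\<close>
    define c where "c = (\<chi> j. cnj (a $ j))"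
    have Re: "Re (\<Sum>j\<in>UNIV. c $ j * \<zeta> j u) = 0" for u
    proof -
      have "orthogonal a (?Z u)" by (intro a(2) span_base) auto
      then show ?thesis by (simp add: orthogonal_def inner_vec_def c_def inner_complex_def)
    qed
    have "(\<Sum>j\<in>UNIV. c $ j * \<zeta> j u) = 0" for u
    proof -
      have "(\<Sum>j\<in>UNIV. c $ j * \<zeta> j (J u)) = \<i> * (\<Sum>j\<in>UNIV. c $ j * \<zeta> j u)"
        by (simp add: lin(2) sum_distrib_left algebra_simps)
      then show ?thesis using Re[of u] Re[of "J u"] by (simp add: complex_eq_iff)
    qed
    then have "c = 0" by (rule coframe_10_unique[OF co])
    then show False using a(1) by (simp add: c_def vec_eq_iff)
  qed
  then obtain u where "z = ?Z u" by blast
  then show ?thesis by auto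
qed

lemma wedge_form1: "wedge 1 1 (form1 \<alpha>) (form1 \<beta>) v = \<alpha> (v 0) * \<beta> (v 1) - \<alpha> (v 1) * \<beta> (v 0)"
proof -
  have "{..<1 + 1::nat} = {0, 1}" by auto
  then have "{\<sigma>. \<sigma> permutes {..<1 + 1::nat}} = {id, Transposition.transpose 0 1}"
    by (intro set_eqI) (simp only: mem_Collect_eq permutes_doubleton_iff insert_iff empty_iff simp_thms)
  moreover have "id \<noteq> Transposition.transpose 0 (1::nat)"
    by (metis id_apply transpose_apply_first zero_neq_one)
  ultimately show ?thesis
    by (simp add: wedge_def form1_def sign_swap_id sign_id)
qed

lemma zeta11_eq: "zeta11 \<zeta> j l v = \<zeta> j (v 0) * cnj (\<zeta> l (v 1)) - \<zeta> j (v 1) * cnj (\<zeta> l (v 0))"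
  unfolding zeta11_def by (rule wedge_form1)

lemma zeta20_eq: "zeta20 \<zeta> j l v = \<zeta> j (v 0) * \<zeta> l (v 1) - \<zeta> j (v 1) * \<zeta> l (v 0)"
  unfolding zeta20_def by (rule wedge_form1)

lemma ext_deriv_form1: "ext_deriv br 1 (form1 \<alpha>) v = - \<alpha> (br (v 0) (v 1))"
  by (simp add: ext_deriv_def lessThan_Suc bracket_args_def form1_def)

text \<open>What a (1,0)-coframe provides: an identification of
  \<open>(\<zeta> 1, \<zeta> 2, \<zeta> 3)\<close> with coordinates in complex three-space, from
  which the six-element real basis is built.\<close>

locale complex_frame =
  fixes J :: "'g::real_vector \<Rightarrow> 'g" and \<zeta> :: "3 \<Rightarrow> 'g \<Rightarrow> complex" and e :: "3 \<Rightarrow> 'g"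
  assumes J_linear: "linear J" and J_square [simp]: "J (J u) = - u"
    and zeta_linear: "linear (\<zeta> j)" and zeta_J [simp]: "\<zeta> j (J u) = \<i> * \<zeta> j u"
    and zeta_injective: "(\<And>j. \<zeta> j u = 0) \<Longrightarrow> u = 0"
    and zeta_e [simp]: "\<zeta> j (e l) = (if j = l then 1 else 0)"
begin

lemma zeta_eqI: "(\<And>j. \<zeta> j u = \<zeta> j v) \<Longrightarrow> u = v"
  using zeta_injective[of "u - v"] by (simp add: linear_diff[OF zeta_linear])

lemmas zeta_simps = linear_add[OF zeta_linear] linear_scale[OF zeta_linear] linear_diff[OF zeta_linear]
  linear_neg[OF zeta_linear] linear_sum[OF zeta_linear]

definition vec :: "(3 \<Rightarrow> complex) \<Rightarrow> 'g" where
  "vec z = (\<Sum>j\<in>UNIV. Re (z j) *\<^sub>R e j + Im (z j) *\<^sub>R J (e j))"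

lemma zeta_vec [simp]: "\<zeta> j (vec z) = z j"
proof -
  have "\<zeta> j (vec z) = (\<Sum>k\<in>UNIV. if j = k then z k else 0)"
    unfolding vec_def zeta_simps by (rule sum.cong) (auto simp: complex_eq_iff)
  then show ?thesis by simp
qed

lemma vec_zeta: "vec (\<lambda>j. \<zeta> j u) = u"
  by (rule zeta_eqI) simp

text \<open>Only \<open>k < 6\<close> is meaningful in the next two definitions.\<close>

definition basis :: "nat \<Rightarrow> 'g" where
  "basis k = (if even k then e ([1, 2, 3] ! (k div 2)) else J (e ([1, 2, 3] ! (k div 2))))"

definition cobasis :: "nat \<Rightarrow> 'g \<Rightarrow> real" where
  "cobasis k u = (if even k then Re (\<zeta> ([1, 2, 3] ! (k div 2)) u) else Im (\<zeta> ([1, 2, 3] ! (k div 2)) u))"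

lemma lessThan_6: "{..<6::nat} = {0, 1, 2, 3, 4, 5}" by auto

lemma basis_simps: "basis 0 = e 1" "basis 1 = J (e 1)" "basis 2 = e 2" "basis 3 = J (e 2)"
  "basis 4 = e 3" "basis 5 = J (e 3)"
  by (simp_all add: basis_def)

lemma cobasis_simps: "cobasis 0 u = Re (\<zeta> 1 u)" "cobasis 1 u = Im (\<zeta> 1 u)" "cobasis 2 u = Re (\<zeta> 2 u)"
  "cobasis 3 u = Im (\<zeta> 2 u)" "cobasis 4 u = Re (\<zeta> 3 u)" "cobasis 5 u = Im (\<zeta> 3 u)"
  by (simp_all add: cobasis_def)

lemma sum_lessThan_6: "(\<Sum>k<6. f k) = f 0 + f 1 + f 2 + f 3 + f 4 + (f (5::nat) :: 'v::comm_monoid_add)"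
  by (simp add: lessThan_6 add.assoc[symmetric] del: One_nat_def)

sublocale real_basis: dual_basis basis cobasis
proof (rule dual_basis.intro)
  show "linear (cobasis k)" for k
    using zeta_linear[of "[1, 2, 3] ! (k div 2)"] by (auto simp: cobasis_def[abs_def] linear_iff)
  show "(\<Sum>k<6. cobasis k u *\<^sub>R basis k) = u" for u
  proof -
    have "(\<Sum>k<6. cobasis k u *\<^sub>R basis k) = vec (\<lambda>j. \<zeta> j u)"
      unfolding sum_lessThan_6 basis_simps cobasis_simps vec_def sum_3 by (simp only: add.assoc)
    then show ?thesis by (simp only: vec_zeta)
  qed
  show "cobasis i (basis k) = (if i = k then 1 else 0)" if "i < 6" "k < 6" for i k
  proof -
    have "i \<in> {0, 1, 2, 3, 4, 5}" "k \<in> {0, 1, 2, 3, 4, 5}" using that by auto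
    then show ?thesis
      by (elim insertE emptyE; simp only: basis_simps cobasis_simps zeta_J zeta_e; simp)
  qed
qed

lemma sum_cobasis_squares: "(\<Sum>k<6. (cobasis k u)\<^sup>2) = (\<Sum>j\<in>UNIV. (cmod (\<zeta> j u))\<^sup>2)"
  unfolding sum_lessThan_6 cobasis_simps sum_3 cmod_power2 by (simp only: add.assoc)

definition rotate :: "(3 \<Rightarrow> complex) \<Rightarrow> 'g \<Rightarrow> 'g" where
  "rotate w u = vec (\<lambda>j. w j * \<zeta> j u)"

lemma zeta_rotate [simp]: "\<zeta> j (rotate w u) = w j * \<zeta> j u"
  by (simp add: rotate_def)

lemma linear_rotate: "linear (rotate w)"
  unfolding linear_iff by (auto intro!: zeta_eqI simp: zeta_simps algebra_simps)

lemma rotate_J: "rotate w (J u) = J (rotate w u)"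
  by (rule zeta_eqI) simp

lemma rotate_rotate: "(\<And>j. w j * w' j = 1) \<Longrightarrow> rotate w (rotate w' u) = u"
  by (rule zeta_eqI) (simp add: mult.assoc[symmetric])

text \<open>The Hermitian matrix of the metric. The sign of the imaginary part fits the convention
  of \<open>metric_eq\<close>, where the second argument is conjugated.\<close>

definition coeff :: "('g \<Rightarrow> 'g \<Rightarrow> real) \<Rightarrow> 3 \<Rightarrow> 3 \<Rightarrow> complex" where
  "coeff g j l = Complex (g (e j) (e l)) (g (e j) (J (e l)))"

end

locale complex_frame_metric = complex_frame J \<zeta> e
  for J :: "'g::real_vector \<Rightarrow> 'g" and \<zeta> :: "3 \<Rightarrow> 'g \<Rightarrow> complex" and e +
  fixes g :: "'g \<Rightarrow> 'g \<Rightarrow> real"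
  assumes herm: "hermitian_metric J g"
begin

lemma inner_g: "inner_form g" by (rule hermitian_metric_inner_form[OF herm])

lemmas gl = inner_form_linear_left[OF inner_g]
lemmas gr = inner_form_linear_right[OF inner_g]
lemmas g_simps = linear_add[OF gl] linear_scale[OF gl] linear_neg[OF gl] linear_sum[OF gl]
  linear_add[OF gr] linear_scale[OF gr] linear_neg[OF gr] linear_sum[OF gr]

lemma g_JJ: "g (J u) (J v) = g u v" using herm by (auto simp: hermitian_metric_def)

lemma g_J: "g (J u) v = - g u (J v)"
  using g_JJ[of u "J v"] by (simp add: g_simps)

lemma coeff_cnj: "coeff g l j = cnj (coeff g j l)"
  using inner_form_sym[OF inner_g, of "e j" "e l"] inner_form_sym[OF inner_g, of "e l" "J (e j)"]
    g_J[of "e j" "e l"] by (simp add: coeff_def complex_eq_iff)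

lemma metric_eq: "g u v = Re (\<Sum>j\<in>UNIV. \<Sum>l\<in>UNIV. coeff g j l * \<zeta> j u * cnj (\<zeta> l v))"
proof -
  have "g (vec z) (vec w) = (\<Sum>j\<in>UNIV. \<Sum>l\<in>UNIV. Re (coeff g j l * z j * cnj (w l)))" for z w
    unfolding vec_def sum_3 g_simps
    by (simp add: coeff_def g_JJ g_J g_simps algebra_simps)
  from this[of "\<lambda>j. \<zeta> j u" "\<lambda>j. \<zeta> j v"] show ?thesis by (simp add: vec_zeta)
qed

lemma coeff_diag_real: "coeff g j j = of_real (Re (coeff g j j))"
  using coeff_cnj[of j j] by (simp add: complex_eq_iff)

text \<open>Three real and three complex parameters describe a Hermitian 3x3 matrix; in them the
  later claims become polynomial identities.\<close>

lemma coeff_entries: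
  obtains a b c :: real and p q r where "coeff g 1 1 = of_real a" "coeff g 2 2 = of_real b" "coeff g 3 3 = of_real c"
    "coeff g 1 2 = p" "coeff g 1 3 = q" "coeff g 2 3 = r"
    "coeff g 2 1 = cnj p" "coeff g 3 1 = cnj q" "coeff g 3 2 = cnj r"
  by (rule that[OF coeff_diag_real coeff_diag_real coeff_diag_real refl refl refl]) (rule coeff_cnj)+

lemma fund_form_eq: "fund_form J g = (\<lambda>v. \<i> / 2 * (\<Sum>j\<in>UNIV. \<Sum>l\<in>UNIV. coeff g j l * zeta11 \<zeta> j l v))"
proof
  fix v :: "nat \<Rightarrow> 'g"
  obtain a b c p q r where h: "coeff g 1 1 = of_real a" "coeff g 2 2 = of_real b" "coeff g 3 3 = of_real c"
    "coeff g 1 2 = p" "coeff g 1 3 = q" "coeff g 2 3 = r"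
    "coeff g 2 1 = cnj p" "coeff g 3 1 = cnj q" "coeff g 3 2 = cnj r" by (rule coeff_entries)
  show "fund_form J g v = \<i> / 2 * (\<Sum>j\<in>UNIV. \<Sum>l\<in>UNIV. coeff g j l * zeta11 \<zeta> j l v)"
    unfolding fund_form_def metric_eq sum_3 zeta11_eq h zeta_J
    by (rule complex_eqI; simp; simp add: algebra_simps)
qed

text \<open>For an arbitrary complex matrix \<open>h\<close>, the pairs \<open>e j, e l\<close> give
  i times its antisymmetric part and the pairs \<open>e j, J (e l)\<close> its symmetric part;
  together they recover every entry.\<close>

lemma fund_form_coeff_unique:
  assumes "fund_form J g = (\<lambda>v. \<i> / 2 * (\<Sum>j\<in>UNIV. \<Sum>l\<in>UNIV. h $ j $ l * zeta11 \<zeta> j l v))"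
  shows "h $ j $ l = coeff g j l"
proof -
  have eq: "of_real (g (J u) v) = \<i> / 2 * (\<Sum>j\<in>UNIV. \<Sum>l\<in>UNIV. h $ j $ l * (\<zeta> j u * cnj (\<zeta> l v) - \<zeta> j v * cnj (\<zeta> l u)))" for u v
    using fun_cong[OF assms, of "\<lambda>i. if i = 0 then u else v"] by (simp add: fund_form_def zeta11_eq)
  have s1: "(\<Sum>j\<in>UNIV. \<Sum>l\<in>UNIV. h $ j $ l * ((if j = p then a else 0) * (if l = q then b else 0))) = h $ p $ q * a * b" for p q a b
  proof -
    have "(\<Sum>l\<in>UNIV. h $ j $ l * ((if j = p then a else 0) * (if l = q then b else 0))) = (if j = p then h $ j $ q * a * b else 0)" for j
    proof -
      have "(\<Sum>l\<in>UNIV. h $ j $ l * ((if j = p then a else 0) * (if l = q then b else 0)))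
        = (\<Sum>l\<in>UNIV. if l = q then h $ j $ l * ((if j = p then a else 0) * b) else 0)"
        by (rule sum.cong) auto
      then show ?thesis by simp
    qed
    then show ?thesis by simp
  qed
  have s: "(\<Sum>j\<in>UNIV. \<Sum>l\<in>UNIV. h $ j $ l * ((if j = p then a else 0) * (if l = q then b else 0)
      - (if j = q then c else 0) * (if l = p then d else 0))) = h $ p $ q * a * b - h $ q $ p * c * d" for p q a b c d
    unfolding right_diff_distrib sum_subtractf by (simp only: s1)
  have 1: "of_real (g (J (e j)) (e l)) = \<i> / 2 * (h $ j $ l - h $ l $ j)"
    using eq[of "e j" "e l"] s[of j 1 l 1 1 1] by (simp add: if_distrib[of cnj] cong: if_cong)
  have 2: "of_real (g (J (e j)) (J (e l))) = \<i> / 2 * (h $ j $ l * - \<i> - h $ l $ j * \<i>)"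
    using eq[of "e j" "J (e l)"] s[of j 1 l "- \<i>" \<i> 1] by (simp add: if_distrib[of cnj] if_distrib[of "(*) _"] cong: if_cong)
  have "coeff g j l = of_real (g (J (e j)) (J (e l))) - \<i> * of_real (g (J (e j)) (e l))"
    by (simp add: coeff_def g_J g_simps complex_eq_iff)
  then show ?thesis unfolding 1 2 by (simp add: algebra_simps)
qed

lemma form_coeffs_eq: "form_coeffs \<zeta> (fund_form J g) = (\<chi> j l. coeff g j l)"
  unfolding form_coeffs_def
proof (rule the_equality)
  show "fund_form J g = (\<lambda>v. \<i> / 2 * (\<Sum>j\<in>UNIV. \<Sum>l\<in>UNIV. (\<chi> j l. coeff g j l) $ j $ l * zeta11 \<zeta> j l v))"
    by (simp add: fund_form_eq)
next
  fix h
  assume "fund_form J g = (\<lambda>v. \<i> / 2 * (\<Sum>j\<in>UNIV. \<Sum>l\<in>UNIV. h $ j $ l * zeta11 \<zeta> j l v))"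
  from fund_form_coeff_unique[OF this] show "h = (\<chi> j l. coeff g j l)" by (simp add: vec_eq_iff)
qed

definition coeff_det :: real where
  "coeff_det = Re (det (\<chi> j l. coeff g j l))"

lemma coeff_diag_pos: "0 < Re (coeff g j j)"
proof -
  have "\<zeta> j (e j) \<noteq> \<zeta> j 0" by (simp add: linear_0[OF zeta_linear])
  then have "e j \<noteq> 0" by metis
  then show ?thesis using inner_form_pos[OF inner_g] by (simp add: coeff_def)
qed

text \<open>Positivity is obtained by testing the Hermitian form on vectors of cofactors: the first
  gives the leading entry times the leading 2x2 minor, the second gives the determinant times that
  minor.\<close>

lemma coeff_det_eq: "of_real coeff_det = det (\<chi> j l. coeff g j l)"
  and coeff_det_pos: "0 < coeff_det"
proof -
  obtain a b c p q r where h: "coeff g 1 1 = of_real a" "coeff g 2 2 = of_real b" "coeff g 3 3 = of_real c"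
    "coeff g 1 2 = p" "coeff g 1 3 = q" "coeff g 2 3 = r"
    "coeff g 2 1 = cnj p" "coeff g 3 1 = cnj q" "coeff g 3 2 = cnj r" by (rule coeff_entries)
  define D where "D = a * b * c - a * ((Re r)\<^sup>2 + (Im r)\<^sup>2) - b * ((Re q)\<^sup>2 + (Im q)\<^sup>2) - c * ((Re p)\<^sup>2 + (Im p)\<^sup>2)
     + 2 * Re (p * r * cnj q)"
  have det: "det (\<chi> j l. coeff g j l) = of_real D"
    unfolding det_3 vec_lambda_beta h D_def
    by (rule complex_eqI; simp; simp add: power2_eq_square algebra_simps)
  then have D: "coeff_det = D" by (simp add: coeff_det_def)
  then show "of_real coeff_det = det (\<chi> j l. coeff g j l)" by (simp add: det)
  have pos: "0 < Re (\<Sum>j\<in>UNIV. \<Sum>l\<in>UNIV. coeff g j l * z j * cnj (z l))" if "z k \<noteq> 0" for z k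
  proof -
    have "\<zeta> k (vec z) \<noteq> \<zeta> k 0" using that by (simp add: linear_0[OF zeta_linear])
    then have "vec z \<noteq> 0" by metis
    then have "0 < g (vec z) (vec z)" by (rule inner_form_pos[OF inner_g])
    then show ?thesis by (simp only: metric_eq zeta_vec)
  qed
  have a: "0 < a" using coeff_diag_pos[of 1] by (simp add: h)
  define m where "m = a * b - (Re p)\<^sup>2 - (Im p)\<^sup>2"
  let ?z = "\<lambda>j::3. if j = 1 then - cnj p else if j = 2 then of_real a else 0"
  have "Re (\<Sum>j\<in>UNIV. \<Sum>l\<in>UNIV. coeff g j l * ?z j * cnj (?z l)) = a * m"
    unfolding sum_3 h m_def by (simp; simp add: power2_eq_square algebra_simps)
  then have "0 < a * m" using pos[of ?z 2] a by simp
  then have m: "0 < m" using a by (simp add: zero_less_mult_iff)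
  text \<open>Evaluate the Hermitian form on the third column of cofactors.\<close>
  let ?w = "\<lambda>j::3. if j = 1 then cnj p * cnj r - of_real b * cnj q
      else if j = 2 then p * cnj q - of_real a * cnj r else of_real m"
  have "Re (\<Sum>j\<in>UNIV. \<Sum>l\<in>UNIV. coeff g j l * ?w j * cnj (?w l)) = D * m"
    unfolding sum_3 h D_def m_def by (simp; simp add: power2_eq_square algebra_simps)
  then have "0 < D * m" using pos[of ?w 3] m by simp
  then show "0 < coeff_det" using m by (simp add: zero_less_mult_iff D)
qed

lemma norm_Psi_square: "(norm_Psi \<zeta> (fund_form J g))\<^sup>2 * coeff_det = 8"
  using coeff_det_pos by (simp add: norm_Psi_def form_coeffs_eq coeff_det_def)

lemma fund_form_skew: "g (J u) v = - g (J v) u"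
  using g_J[of u v] inner_form_sym[OF inner_g, of u "J v"] by linarith

lemma fund_form_frame:
  "g (J (e j)) (e l) = - Im (coeff g j l)" "g (J (e j)) (J (e l)) = Re (coeff g j l)"
  "g (J (J (e j))) (e l) = - Re (coeff g j l)" "g (J (J (e j))) (J (e l)) = - Im (coeff g j l)"
  by (simp_all add: coeff_def g_JJ g_J g_simps)

text \<open>The Pfaffian of the real skew matrix of a Hermitian form is the Hermitian determinant;
  listing each \<open>J (e j)\<close> right after \<open>e j\<close> makes the sign positive. The
  denominator of the contraction is thus controlled by \<open>coeff_det\<close>.\<close>

lemma power3_form_basis: "power3_form (fund_form J g) basis = of_real (6 * coeff_det)"
proof -
  obtain a b c p q r where h: "coeff g 1 1 = of_real a" "coeff g 2 2 = of_real b" "coeff g 3 3 = of_real c"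
    "coeff g 1 2 = p" "coeff g 1 3 = q" "coeff g 2 3 = r"
    "coeff g 2 1 = cnj p" "coeff g 3 1 = cnj q" "coeff g 3 2 = cnj r" by (rule coeff_entries)
  have det: "coeff_det = Re (coeff g 1 1 * coeff g 2 2 * coeff g 3 3 + coeff g 1 2 * coeff g 2 3 * coeff g 3 1
     + coeff g 1 3 * coeff g 2 1 * coeff g 3 2 - coeff g 1 1 * coeff g 2 3 * coeff g 3 2
     - coeff g 1 2 * coeff g 2 1 * coeff g 3 3 - coeff g 1 3 * coeff g 2 2 * coeff g 3 1)"
    unfolding coeff_det_def det_3 by simp
  show ?thesis
    unfolding fund_form_def power3_form_eq[of "\<lambda>u v. g (J u) v", OF fund_form_skew] pfaffian_def basis_simps
      fund_form_frame det h
    by (simp add: algebra_simps)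
qed

text \<open>The minor with rows \<open>i, j\<close> and columns \<open>i, k\<close>. Two pairs of
  indices from a set of three always share an index, so up to sign every 2x2 minor has this
  shape.\<close>

definition coeff_minor :: "3 \<Rightarrow> 3 \<Rightarrow> 3 \<Rightarrow> complex" where
  "coeff_minor i j k = coeff g i i * coeff g j k - coeff g i k * coeff g j i"

text \<open>The minors of the coefficient matrix are the coefficients of the square of the fundamental form;
  the matrix is recovered from them by taking minors again.\<close>

lemma coeff_minor_eq:
  "2 * coeff_minor i j k = power2_form (fund_form J g) ((!) [e i, J (e i), e j, J (e k)])
     - \<i> * power2_form (fund_form J g) ((!) [e i, J (e i), e j, e k])"
proof -
  have nth: "[x0, x1, x2, x3] ! 0 = x0" "[x0, x1, x2, x3] ! 1 = x1" "[x0, x1, x2, x3] ! 2 = x2"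
    "[x0, x1, x2, x3] ! 3 = x3" for x0 x1 x2 x3 :: 'g by simp_all
  show ?thesis
    unfolding fund_form_def power2_form_eq[of "\<lambda>u v. g (J u) v", OF fund_form_skew] nth fund_form_frame coeff_minor_def
      coeff_cnj[of j i]
    using coeff_cnj[of i i] by (simp add: complex_eq_iff algebra_simps)
qed

text \<open>The adjugate of the adjugate of a 3x3 matrix is the determinant times the matrix; the
  signs of the cofactors are absorbed in the order of the indices.\<close>

lemma coeff_from_minors:
  assumes "i \<noteq> j" "i \<noteq> k" "j \<noteq> k"
  shows "of_real coeff_det * coeff g i i = coeff_minor i j j * coeff_minor i k k - coeff_minor i j k * coeff_minor i k j"
    and "of_real coeff_det * coeff g i j = coeff_minor k i j * coeff_minor i j j + coeff_minor i k j * coeff_minor j i k"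
proof -
  have "(i = 1 \<and> j = 2 \<and> k = 3) \<or> (i = 1 \<and> j = 3 \<and> k = 2) \<or> (i = 2 \<and> j = 1 \<and> k = 3) \<or>
    (i = 2 \<and> j = 3 \<and> k = 1) \<or> (i = 3 \<and> j = 1 \<and> k = 2) \<or> (i = 3 \<and> j = 2 \<and> k = 1)"
    using assms exhaust_3[of i] exhaust_3[of j] exhaust_3[of k] by auto
  then show "of_real coeff_det * coeff g i i = coeff_minor i j j * coeff_minor i k k - coeff_minor i j k * coeff_minor i k j"
    "of_real coeff_det * coeff g i j = coeff_minor k i j * coeff_minor i j j + coeff_minor i k j * coeff_minor j i k"
    unfolding coeff_det_eq det_3 coeff_minor_def
    by (elim disjE; clarify; simp; simp add: algebra_simps)+
qed

end

section \<open>Gronwall estimates and the rotation\<close>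

text \<open>The claim concerns times on both sides of zero, hence two integrating factors:
  \<open>exp (- M * s)\<close> for later times and \<open>exp (M * s)\<close> for earlier
  ones.\<close>

lemma gronwall_zero:
  fixes E :: "real \<Rightarrow> real"
  assumes E: "\<And>t. t \<in> {a..b} \<Longrightarrow> (E has_real_derivative E' t) (at t within {a..b})"
    and bound: "\<And>t. t \<in> {a..b} \<Longrightarrow> \<bar>E' t\<bar> \<le> M * E t"
    and pos: "\<And>t. 0 \<le> E t" and zero: "E 0 = 0" and 0: "0 \<in> {a..b}" and t: "t \<in> {a..b}"
  shows "E t = 0"
proof (cases "0 \<le> t")
  case True
  define f where "f = (\<lambda>s. exp (- M * s) * E s)"
  define f' where "f' = (\<lambda>s. exp (- M * s) * (E' s - M * E s))"
  have "(f has_real_derivative f' s) (at s within {0..t})" if "s \<in> {0..t}" for s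
  proof -
    have "(E has_real_derivative E' s) (at s within {0..t})"
      using E[of s] by (rule DERIV_subset) (use that 0 t in auto)
    then show ?thesis unfolding f_def f'_def
      by (auto intro!: derivative_eq_intros simp: algebra_simps)
  qed
  then have "(f has_derivative (\<lambda>h. h * f' s)) (at s within {0..t})" if "0 \<le> s" "s \<le> t" for s
    using that by (simp add: has_field_derivative_def mult.commute[of _ "f' _"])
  from mvt_very_simple[OF True this] obtain s where s: "s \<in> {0..t}" "f t - f 0 = t * f' s" by auto
  have "E' s \<le> M * E s" using bound[of s] s(1) 0 t by (auto simp: abs_le_iff)
  then have "f' s \<le> 0" by (simp add: f'_def mult_nonneg_nonpos)
  then have "f t \<le> 0" using s zero True by (simp add: f_def mult_nonneg_nonpos)
  then show ?thesis using pos[of t] by (simp add: f_def mult_le_0_iff)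
next
  case False
  define f where "f = (\<lambda>s. exp (M * s) * E s)"
  define f' where "f' = (\<lambda>s. exp (M * s) * (E' s + M * E s))"
  have "(f has_real_derivative f' s) (at s within {t..0})" if "s \<in> {t..0}" for s
  proof -
    have "(E has_real_derivative E' s) (at s within {t..0})"
      using E[of s] by (rule DERIV_subset) (use that 0 t in auto)
    then show ?thesis unfolding f_def f'_def
      by (auto intro!: derivative_eq_intros simp: algebra_simps)
  qed
  then have "(f has_derivative (\<lambda>h. h * f' s)) (at s within {t..0})" if "t \<le> s" "s \<le> 0" for s
    using that by (simp add: has_field_derivative_def mult.commute[of _ "f' _"])
  moreover have "t \<le> 0" using False by simp
  ultimately obtain s where s: "s \<in> {t..0}" "f 0 - f t = - t * f' s"
    using mvt_very_simple[of t 0 f "\<lambda>s h. h * f' s"] by auto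
  have "- E' s \<le> M * E s" using bound[of s] s(1) 0 t by (auto simp: abs_le_iff)
  then have "0 \<le> f' s" by (simp add: f'_def)
  then have "0 \<le> - t * f' s" using False by (intro mult_nonneg_nonneg) auto
  then have "f t \<le> 0" using s zero by (simp add: f_def)
  then show ?thesis using pos[of t] by (simp add: f_def mult_le_0_iff)
qed

text \<open>A sum of norms need not be differentiable where a component vanishes, so the energy is
  the sum of squares; comparing the square of the sum with it costs the factor
  \<open>card K\<close>.\<close>

lemma gronwall_family_zero:
  fixes K :: "(real \<Rightarrow> complex) set"
  assumes fin: "finite K"
    and deriv: "\<And>f t. f \<in> K \<Longrightarrow> t \<in> {a..b} \<Longrightarrow> (f has_vector_derivative f' f t) (at t within {a..b})"
    and bound: "\<And>f t. f \<in> K \<Longrightarrow> t \<in> {a..b} \<Longrightarrow> norm (f' f t) \<le> C * (\<Sum>f\<in>K. norm (f t))"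
    and C: "0 \<le> C" and zero: "\<And>f. f \<in> K \<Longrightarrow> f 0 = 0" and 0: "0 \<in> {a..b}"
    and f: "f \<in> K" and t: "t \<in> {a..b}"
  shows "f t = 0"
proof -
  define E where "E = (\<lambda>t. \<Sum>f\<in>K. f t \<bullet> f t)"
  define E' where "E' = (\<lambda>t. \<Sum>f\<in>K. f t \<bullet> f' f t + f' f t \<bullet> f t)"
  have "E t = 0"
  proof (rule gronwall_zero[where E = E and E' = E' and M = "2 * C * real (card K)", OF _ _ _ _ 0 t])
    fix t assume t: "t \<in> {a..b}"
    have "((\<lambda>t. f t \<bullet> f t) has_real_derivative (f t \<bullet> f' f t + f' f t \<bullet> f t)) (at t within {a..b})" if "f \<in> K" for f
      using has_derivative_inner[OF deriv[OF that t, unfolded has_vector_derivative_def] deriv[OF that t, unfolded has_vector_derivative_def]]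
      by (simp add: has_field_derivative_def algebra_simps fun_eq_iff)
        (erule has_derivative_eq_rhs, simp add: fun_eq_iff algebra_simps)
    then show "(E has_real_derivative E' t) (at t within {a..b})"
      unfolding E_def E'_def by (intro DERIV_sum) auto
    have "\<bar>E' t\<bar> \<le> (\<Sum>f\<in>K. \<bar>f t \<bullet> f' f t + f' f t \<bullet> f t\<bar>)" unfolding E'_def by (rule sum_abs)
    also have "\<dots> \<le> (\<Sum>f\<in>K. 2 * (norm (f t) * (C * (\<Sum>f\<in>K. norm (f t)))))"
    proof (rule sum_mono)
      fix f assume f: "f \<in> K"
      have "\<bar>f t \<bullet> f' f t + f' f t \<bullet> f t\<bar> = 2 * \<bar>f t \<bullet> f' f t\<bar>" by (simp add: inner_commute)
      also have "\<dots> \<le> 2 * (norm (f t) * norm (f' f t))" using Cauchy_Schwarz_ineq2[of "f t" "f' f t"] by simp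
      also have "\<dots> \<le> 2 * (norm (f t) * (C * (\<Sum>f\<in>K. norm (f t))))"
        using bound[OF f t] by (intro mult_left_mono) auto
      finally show "\<bar>f t \<bullet> f' f t + f' f t \<bullet> f t\<bar> \<le> 2 * (norm (f t) * (C * (\<Sum>f\<in>K. norm (f t))))" .
    qed
    also have "\<dots> = 2 * C * (\<Sum>f\<in>K. norm (f t))\<^sup>2"
      by (simp add: sum_distrib_left[symmetric] sum_distrib_right[symmetric] power2_eq_square)
    also have "\<dots> \<le> 2 * C * (E t * real (card K))"
      using sum_squared_le_sum_of_squares[of "\<lambda>f. norm (f t)" K] C
      by (intro mult_left_mono) (auto simp: E_def power2_norm_eq_inner)
    finally show "\<bar>E' t\<bar> \<le> 2 * C * real (card K) * E t" by (simp add: mult_ac)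
  qed (auto simp: E_def zero sum_nonneg)
  then have "f t \<bullet> f t = 0" using f fin by (simp add: E_def sum_nonneg_eq_0_iff)
  then show ?thesis by simp
qed

context complex_frame
begin

text \<open>The constant is the minimum of the Hermitian form over the compact product of
  \<open>S\<close> with the unit sphere; homogeneity extends the estimate to all vectors.\<close>

lemma uniformly_positive:
  assumes S: "compact S" and g: "\<And>t. t \<in> S \<Longrightarrow> hermitian_metric J (g t)"
    and cont: "\<And>u v. continuous_on S (\<lambda>t::real. g t u v)"
  shows "\<exists>c>0. \<forall>t\<in>S. \<forall>u. c * (\<Sum>j\<in>UNIV. (cmod (\<zeta> j u))\<^sup>2) \<le> g t u u"
proof (cases "S = {}")
  case False
  \<comment> \<open>The Lie algebra carries no topology, so compactness is used for the coordinate
    vectors instead.\<close>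
  define f where "f = (\<lambda>(t, z::complex^3). Re (\<Sum>j\<in>UNIV. \<Sum>l\<in>UNIV. coeff (g t) j l * z $ j * cnj (z $ l)))"
  have gf: "g t u u = f (t, \<chi> j. \<zeta> j u)" if "t \<in> S" for t u
  proof -
    interpret complex_frame_metric J \<zeta> e "g t"
      using complex_frame_axioms g[OF that] by (simp add: complex_frame_metric_def complex_frame_metric_axioms_def)
    show ?thesis by (simp add: f_def metric_eq)
  qed
  have coeff: "coeff (g t) j l = of_real (g t (e j) (e l)) + \<i> * of_real (g t (e j) (J (e l)))" for t j l
    by (simp add: coeff_def complex_eq_iff)
  have comp: "compact (S \<times> sphere (0::complex^3) 1)" using S by (intro compact_Times) auto
  have contg: "continuous_on (S \<times> sphere (0::complex^3) 1) (\<lambda>p. g (fst p) u v)" for u v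
    by (rule continuous_on_compose2[OF cont]) (auto intro: continuous_intros)
  have contf: "continuous_on (S \<times> sphere (0::complex^3) 1) f"
    unfolding f_def case_prod_unfold coeff by (intro continuous_intros contg)
  have ne: "S \<times> sphere (0::complex^3) 1 \<noteq> {}"
    using False by (auto intro: exI[of _ "axis 1 1"])
  obtain p where p: "p \<in> S \<times> sphere (0::complex^3) 1" "\<And>q. q \<in> S \<times> sphere (0::complex^3) 1 \<Longrightarrow> f p \<le> f q"
    using continuous_attains_inf[OF comp ne contf] by blast
  obtain t z where tz: "p = (t, z)" "t \<in> S" "norm z = 1" using p(1) by (cases p) auto
  have "f p > 0"
  proof -
    have z: "z = (\<chi> j. \<zeta> j (vec (($) z)))" by (simp add: vec_eq_iff)
    have "vec (($) z) \<noteq> 0"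
    proof
      assume "vec (($) z) = 0"
      then have "z = 0" by (subst z) (simp add: linear_0[OF zeta_linear] vec_eq_iff)
      then show False using tz(3) by simp
    qed
    then have "0 < g t (vec (($) z)) (vec (($) z))"
      using inner_form_pos hermitian_metric_inner_form g[OF tz(2)] by blast
    then show ?thesis using gf[OF tz(2), of "vec (($) z)"] z tz(1) by simp
  qed
  moreover have "f p * (\<Sum>j\<in>UNIV. (cmod (\<zeta> j u))\<^sup>2) \<le> g s u u" if s: "s \<in> S" for s u
  proof (cases "u = 0")
    case True
    then show ?thesis using linear_0[OF inner_form_linear_left[OF hermitian_metric_inner_form[OF g[OF s]]]]
      by (simp add: linear_0[OF zeta_linear])
  next
    case False
    let ?z = "\<chi> j. \<zeta> j u"
    have z0: "?z \<noteq> 0" using zeta_injective[of u] False by (auto simp: vec_eq_iff)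
    define N where "N = norm ?z"
    have N: "N > 0" using z0 by (simp add: N_def)
    have N2: "(\<Sum>j\<in>UNIV. (cmod (\<zeta> j u))\<^sup>2) = N\<^sup>2"
      unfolding N_def norm_vec_def L2_set_def by (simp add: sum_nonneg)
    have "f p \<le> f (s, ?z /\<^sub>R N)" using s N by (intro p(2)) (auto simp: N_def)
    also have "f (s, ?z /\<^sub>R N) = g s (u /\<^sub>R N) (u /\<^sub>R N)"
      using gf[OF s, of "u /\<^sub>R N"] by (simp add: zeta_simps vec_eq_iff scaleR_vec_def)
    also have "\<dots> = g s u u / N\<^sup>2"
      using hermitian_metric_inner_form[OF g[OF s]]
      by (simp add: linear_scale[OF inner_form_linear_left] linear_scale[OF inner_form_linear_right]
          power2_eq_square divide_inverse)
    finally show ?thesis using N unfolding N2 by (simp add: field_simps)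
  qed
  ultimately show ?thesis by blast
qed (auto intro: exI[of _ 1])

text \<open>Invariance of \<zeta>^1 wedge its conjugate asks for third phase 1, and invariance of
  \<zeta>^1 wedge \<zeta>^2 for first phases w and 1/w. The three are pairwise distinct when w^2
  differs from 1; w = i is a simple choice.\<close>

definition phase :: "3 \<Rightarrow> complex" where
  "phase j = (if j = 1 then \<i> else if j = 2 then - \<i> else 1)"

definition rot :: "'g \<Rightarrow> 'g" where "rot = rotate phase"

definition rot_inv :: "'g \<Rightarrow> 'g" where "rot_inv = rotate (\<lambda>j. cnj (phase j))"

lemma rot_rot_inv: "rot (rot_inv u) = u" "rot_inv (rot u) = u"
  unfolding rot_def rot_inv_def by (rule rotate_rotate; simp add: phase_def)+

lemma rot_e: "rot (e 1) = J (e 1)" "rot (e 2) = - J (e 2)" "rot (e 3) = e 3"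
  by (rule zeta_eqI; simp add: rot_def phase_def zeta_simps)+

lemma rot_J: "rot (J u) = J (rot u)"
  unfolding rot_def by (rule rotate_J)

lemma linear_rot: "linear rot"
  unfolding rot_def by (rule linear_rotate)

lemma cmod_zeta_rot: "cmod (\<zeta> j (rot u)) = cmod (\<zeta> j u)"
  by (simp add: rot_def norm_mult phase_def)

text \<open>This is \<open>coeff_minor_eq\<close> solved for the minor and read for any four-form: a
  multiple of the squared fundamental form yields the same multiple of the minor.\<close>

definition minor_of :: "'g form \<Rightarrow> 3 \<Rightarrow> 3 \<Rightarrow> 3 \<Rightarrow> complex" where
  "minor_of Q i j k = (1 / 2) * (Q ((!) [e i, J (e i), e j, J (e k)]) - \<i> * Q ((!) [e i, J (e i), e j, e k]))"

end

context complex_frame_metric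
begin

text \<open>Minors of minors are quadratic in the conformal factor, and
  \<open>n\<^sup>2 * coeff_det\<close> is 8, so factor and determinant disappear together. Keeping
  \<open>n\<close> free allows the factor of one metric to be used for its rotated copy.\<close>

lemma coeff_from_power2:
  assumes n: "n\<^sup>2 * coeff_det = 8" and ne: "i \<noteq> j" "i \<noteq> k" "j \<noteq> k"
    and Q: "\<And>v. Q v = of_real n * power2_form (fund_form J g) v"
  shows "coeff g i i = (1 / 8) * (minor_of Q i j j * minor_of Q i k k - minor_of Q i j k * minor_of Q i k j)"
    and "coeff g i j = (1 / 8) * (minor_of Q k i j * minor_of Q i j j + minor_of Q i k j * minor_of Q j i k)"
proof -
  have m: "minor_of Q i j k = of_real n * coeff_minor i j k" for i j k
  proof -
    have "minor_of Q i j k = (1 / 2) * (of_real n * (2 * coeff_minor i j k))"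
      unfolding coeff_minor_eq minor_of_def Q by (simp only: right_diff_distrib mult_ac)
    then show ?thesis by simp
  qed
  have n8: "of_real n * (of_real n * (of_real coeff_det * z)) = 8 * z" for z :: complex
  proof -
    have "of_real (n\<^sup>2 * coeff_det) * z = 8 * z" by (simp add: n)
    then show ?thesis by (simp add: power2_eq_square mult.assoc)
  qed
  show "coeff g i i = (1 / 8) * (minor_of Q i j j * minor_of Q i k k - minor_of Q i j k * minor_of Q i k j)"
    using n8[of "coeff g i i"] unfolding coeff_from_minors(1)[OF ne] m by (simp add: algebra_simps)
  show "coeff g i j = (1 / 8) * (minor_of Q k i j * minor_of Q i j j + minor_of Q i k j * minor_of Q j i k)"
    using n8[of "coeff g i j"] unfolding coeff_from_minors(2)[OF ne] m by (simp add: algebra_simps)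
qed

lemma hermitian_metric_rot: "hermitian_metric J (\<lambda>u v. g (rot u) (rot v))"
proof -
  have "linear (\<lambda>u. g (rot u) (rot v))" "linear (\<lambda>v. g (rot u) (rot v))" for u v
    using linear_compose[OF linear_rot gl[of "rot v"]] linear_compose[OF linear_rot gr[of "rot u"]]
    by (simp_all add: o_def)
  moreover have "rot u \<noteq> 0" if "u \<noteq> 0" for u
    using rot_rot_inv(2)[of u] linear_0[OF linear_rotate] that unfolding rot_inv_def by metis
  ultimately show ?thesis
    using inner_form_pos[OF inner_g] inner_form_sym[OF inner_g]
    by (auto simp: hermitian_metric_def bilinear_def rot_J g_JJ)
qed

lemma coeff_rot:
  "coeff (\<lambda>u v. g (rot u) (rot v)) j l = phase j * cnj (phase l) * coeff g j l"
proof -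
  have "(j = 1 \<or> j = 2 \<or> j = 3) \<and> (l = 1 \<or> l = 2 \<or> l = 3)" using exhaust_3 by blast
  then show ?thesis
    by (elim conjE disjE; simp add: coeff_def rot_J rot_e phase_def g_JJ g_J g_simps linear_neg[OF J_linear] complex_eq_iff)
qed

lemma coeff_det_rot:
  "complex_frame_metric.coeff_det J e (\<lambda>u v. g (rot u) (rot v)) = coeff_det"
proof -
  interpret R: complex_frame_metric J \<zeta> e "\<lambda>u v. g (rot u) (rot v)"
    by unfold_locales (rule hermitian_metric_rot)
  show ?thesis
    unfolding R.coeff_det_def coeff_det_def det_3
    by (rule arg_cong[of _ _ Re]) (simp add: coeff_rot phase_def algebra_simps)
qed

lemma diagonal_metric_iff:
  "diagonal_metric J \<zeta> g \<longleftrightarrow> (\<forall>j l. j \<noteq> l \<longrightarrow> coeff g j l = 0)"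
proof
  assume "diagonal_metric J \<zeta> g"
  then obtain r s k :: real where rsk: "fund_form J g = (\<lambda>v. \<i> / 2 * (of_real (r\<^sup>2) * zeta11 \<zeta> 1 1 v
      + of_real (s\<^sup>2) * zeta11 \<zeta> 2 2 v + of_real (k\<^sup>2) * zeta11 \<zeta> 3 3 v))"
    unfolding diagonal_metric_def by blast
  define h :: "complex^3^3" where "h = (\<chi> j l. if j = l then (if j = 1 then of_real (r\<^sup>2)
      else if j = 2 then of_real (s\<^sup>2) else of_real (k\<^sup>2)) else 0)"
  have "fund_form J g = (\<lambda>v. \<i> / 2 * (\<Sum>j\<in>UNIV. \<Sum>l\<in>UNIV. h $ j $ l * zeta11 \<zeta> j l v))"
    unfolding rsk sum_3 by (simp add: h_def)
  then have "coeff g j l = h $ j $ l" for j l by (rule fund_form_coeff_unique[symmetric])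
  then show "\<forall>j l. j \<noteq> l \<longrightarrow> coeff g j l = 0" by (simp add: h_def)
next
  assume 0: "\<forall>j l. j \<noteq> l \<longrightarrow> coeff g j l = 0"
  have c: "coeff g j j = of_real ((sqrt (Re (coeff g j j)))\<^sup>2)" for j
    using coeff_diag_pos[of j] coeff_diag_real[of j] by simp
  have z: "coeff g 1 2 = 0" "coeff g 1 3 = 0" "coeff g 2 1 = 0" "coeff g 2 3 = 0" "coeff g 3 1 = 0" "coeff g 3 2 = 0"
    using 0 by simp_all
  have "fund_form J g = (\<lambda>v. \<i> / 2 * (coeff g 1 1 * zeta11 \<zeta> 1 1 v + coeff g 2 2 * zeta11 \<zeta> 2 2 v
       + coeff g 3 3 * zeta11 \<zeta> 3 3 v))"
    unfolding fund_form_eq sum_3 z by simp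
  then have "fund_form J g = (\<lambda>v. \<i> / 2 * (of_real ((sqrt (Re (coeff g 1 1)))\<^sup>2) * zeta11 \<zeta> 1 1 v
      + of_real ((sqrt (Re (coeff g 2 2)))\<^sup>2) * zeta11 \<zeta> 2 2 v + of_real ((sqrt (Re (coeff g 3 3)))\<^sup>2) * zeta11 \<zeta> 3 3 v))"
    unfolding c[symmetric] .
  moreover have "sqrt (Re (coeff g j j)) \<noteq> 0" for j using coeff_diag_pos[of j] by simp
  ultimately show "diagonal_metric J \<zeta> g" unfolding diagonal_metric_def by blast
qed

text \<open>Rotation multiplies the coefficient at \<open>j, l\<close> by a quotient of two phases,
  which is 1 only on the diagonal because the phases are distinct.\<close>

lemma diagonal_metric_iff_invariant:
  "diagonal_metric J \<zeta> g \<longleftrightarrow> (\<forall>u v. g (rot u) (rot v) = g u v)"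
proof -
  interpret R: complex_frame_metric J \<zeta> e "\<lambda>u v. g (rot u) (rot v)"
    by unfold_locales (rule hermitian_metric_rot)
  have "phase j * cnj (phase l) = 1 \<longleftrightarrow> j = l" for j l
    using exhaust_3[of j] exhaust_3[of l] by (auto simp: phase_def complex_eq_iff)
  then have "phase j * cnj (phase l) * coeff g j l = coeff g j l \<longleftrightarrow> j = l \<or> coeff g j l = 0" for j l
    by (metis mult_cancel_right1 mult.commute mult_cancel_right2)
  then have "diagonal_metric J \<zeta> g \<longleftrightarrow> (\<forall>j l. coeff (\<lambda>u v. g (rot u) (rot v)) j l = coeff g j l)"
    unfolding diagonal_metric_iff coeff_rot by metis
  also have "\<dots> \<longleftrightarrow> (\<forall>u v. g (rot u) (rot v) = g u v)"
  proof
    assume "\<forall>j l. coeff (\<lambda>u v. g (rot u) (rot v)) j l = coeff g j l"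
    then show "\<forall>u v. g (rot u) (rot v) = g u v" using R.metric_eq metric_eq by simp
  qed (simp add: coeff_def)
  finally show ?thesis .
qed

end

section \<open>The flow\<close>

text \<open>Permits passing to compact time intervals, where the uniform constants exist.\<close>

lemma anomaly_flow_subset:
  assumes "anomaly_flow br J \<zeta> \<alpha>' \<tau> \<kappa> \<epsilon> I g H" "S \<subseteq> I"
  shows "anomaly_flow br J \<zeta> \<alpha>' \<tau> \<kappa> \<epsilon> S g H"
  unfolding anomaly_flow_def Let_def
proof (intro conjI ballI allI)
  note flow = assms(1)[unfolded anomaly_flow_def Let_def]
  fix t assume "t \<in> S"
  then have t: "t \<in> I" using assms(2) by blast
  show "hermitian_metric J (g t)" "hermitian_metric J (H t)" using flow t by blast+
  show "((\<lambda>s. of_real (norm_Psi \<zeta> (fund_form J (g s))) * power2_form (fund_form J (g s)) v) has_vector_derivative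
         \<i> * del br J 1 2 (delbar br J 1 1 (fund_form J (g t))) v
           - of_real (\<alpha>' / 4) * (trace_square (g t) (gauduchon_curvature br J \<tau> (g t)) v
               - trace_square (H t) (gauduchon_curvature br J \<kappa> (H t)) v)) (at t within S)" for v
    by (rule has_vector_derivative_within_subset[OF _ assms(2)]) (use flow t in blast)
  obtain H' where H': "\<And>u v. ((\<lambda>s. H s u v) has_real_derivative H' u v) (at t within I)"
    "endo_of (H t) H' = (\<lambda>u. \<epsilon> *\<^sub>R J (contracted_curvature (fund_form J (g t)) (gauduchon_curvature br J \<kappa> (H t)) u))"
    using flow t by blast
  show "\<exists>H'. (\<forall>u v. ((\<lambda>s. H s u v) has_real_derivative H' u v) (at t within S)) \<and>
    endo_of (H t) H' = (\<lambda>u. \<epsilon> *\<^sub>R J (contracted_curvature (fund_form J (g t)) (gauduchon_curvature br J \<kappa> (H t)) u))"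
    using DERIV_subset[OF H'(1) assms(2)] H'(2) by blast
qed

context comparison
begin

lemma close_Re: "close a a' \<Longrightarrow> close (\<lambda>t. Re (a t)) (\<lambda>t. Re (a' t))"
proof -
  assume "close a a'"
  then obtain B where B: "\<And>t. t \<in> S \<Longrightarrow> norm (a t) \<le> B" "\<And>t. t \<in> S \<Longrightarrow> norm (a' t) \<le> B"
    "\<And>t. t \<in> S \<Longrightarrow> norm (a t - a' t) \<le> B * d t" unfolding close_def by blast
  show ?thesis
  proof (rule closeI)
    fix t assume t: "t \<in> S"
    show "norm (Re (a t)) \<le> B" using abs_Re_le_cmod[of "a t"] B(1)[OF t] by simp
    show "norm (Re (a' t)) \<le> B" using abs_Re_le_cmod[of "a' t"] B(2)[OF t] by simp
    show "norm (Re (a t) - Re (a' t)) \<le> B * d t" using abs_Re_le_cmod[of "a t - a' t"] B(3)[OF t] by simp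
  qed
qed

text \<open>The starting point of all comparisons: compactness bounds the components that the defect
  sums up, and the defect itself bounds their differences with constant 1.\<close>

lemma close_if_continuous:
  assumes S: "compact S" and "continuous_on S a" "continuous_on S a'"
    and d: "\<And>t. t \<in> S \<Longrightarrow> norm (a t - a' t) \<le> d t"
  shows "close a a'"
proof -
  have "bounded (a ` S)" "bounded (a' ` S)"
    using assms by (auto intro!: compact_imp_bounded compact_continuous_image)
  then obtain B B' where "\<And>t. t \<in> S \<Longrightarrow> norm (a t) \<le> B" "\<And>t. t \<in> S \<Longrightarrow> norm (a' t) \<le> B'"
    unfolding bounded_iff by auto
  then show ?thesis using d by (intro closeI[where C = 1]) auto
qed

end

section \<open>The Lie algebra of the structure equations and its rotation\<close>

locale structure_equations = complex_frame J \<zeta> e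
  for J :: "'g::real_vector \<Rightarrow> 'g" and \<zeta> :: "3 \<Rightarrow> 'g \<Rightarrow> complex" and e +
  fixes br :: "'g \<Rightarrow> 'g \<Rightarrow> 'g" and x y \<rho> :: real
  assumes br_structure: "complex_structure br J"
    and d1: "ext_deriv br 1 (form1 (\<zeta> 1)) = (\<lambda>v. 0)"
    and d2: "ext_deriv br 1 (form1 (\<zeta> 2)) = (\<lambda>v. 0)"
    and d3: "ext_deriv br 1 (form1 (\<zeta> 3)) =
      (\<lambda>v. of_real \<rho> * zeta20 \<zeta> 1 2 v + zeta11 \<zeta> 1 1 v + Complex x y * zeta11 \<zeta> 2 2 v)"
begin

text \<open>As the coframe is injective, these formulas determine the bracket; its bilinearity,
  skewness and rotation invariance are read off from them.\<close>

lemma zeta_br: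
  "\<zeta> 1 (br u v) = 0" "\<zeta> 2 (br u v) = 0"
  "\<zeta> 3 (br u v) = - (of_real \<rho> * (\<zeta> 1 u * \<zeta> 2 v - \<zeta> 1 v * \<zeta> 2 u)
     + (\<zeta> 1 u * cnj (\<zeta> 1 v) - \<zeta> 1 v * cnj (\<zeta> 1 u))
     + Complex x y * (\<zeta> 2 u * cnj (\<zeta> 2 v) - \<zeta> 2 v * cnj (\<zeta> 2 u)))"
proof -
  let ?w = "\<lambda>i::nat. if i = 0 then u else v"
  show "\<zeta> 1 (br u v) = 0" using fun_cong[OF d1, of ?w] unfolding ext_deriv_form1 by simp
  show "\<zeta> 2 (br u v) = 0" using fun_cong[OF d2, of ?w] unfolding ext_deriv_form1 by simp
  show "\<zeta> 3 (br u v) = - (of_real \<rho> * (\<zeta> 1 u * \<zeta> 2 v - \<zeta> 1 v * \<zeta> 2 u)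
     + (\<zeta> 1 u * cnj (\<zeta> 1 v) - \<zeta> 1 v * cnj (\<zeta> 1 u))
     + Complex x y * (\<zeta> 2 u * cnj (\<zeta> 2 v) - \<zeta> 2 v * cnj (\<zeta> 2 u)))"
    using arg_cong[OF fun_cong[OF d3, of ?w], of uminus] unfolding ext_deriv_form1 zeta20_eq zeta11_eq minus_minus by simp
qed

lemma zeta_eqI3: "\<zeta> 1 u = \<zeta> 1 v \<Longrightarrow> \<zeta> 2 u = \<zeta> 2 v \<Longrightarrow> \<zeta> 3 u = \<zeta> 3 v \<Longrightarrow> u = v"
  by (rule zeta_eqI) (metis exhaust_3)

sublocale complex_bracket basis cobasis br J
proof (intro complex_bracket.intro complex_bracket_axioms.intro)
  show "bilinear br"
    unfolding bilinear_def linear_iff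
    by (intro conjI allI zeta_eqI3)
      (simp_all add: zeta_br zeta_simps scaleR_conv_of_real algebra_simps)
  show "br u v = - br v u" for u v
    by (rule zeta_eqI3) (simp_all add: zeta_br zeta_simps algebra_simps)
qed (rule real_basis.dual_basis_axioms, rule br_structure)

lemma rot_br: "rot (br u v) = br (rot u) (rot v)"
  by (rule zeta_eqI3) (simp_all add: zeta_br rot_def phase_def algebra_simps)

lemma symmetric_comparison_rot:
  "comparison S d \<Longrightarrow> symmetric_comparison basis cobasis br J S d rot rot_inv"
  by (intro symmetric_comparison.intro symmetric_comparison_axioms.intro complex_bracket_axioms
      linear_rot rot_rot_inv rot_J rot_br)

end

lemma exists_third_index: "\<exists>k::3. k \<noteq> i \<and> k \<noteq> j"
proof (rule ccontr)
  assume "\<not> ?thesis"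
  then have "(UNIV :: 3 set) \<subseteq> {i, j}" by auto
  from card_mono[OF _ this] have "CARD(3) \<le> card {i, j}" by simp
  also have "\<dots> \<le> 2" by (simp add: card_insert_if)
  finally show False by simp
qed

locale anomaly_flow_on_interval = structure_equations +
  fixes \<alpha>' \<tau> \<kappa> \<epsilon> a b :: real and g H :: "real \<Rightarrow> 'a \<Rightarrow> 'a \<Rightarrow> real"
  assumes flow: "anomaly_flow br J \<zeta> \<alpha>' \<tau> \<kappa> \<epsilon> {a..b} g H"
    and a_less_b: "a < b" and zero_mem: "0 \<in> {a..b}"
begin

lemma hermitian_g: "t \<in> {a..b} \<Longrightarrow> hermitian_metric J (g t)"
  and hermitian_H: "t \<in> {a..b} \<Longrightarrow> hermitian_metric J (H t)"
  using flow unfolding anomaly_flow_def Let_def by blast+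

lemma frame_metric_g: "t \<in> {a..b} \<Longrightarrow> complex_frame_metric J \<zeta> e (g t)"
  and frame_metric_H: "t \<in> {a..b} \<Longrightarrow> complex_frame_metric J \<zeta> e (H t)"
  by (intro complex_frame_metric.intro complex_frame_axioms complex_frame_metric_axioms.intro hermitian_g hermitian_H; assumption)+

definition Q :: "real \<Rightarrow> 'a form" where
  "Q t v = of_real (norm_Psi \<zeta> (fund_form J (g t))) * power2_form (fund_form J (g t)) v"

definition Q_velocity :: "real \<Rightarrow> 'a form" where
  "Q_velocity t v = \<i> * del br J 1 2 (delbar br J 1 1 (fund_form J (g t))) v
     - of_real (\<alpha>' / 4) * (trace_square (g t) (gauduchon_curvature br J \<tau> (g t)) v
         - trace_square (H t) (gauduchon_curvature br J \<kappa> (H t)) v)"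

definition H_velocity :: "real \<Rightarrow> 'a \<Rightarrow> 'a \<Rightarrow> real" where
  "H_velocity t u v =
     H t (\<epsilon> *\<^sub>R J (contracted_curvature (fund_form J (g t)) (gauduchon_curvature br J \<kappa> (H t)) u)) v"

lemma Q_derivative:
  "t \<in> {a..b} \<Longrightarrow> ((\<lambda>s. Q s v) has_vector_derivative Q_velocity t v) (at t within {a..b})"
  using flow unfolding anomaly_flow_def Let_def Q_def Q_velocity_def by blast

text \<open>The second flow equation equates a definite description, so it can be used only once
  \<open>H'\<close> is known to be representable. Linearity in the second argument is inherited from
  \<open>H\<close> by uniqueness of derivatives; Riesz representation then gives the endomorphism
  and nondegeneracy identifies it.\<close>

lemma H_derivative:
  assumes t: "t \<in> {a..b}"
  shows "((\<lambda>s. H s u v) has_real_derivative H_velocity t u v) (at t within {a..b})"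
proof -
  let ?K = "\<lambda>u. \<epsilon> *\<^sub>R J (contracted_curvature (fund_form J (g t)) (gauduchon_curvature br J \<kappa> (H t)) u)"
  obtain H' where H': "\<And>u v. ((\<lambda>s. H s u v) has_real_derivative H' u v) (at t within {a..b})"
    "endo_of (H t) H' = ?K"
    using flow t unfolding anomaly_flow_def Let_def by blast
  have inner: "inner_form (H s)" if "s \<in> {a..b}" for s
    by (rule hermitian_metric_inner_form[OF hermitian_H[OF that]])
  \<comment> \<open>On a nondegenerate interval every point, endpoints included, is a limit point,
    which makes derivatives within the interval unique.\<close>
  have nontriv: "at t within {a..b} \<noteq> bot"
    using t a_less_b by (simp add: trivial_limit_within islimpt_Icc)
  have unique: "D = D'" if "(f has_real_derivative D) (at t within {a..b})" "(f' has_real_derivative D') (at t within {a..b})"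
    "\<And>s. s \<in> {a..b} \<Longrightarrow> f s = f' s" for f f' D D'
  proof -
    have "(f has_real_derivative D') (at t within {a..b})"
      by (rule has_field_derivative_transform_within[OF that(2) zero_less_one t]) (simp add: that(3))
    then show ?thesis
      using that(1) vector_derivative_unique_within[OF nontriv]
      by (simp add: has_real_derivative_iff_has_vector_derivative)
  qed
  have "linear (H' u)" for u
  proof (rule linearI)
    fix v w c
    note lin = inner_form_linear_right[OF inner]
    show "H' u (v + w) = H' u v + H' u w"
      by (rule unique[OF H'(1) DERIV_add[OF H'(1) H'(1)]]) (simp add: linear_add[OF lin])
    show "H' u (c *\<^sub>R v) = c *\<^sub>R H' u v"
      unfolding real_scaleR_def
      by (rule unique[OF H'(1) DERIV_cmult[OF H'(1)]]) (simp add: linear_scale[OF lin])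
  qed
  then have "\<exists>X. \<forall>w. H t X w = H' u w" for u
    by (rule real_basis.exists_representer[OF inner[OF t]])
  then obtain K where K: "\<And>u w. H t (K u) w = H' u w" by metis
  have "endo_of (H t) H' = K"
    unfolding endo_of_def
  proof (rule the_equality)
    fix K' assume "\<forall>u v. H t (K' u) v = H' u v"
    then show "K' = K" by (intro ext inner_form_eqI[OF inner[OF t]]) (simp add: K)
  qed (simp add: K)
  then have eq: "K = ?K" using H'(2) by simp
  have "H_velocity t u v = H t (K u) v" unfolding H_velocity_def eq ..
  then have "H' u v = H_velocity t u v" using K by simp
  then show ?thesis using H'(1)[of u v] by simp
qed

lemma Q_continuous: "continuous_on {a..b} (\<lambda>t. Q t v)"
  using has_vector_derivative_continuous[OF Q_derivative] by (simp add: continuous_on_eq_continuous_within)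

lemma H_continuous: "continuous_on {a..b} (\<lambda>t. H t u v)"
  using DERIV_continuous[OF H_derivative] by (simp add: continuous_on_eq_continuous_within)

lemma minor_of_Q_continuous: "continuous_on {a..b} (\<lambda>t. minor_of (Q t) i j k)"
  unfolding minor_of_def by (intro continuous_intros Q_continuous)

lemma coeff_g_from_Q:
  assumes t: "t \<in> {a..b}" and ne: "i \<noteq> j" "i \<noteq> k" "j \<noteq> k"
  shows "coeff (g t) i i = (1 / 8) * (minor_of (Q t) i j j * minor_of (Q t) i k k - minor_of (Q t) i j k * minor_of (Q t) i k j)"
    and "coeff (g t) i j = (1 / 8) * (minor_of (Q t) k i j * minor_of (Q t) i j j + minor_of (Q t) i k j * minor_of (Q t) j i k)"
proof -
  interpret M: complex_frame_metric J \<zeta> e "g t" by (rule frame_metric_g[OF t])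
  show "coeff (g t) i i = (1 / 8) * (minor_of (Q t) i j j * minor_of (Q t) i k k - minor_of (Q t) i j k * minor_of (Q t) i k j)"
    by (rule M.coeff_from_power2(1)[OF M.norm_Psi_square ne Q_def])
  show "coeff (g t) i j = (1 / 8) * (minor_of (Q t) k i j * minor_of (Q t) i j j + minor_of (Q t) i k j * minor_of (Q t) j i k)"
    by (rule M.coeff_from_power2(2)[OF M.norm_Psi_square ne Q_def])
qed

lemma coeff_rot_g_from_Q:
  assumes t: "t \<in> {a..b}" and ne: "i \<noteq> j" "i \<noteq> k" "j \<noteq> k"
  defines "Q' \<equiv> \<lambda>v. Q t (\<lambda>i. rot (v i))"
  shows "coeff (\<lambda>u v. g t (rot u) (rot v)) i i
      = (1 / 8) * (minor_of Q' i j j * minor_of Q' i k k - minor_of Q' i j k * minor_of Q' i k j)"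
    and "coeff (\<lambda>u v. g t (rot u) (rot v)) i j
      = (1 / 8) * (minor_of Q' k i j * minor_of Q' i j j + minor_of Q' i k j * minor_of Q' j i k)"
proof -
  interpret M: complex_frame_metric J \<zeta> e "g t" by (rule frame_metric_g[OF t])
  interpret R: complex_frame_metric J \<zeta> e "\<lambda>u v. g t (rot u) (rot v)"
    by unfold_locales (rule M.hermitian_metric_rot)
  have Q': "Q' v = of_real (norm_Psi \<zeta> (fund_form J (g t))) * power2_form (fund_form J (\<lambda>u v. g t (rot u) (rot v))) v" for v
    by (simp add: Q'_def Q_def power2_form_def wedge_def fund_form_def rot_J)
  \<comment> \<open>The norm factor in \<open>Q'\<close> is that of the unrotated metric; rotation
    preserves the determinant, so the normalisation by 8 still holds.\<close>
  have n: "(norm_Psi \<zeta> (fund_form J (g t)))\<^sup>2 * R.coeff_det = 8"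
    unfolding M.coeff_det_rot by (rule M.norm_Psi_square)
  show "coeff (\<lambda>u v. g t (rot u) (rot v)) i i
      = (1 / 8) * (minor_of Q' i j j * minor_of Q' i k k - minor_of Q' i j k * minor_of Q' i k j)"
    by (rule R.coeff_from_power2(1)[OF n ne Q'])
  show "coeff (\<lambda>u v. g t (rot u) (rot v)) i j
      = (1 / 8) * (minor_of Q' k i j * minor_of Q' i j j + minor_of Q' i k j * minor_of Q' j i k)"
    by (rule R.coeff_from_power2(2)[OF n ne Q'])
qed

text \<open>Differentiability is given only for \<open>Q\<close>; the metric inherits continuity as
  a polynomial in the minors.\<close>

lemma coeff_g_continuous: "continuous_on {a..b} (\<lambda>t. coeff (g t) i j)"
proof (cases "i = j")
  case True
  obtain j' where j': "i \<noteq> j'" using exists_third_index[of i i] by metis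
  obtain k where k: "i \<noteq> k" "j' \<noteq> k" using exists_third_index[of i j'] by metis
  have "continuous_on {a..b} (\<lambda>t. (1 / 8) * (minor_of (Q t) i j' j' * minor_of (Q t) i k k - minor_of (Q t) i j' k * minor_of (Q t) i k j'))"
    by (intro continuous_intros minor_of_Q_continuous)
  then show ?thesis unfolding True[symmetric]
    by (rule continuous_on_eq) (rule coeff_g_from_Q(1)[OF _ j' k, symmetric])
next
  case False
  obtain k where k: "i \<noteq> k" "j \<noteq> k" using exists_third_index[of i j] by metis
  have "continuous_on {a..b} (\<lambda>t. (1 / 8) * (minor_of (Q t) k i j * minor_of (Q t) i j j + minor_of (Q t) i k j * minor_of (Q t) j i k))"
    by (intro continuous_intros minor_of_Q_continuous)
  then show ?thesis
    by (rule continuous_on_eq) (rule coeff_g_from_Q(2)[OF _ False k, symmetric])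
qed

lemma g_continuous: "continuous_on {a..b} (\<lambda>t. g t u v)"
proof -
  have "continuous_on {a..b} (\<lambda>t. Re (\<Sum>j\<in>UNIV. \<Sum>l\<in>UNIV. coeff (g t) j l * \<zeta> j u * cnj (\<zeta> l v)))"
    by (intro continuous_intros coeff_g_continuous)
  then show ?thesis
    by (rule continuous_on_eq) (rule complex_frame_metric.metric_eq[OF frame_metric_g, symmetric])
qed

lemma power3_form_rot:
  "power3_form (fund_form J h) (\<lambda>i. rot (v i)) = power3_form (fund_form J (\<lambda>u v. h (rot u) (rot v))) v"
  by (simp add: power3_form_def power2_form_def wedge_def fund_form_def rot_J)

text \<open>The volume of the basis is 6 times a continuous positive determinant, which attains its
  minimum on the interval and is unchanged by rotation.\<close>

lemma power3_form_bounded_below: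
  "\<exists>c>0. \<forall>t\<in>{a..b}. c \<le> norm (power3_form (fund_form J (g t)) basis)
     \<and> c \<le> norm (power3_form (fund_form J (g t)) (\<lambda>i. rot (basis i)))"
proof -
  let ?f = "\<lambda>t. Re (det (\<chi> j l. coeff (g t) j l))"
  have "continuous_on {a..b} ?f"
    unfolding det_3 vec_lambda_beta by (intro continuous_intros coeff_g_continuous)
  moreover have "{a..b} \<noteq> {}" using zero_mem by auto
  ultimately obtain s where s: "s \<in> {a..b}" "\<And>t. t \<in> {a..b} \<Longrightarrow> ?f s \<le> ?f t"
    using continuous_attains_inf[of "{a..b}" ?f] by auto
  interpret S: complex_frame_metric J \<zeta> e "g s" by (rule frame_metric_g[OF s(1)])
  show ?thesis
  proof (intro exI[of _ "6 * ?f s"] conjI ballI)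
    show "0 < 6 * ?f s" using S.coeff_det_pos by (simp add: S.coeff_det_def)
    fix t assume t: "t \<in> {a..b}"
    interpret M: complex_frame_metric J \<zeta> e "g t" by (rule frame_metric_g[OF t])
    interpret R: complex_frame_metric J \<zeta> e "\<lambda>u v. g t (rot u) (rot v)"
      by unfold_locales (rule M.hermitian_metric_rot)
    have f: "?f t = M.coeff_det" by (simp add: M.coeff_det_def)
    show "6 * ?f s \<le> norm (power3_form (fund_form J (g t)) basis)"
      unfolding M.power3_form_basis norm_of_real using s(2)[OF t] f by linarith
    show "6 * ?f s \<le> norm (power3_form (fund_form J (g t)) (\<lambda>i. rot (basis i)))"
      unfolding power3_form_rot R.power3_form_basis M.coeff_det_rot norm_of_real using s(2)[OF t] f by linarith
  qed
qed

text \<open>The values of the square of the fundamental form on these sequences determine \<open>minor_of\<close>,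
  hence the metric.\<close>

definition test_sequences :: "(nat \<Rightarrow> 'a) set" where
  "test_sequences = (\<lambda>(i, j, u). (!) [e i, J (e i), e j, u]) ` (UNIV \<times> UNIV \<times> (range e \<union> J ` range e))"

lemma finite_test_sequences: "finite test_sequences"
  unfolding test_sequences_def by (intro finite_imageI finite_cartesian_product finite_UnI) auto

definition Q_defect :: "(nat \<Rightarrow> 'a) \<Rightarrow> real \<Rightarrow> complex" where
  "Q_defect v t = Q t v - Q t (\<lambda>i. rot (v i))"

text \<open>Cast to the complex numbers so that both kinds of defect belong to one family in the
  Gronwall estimate.\<close>

definition H_defect :: "nat \<times> nat \<Rightarrow> real \<Rightarrow> complex" where
  "H_defect p t = of_real (H t (basis (fst p)) (basis (snd p)) - H t (rot (basis (fst p))) (rot (basis (snd p))))"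

definition defects :: "(real \<Rightarrow> complex) set" where
  "defects = Q_defect ` test_sequences \<union> H_defect ` ({..<6} \<times> {..<6})"

definition defect_size :: "real \<Rightarrow> real" where
  "defect_size t = (\<Sum>f\<in>defects. norm (f t))"

lemma finite_defects: "finite defects"
  unfolding defects_def using finite_test_sequences by auto

lemma norm_le_defect_size: "f \<in> defects \<Longrightarrow> norm (f t) \<le> defect_size t"
  unfolding defect_size_def using finite_defects by (intro member_le_sum) auto

sublocale compare: comparison "{a..b}" defect_size
  by unfold_locales (simp add: defect_size_def sum_nonneg)

sublocale compare: symmetric_comparison basis cobasis br J "{a..b}" defect_size rot rot_inv
  by (rule symmetric_comparison_rot) (rule compare.comparison_axioms)

lemma close_Q:
  assumes "v \<in> test_sequences"
  shows "compare.close (\<lambda>t. Q t v) (\<lambda>t. Q t (\<lambda>i. rot (v i)))"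
proof (rule compare.close_if_continuous)
  fix t
  have "Q_defect v \<in> defects" using assms by (simp add: defects_def)
  from norm_le_defect_size[OF this, of t] show "norm (Q t v - Q t (\<lambda>i. rot (v i))) \<le> defect_size t"
    by (simp add: Q_defect_def)
qed (simp_all add: Q_continuous)

lemma close_minor_of:
  "compare.close (\<lambda>t. minor_of (Q t) i j k) (\<lambda>t. minor_of (\<lambda>v. Q t (\<lambda>i. rot (v i))) i j k)"
  unfolding minor_of_def
  by (intro compare.close_cmult compare.close_diff close_Q) (force simp: test_sequences_def)+

lemma close_coeff:
  "compare.close (\<lambda>t. coeff (g t) i j) (\<lambda>t. coeff (\<lambda>u v. g t (rot u) (rot v)) i j)"
proof (cases "i = j")
  case True
  obtain j' where j': "i \<noteq> j'" using exists_third_index[of i i] by metis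
  obtain k where k: "i \<noteq> k" "j' \<noteq> k" using exists_third_index[of i j'] by metis
  show ?thesis
    unfolding True[symmetric]
    by (rule compare.close_cong[OF _ coeff_g_from_Q(1)[OF _ j' k, symmetric] coeff_rot_g_from_Q(1)[OF _ j' k, symmetric]])
      (intro compare.close_cmult compare.close_diff compare.close_mult close_minor_of)
next
  case False
  obtain k where k: "i \<noteq> k" "j \<noteq> k" using exists_third_index[of i j] by metis
  show ?thesis
    by (rule compare.close_cong[OF _ coeff_g_from_Q(2)[OF _ False k, symmetric] coeff_rot_g_from_Q(2)[OF _ False k, symmetric]])
      (intro compare.close_cmult compare.close_add compare.close_mult close_minor_of)
qed

lemma frame_metric_rot:
  assumes "complex_frame_metric J \<zeta> e h"
  shows "complex_frame_metric J \<zeta> e (\<lambda>u v. h (rot u) (rot v))"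
  by (intro complex_frame_metric.intro complex_frame_axioms complex_frame_metric_axioms.intro
      complex_frame_metric.hermitian_metric_rot[OF assms])

lemma close_g: "compare.close (\<lambda>t. g t u v) (\<lambda>t. g t (rot u) (rot v))"
  by (rule compare.close_cong[OF _ complex_frame_metric.metric_eq[OF frame_metric_g, symmetric]
        complex_frame_metric.metric_eq[OF frame_metric_rot[OF frame_metric_g], symmetric]])
    (intro compare.close_Re compare.close_sum compare.close_mult compare.close_const close_coeff)

text \<open>Unlike \<open>g\<close>, the metric \<open>H\<close> is itself differentiated by the
  flow, so its basis components enter the defect directly and bilinearity gives the rest.\<close>

lemma close_H: "compare.close (\<lambda>t. H t u v) (\<lambda>t. H t (rot u) (rot v))"
proof -
  have basis: "compare.close (\<lambda>t. H t (basis i) (basis j)) (\<lambda>t. H t (rot (basis i)) (rot (basis j)))"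
    if "i < 6" "j < 6" for i j
  proof (rule compare.close_if_continuous)
    fix t
    have "H_defect (i, j) \<in> defects" using that by (simp add: defects_def)
    from norm_le_defect_size[OF this, of t]
    show "norm (H t (basis i) (basis j) - H t (rot (basis i)) (rot (basis j))) \<le> defect_size t"
      by (simp only: H_defect_def fst_conv snd_conv norm_of_real real_norm_def)
  qed (simp_all add: H_continuous)
  have expand: "h u v = (\<Sum>i<6. \<Sum>j<6. cobasis i u * (cobasis j v * h (basis i) (basis j)))"
    if "inner_form h" for h :: "'a \<Rightarrow> 'a \<Rightarrow> real"
    using real_basis.linear_expand[OF inner_form_linear_left[OF that, of v], of u]
      real_basis.linear_expand[OF inner_form_linear_right[OF that], of _ v]
    by (simp add: sum_distrib_left)
  have inner: "inner_form (H t)" "inner_form (\<lambda>u v. H t (rot u) (rot v))" if "t \<in> {a..b}" for t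
    using hermitian_metric_inner_form[OF complex_frame_metric.herm] frame_metric_H[OF that]
      frame_metric_rot[OF frame_metric_H[OF that]] by blast+
  show ?thesis
    by (rule compare.close_cong[OF _ expand[OF inner(1), symmetric] expand[OF inner(2), symmetric]])
      (intro compare.close_sum compare.close_mult compare.close_const basis; simp)
qed

lemma metrics_close_intro:
  assumes h: "\<And>t. t \<in> {a..b} \<Longrightarrow> hermitian_metric J (h t)"
    and cont: "\<And>u v. continuous_on {a..b} (\<lambda>t. h t u v)"
    and close: "\<And>u v. compare.close (\<lambda>t. h t u v) (\<lambda>t. h t (rot u) (rot v))"
  shows "compare.metrics_close h"
proof -
  obtain c where c: "c > 0" "\<And>t u. t \<in> {a..b} \<Longrightarrow> c * (\<Sum>j\<in>UNIV. (cmod (\<zeta> j u))\<^sup>2) \<le> h t u u"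
    using uniformly_positive[OF compact_Icc h cont] by blast
  have "c * (\<Sum>k<6. (cobasis k u)\<^sup>2) \<le> h t u u" "c * (\<Sum>k<6. (cobasis k u)\<^sup>2) \<le> h t (rot u) (rot u)"
    if "t \<in> {a..b}" for t u
    using c(2)[OF that, of u] c(2)[OF that, of "rot u"] by (simp_all only: sum_cobasis_squares cmod_zeta_rot)
  then show ?thesis
    unfolding compare.metrics_close_def using h close c(1) by blast
qed

lemma metrics_close_g: "compare.metrics_close g"
  by (rule metrics_close_intro[OF hermitian_g g_continuous close_g])

lemma metrics_close_H: "compare.metrics_close H"
  by (rule metrics_close_intro[OF hermitian_H H_continuous close_H])

lemma close_Q_velocity: "compare.close (\<lambda>t. Q_velocity t v) (\<lambda>t. Q_velocity t (\<lambda>i. rot (v i)))"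
proof -
  have "compare.forms_close (\<lambda>t. del br J 1 2 (delbar br J 1 1 (fund_form J (g t))))
      (\<lambda>t. del br J 1 2 (delbar br J 1 1 (fund_form J (g t))))"
    by (intro compare.forms_close_del compare.forms_close_delbar compare.forms_close_fund_form metrics_close_g)
  then show ?thesis
    unfolding Q_velocity_def
    using compare.forms_close_trace_square[OF metrics_close_g, of \<tau>]
      compare.forms_close_trace_square[OF metrics_close_H, of \<kappa>]
    unfolding compare.forms_close_def by (intro compare.close_diff compare.close_cmult) blast+
qed

lemma close_H_velocity: "compare.close (\<lambda>t. H_velocity t u v) (\<lambda>t. H_velocity t (rot u) (rot v))"
proof -
  obtain c where c: "c > 0" "\<And>t. t \<in> {a..b} \<Longrightarrow> c \<le> norm (power3_form (fund_form J (g t)) basis)"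
    "\<And>t. t \<in> {a..b} \<Longrightarrow> c \<le> norm (power3_form (fund_form J (g t)) (\<lambda>i. rot (basis i)))"
    using power3_form_bounded_below by blast
  let ?K = "\<lambda>u t. contracted_curvature (fund_form J (g t)) (gauduchon_curvature br J \<kappa> (H t)) u"
  have K: "compare.vclose (?K u) (?K (rot u))"
    by (rule compare.vclose_contracted_curvature[OF metrics_close_g metrics_close_H c])
  have bil: "bilinear (\<lambda>u v. H t (\<epsilon> *\<^sub>R J u) v)" if "t \<in> {a..b}" for t
  proof -
    note inner = hermitian_metric_inner_form[OF hermitian_H[OF that]]
    have "linear (\<lambda>u. \<epsilon> *\<^sub>R J u)" using J_linear by (simp add: linear_iff algebra_simps)
    from linear_compose[OF this inner_form_linear_left[OF inner]] show ?thesis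
      using inner_form_linear_right[OF inner] by (simp add: bilinear_def o_def)
  qed
  have "compare.close (\<lambda>t. H t (\<epsilon> *\<^sub>R J u) v) (\<lambda>t. H t (\<epsilon> *\<^sub>R J (rot u)) (rot v))" for u v
    using close_H[of "\<epsilon> *\<^sub>R J u" v] by (simp only: linear_scale[OF linear_rot] rot_J)
  from compare.close_bilinear[where B = "\<lambda>t u v. H t (\<epsilon> *\<^sub>R J u) v" and B' = "\<lambda>t u v. H t (\<epsilon> *\<^sub>R J u) v",
      OF bil bil this K compare.vclose_const[of v]]
  show ?thesis by (simp only: H_velocity_def)
qed

lemma defect_derivative:
  assumes "f \<in> defects"
  shows "\<exists>f' C. 0 \<le> C \<and> (\<forall>t\<in>{a..b}. (f has_vector_derivative f' t) (at t within {a..b})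
    \<and> norm (f' t) \<le> C * defect_size t)"
proof -
  consider (Q) v where "f = Q_defect v" | (H) i j where "f = H_defect (i, j)"
    using assms unfolding defects_def by blast
  then show ?thesis
  proof cases
    case (Q v)
    let ?D = "\<lambda>t. Q_velocity t v - Q_velocity t (\<lambda>i. rot (v i))"
    have "(f has_vector_derivative ?D t) (at t within {a..b})" if "t \<in> {a..b}" for t
      unfolding Q Q_defect_def[abs_def] by (rule has_vector_derivative_diff[OF Q_derivative[OF that] Q_derivative[OF that]])
    moreover obtain C where "0 \<le> C" "\<forall>t\<in>{a..b}. norm (?D t) \<le> C * defect_size t"
      using compare.close_bounded_difference[OF close_Q_velocity[of v]] by blast
    ultimately show ?thesis by (intro exI[of _ ?D] exI[of _ C]) simp
  next
    case (H i j)
    let ?D = "\<lambda>t. H_velocity t (basis i) (basis j) - H_velocity t (rot (basis i)) (rot (basis j))"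
    have "(f has_vector_derivative of_real (?D t)) (at t within {a..b})" if "t \<in> {a..b}" for t
      unfolding H H_defect_def[abs_def] fst_conv snd_conv
      by (rule has_vector_derivative_of_real[OF DERIV_diff[OF H_derivative[OF that] H_derivative[OF that]]])
    moreover obtain C where "0 \<le> C" "\<forall>t\<in>{a..b}. norm (?D t) \<le> C * defect_size t"
      using compare.close_bounded_difference[OF close_H_velocity[of "basis i" "basis j"]] by blast
    ultimately show ?thesis
      by (intro exI[of _ "\<lambda>t. of_real (?D t)"] exI[of _ C] conjI ballI) (simp_all only: norm_of_real real_norm_def)
  qed
qed

lemma diagonal_metric_on_interval:
  assumes "diagonal_metric J \<zeta> (g 0)" "diagonal_metric J \<zeta> (H 0)" and t: "t \<in> {a..b}"
  shows "diagonal_metric J \<zeta> (g t) \<and> diagonal_metric J \<zeta> (H t)"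
proof -
  have inv: "g 0 (rot u) (rot v) = g 0 u v" "H 0 (rot u) (rot v) = H 0 u v" for u v
    using assms(1,2) complex_frame_metric.diagonal_metric_iff_invariant[OF frame_metric_g[OF zero_mem]]
      complex_frame_metric.diagonal_metric_iff_invariant[OF frame_metric_H[OF zero_mem]] by blast+
  have zero: "f 0 = 0" if "f \<in> defects" for f
    using that unfolding defects_def
    by (auto simp: Q_defect_def H_defect_def inv Q_def power2_form_def wedge_def fund_form_def rot_J[symmetric])
  obtain f' C where C: "\<And>f. f \<in> defects \<Longrightarrow> 0 \<le> C f"
    "\<And>f t. f \<in> defects \<Longrightarrow> t \<in> {a..b} \<Longrightarrow> (f has_vector_derivative f' f t) (at t within {a..b})"
    "\<And>f t. f \<in> defects \<Longrightarrow> t \<in> {a..b} \<Longrightarrow> norm (f' f t) \<le> C f * defect_size t"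
    using defect_derivative by metis
  have "f s = 0" if f: "f \<in> defects" and s: "s \<in> {a..b}" for f s
  proof (rule gronwall_family_zero[where K = defects and f = f and t = s and a = a and b = b and f' = f' and C = "\<Sum>f\<in>defects. C f",
      OF finite_defects _ _ _ _ zero_mem f s])
    fix f t assume f: "f \<in> defects" and t: "t \<in> {a..b}"
    \<comment> \<open>Each defect has its own constant; their sum serves for the whole finite
      family.\<close>
    have "C f \<le> (\<Sum>f\<in>defects. C f)" using f C(1) finite_defects by (intro member_le_sum) auto
    then have "C f * defect_size t \<le> (\<Sum>f\<in>defects. C f) * defect_size t"
      by (intro mult_right_mono compare.d_nonneg t)
    then show "norm (f' f t) \<le> (\<Sum>f\<in>defects. C f) * (\<Sum>f\<in>defects. norm (f t))"
      using C(3)[OF f t] by (simp add: defect_size_def)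
  qed (auto intro: sum_nonneg C(1) C(2) zero)
  then have "defect_size t = 0" using t unfolding defect_size_def by (intro sum.neutral) simp
  \<comment> \<open>Closeness bounds these differences by a multiple of the defect, so the finitely
    many tests yield invariance for all \<open>u\<close> and \<open>v\<close>.\<close>
  then have "g t (rot u) (rot v) = g t u v" "H t (rot u) (rot v) = H t u v" for u v
    using compare.close_bounded_difference[OF close_g[of u v]] compare.close_bounded_difference[OF close_H[of u v]] t
    by fastforce+
  then show ?thesis
    using complex_frame_metric.diagonal_metric_iff_invariant[OF frame_metric_g[OF t]]
      complex_frame_metric.diagonal_metric_iff_invariant[OF frame_metric_H[OF t]] by blast
qed

end

theorem theorem4:
  fixes \<A> :: "('a::{t2_space, second_countable_topology} set \<times> ('a \<Rightarrow> real ^ 6)) set"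
    and mul :: "'a \<Rightarrow> 'a \<Rightarrow> 'a" and e :: 'a and inverse :: "'a \<Rightarrow> 'a"
    and L :: "'g::real_vector \<Rightarrow> ('a \<Rightarrow> real) \<Rightarrow> 'a \<Rightarrow> real"
    and br :: "'g \<Rightarrow> 'g \<Rightarrow> 'g"
    and J :: "'g \<Rightarrow> 'g"
    and \<zeta> :: "3 \<Rightarrow> 'g \<Rightarrow> complex"
    and x y \<rho> :: real
    and \<alpha>' \<tau> \<kappa> \<epsilon> :: real
    and I :: "real set"
    and g H :: "real \<Rightarrow> 'g \<Rightarrow> 'g \<Rightarrow> real"
  assumes "lie_group mul e inverse \<A>"
    and "lie_algebra_of \<A> mul L br"
    and "complex_structure br J"
    and "\<not> complex_lie_group \<A> mul L J"
    and "coframe_10 J \<zeta>"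
    and "ext_deriv br 1 (form1 (\<zeta> 1)) = (\<lambda>v. 0)"
    and "ext_deriv br 1 (form1 (\<zeta> 2)) = (\<lambda>v. 0)"
    and "ext_deriv br 1 (form1 (\<zeta> 3)) =
      (\<lambda>v. of_real \<rho> * zeta20 \<zeta> 1 2 v + zeta11 \<zeta> 1 1 v + Complex x y * zeta11 \<zeta> 2 2 v)"
    and "\<rho> \<in> {0, 1}"
    and "\<epsilon> \<in> {1, -1}"
    and "is_interval I" and "0 \<in> I"
    and "anomaly_flow br J \<zeta> \<alpha>' \<tau> \<kappa> \<epsilon> I g H"
    and "diagonal_metric J \<zeta> (g 0)"
    and "diagonal_metric J \<zeta> (H 0)"
  shows "\<forall>t\<in>I. diagonal_metric J \<zeta> (g t) \<and> diagonal_metric J \<zeta> (H t)"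
proof
  fix t
  assume t: "t \<in> I"
  have J: "linear J" "\<And>u. J (J u) = - u" using assms(3) by (auto simp: complex_structure_def)
  have "\<exists>u. \<forall>j. \<zeta> j u = axis l 1 $ j" for l :: 3
    by (rule coframe_10_surjective[OF J assms(5)])
  then obtain E where E: "\<And>l j. \<zeta> j (E l) = axis l 1 $ j" by metis
  have frame: "complex_frame J \<zeta> E"
  proof (rule complex_frame.intro)
    show "linear (\<zeta> j)" "\<zeta> j (J u) = \<i> * \<zeta> j u" for j u
      using assms(5) by (auto simp: coframe_10_def form_10_def)
    show "u = 0" if "\<And>j. \<zeta> j u = 0" for u
      using coframe_10_injective[OF J assms(5)] that by blast
  qed (auto simp: J E axis_def)
  show "diagonal_metric J \<zeta> (g t) \<and> diagonal_metric J \<zeta> (H t)"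
  \<comment> \<open>For \<open>t = 0\<close> the interval below would shrink to a point, where
    derivatives within it are not unique.\<close>
  proof (cases "t = 0")
    case True
    then show ?thesis using assms(14,15) by simp
  next
    case False
    \<comment> \<open>\<open>I\<close> need not be compact, so all uniform constants are taken on
      the segment between zero and \<open>t\<close>.\<close>
    let ?a = "min 0 t" and ?b = "max 0 t"
    have "{?a..?b} \<subseteq> I"
      using mem_is_interval_1_I[OF assms(11) assms(12) t] mem_is_interval_1_I[OF assms(11) t assms(12)]
      by (cases "0 \<le> t") auto
    then have flow: "anomaly_flow br J \<zeta> \<alpha>' \<tau> \<kappa> \<epsilon> {?a..?b} g H"
      by (rule anomaly_flow_subset[OF assms(13)])
    interpret anomaly_flow_on_interval J \<zeta> E br x y \<rho> \<alpha>' \<tau> \<kappa> \<epsilon> ?a ?b g H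
      using frame assms(3,6-8) flow False
      by (intro anomaly_flow_on_interval.intro structure_equations.intro structure_equations_axioms.intro
          anomaly_flow_on_interval_axioms.intro) auto
    show ?thesis by (rule diagonal_metric_on_interval[OF assms(14,15)]) auto
  qed
qed

end
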